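(* Let $\lambda\in\mathbb{R}$ and let $u\in H^1(\Omega)$ be a weak solution of (P). Assume that (g.1) holds with $r>\frac N2$. Then $u\in L^\infty(\Omega)$.
   Context: $N\ge2$, $\Omega\subset\mathbb{R}^N$ bounded Lipschitz domain, $p\in(2,2^* )$ with $2^*=\frac{2N}{N-2}$ ($N\ge3$), $\infty$ ($N=2$). $A(x,s)=(a_{ij}(x,s))$ symmetric, $a_{ij}$ $C^1$-Carathéodory, $D_sA=(\partial_sa_{ij})$, and there are $C,\nu,R>0$ with: (a.1) $|a_{ij}|,|D_sa_{ij}|\le C$; (a.2) $A(x,s)\xi\cdot\xi\ge\nu|\xi|^2$; (a.3) $|s|\ge R\Rightarrow sD_sA(x,s)\xi\cdot\xi\ge0$ (a.e. $x$, all $s,\xi$). $g$ Carathéodory with (g.1) $|g(x,s)|\le a(x)+b|s|^{p-1}$, $a\in L^r(\Omega)$, $b\in\mathbb{R}$. Problem (P): $-\mathrm{div}(A(x,u)\nabla u)+\frac12D_sA(x,u)\nabla u\cdot\nabla u=g(x,u)-\lambda u$ in $\Omega$, $A(x,u)\nabla u\cdot\eta=0$ on $\partial\Omega$; weak solution: $u\in H^1(\Omega)$ with $\int_\Omega A(x,u)\nabla u\cdot\nabla v+\frac12\int_\Omega vD_sA(x,u)\nabla u\cdot\nabla u=\int_\Omega(g(x,u)-\lambda u)v$ for all $v\in C^\infty(\overline\Omega)$. *)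

theory Defs
  imports "HOL-Analysis.Analysis"
begin

fun Ck :: "nat \<Rightarrow> (real^'n \<Rightarrow> real) \<Rightarrow> bool" where
  "Ck 0 f = continuous_on UNIV f"
| "Ck (Suc k) f = (\<exists>G. (\<forall>x. (f has_derivative (\<lambda>h. G x \<bullet> h)) (at x)) \<and>
                        (\<forall>i. Ck k (\<lambda>x. G x $ i)))"

definition smooth_fun :: "(real^'n \<Rightarrow> real) \<Rightarrow> bool" where
  "smooth_fun f \<longleftrightarrow> (\<forall>k. Ck k f)"

definition has_grad :: "(real^'n \<Rightarrow> real) \<Rightarrow> (real^'n \<Rightarrow> real^'n) \<Rightarrow> bool" where
  "has_grad v gv \<longleftrightarrow> (\<forall>x. (v has_derivative (\<lambda>h. gv x \<bullet> h)) (at x))"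

definition lipschitz_domain :: "(real^'n) set \<Rightarrow> bool" where
  "lipschitz_domain \<Omega> \<longleftrightarrow> open \<Omega> \<and> connected \<Omega> \<and> \<Omega> \<noteq> {} \<and>
     (\<forall>x\<in>frontier \<Omega>. \<exists>r>0. \<exists>(e::real^'n) (\<gamma>::real^'n \<Rightarrow> real) L.
        norm e = 1 \<and> L-lipschitz_on {z. z \<bullet> e = 0} \<gamma> \<and>
        \<Omega> \<inter> ball x r = {y \<in> ball x r. y \<bullet> e > \<gamma> (y - (y \<bullet> e) *\<^sub>R e)})"

definition in_Lp :: "real \<Rightarrow> (real^'n) set \<Rightarrow> (real^'n \<Rightarrow> real) \<Rightarrow> bool" where
  "in_Lp q \<Omega> f \<longleftrightarrow> set_borel_measurable lebesgue \<Omega> f \<and>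
                     set_integrable lebesgue \<Omega> (\<lambda>x. \<bar>f x\<bar> powr q)"

definition in_Linf :: "(real^'n) set \<Rightarrow> (real^'n \<Rightarrow> real) \<Rightarrow> bool" where
  "in_Linf \<Omega> f \<longleftrightarrow> set_borel_measurable lebesgue \<Omega> f \<and>
                     (\<exists>M. AE x in lebesgue. x \<in> \<Omega> \<longrightarrow> \<bar>f x\<bar> \<le> M)"

definition weak_gradient :: "(real^'n) set \<Rightarrow> (real^'n \<Rightarrow> real) \<Rightarrow> (real^'n \<Rightarrow> real^'n) \<Rightarrow> bool" where
  "weak_gradient \<Omega> u Du \<longleftrightarrow>
     (\<forall>\<phi> g\<phi>. smooth_fun \<phi> \<longrightarrow> has_grad \<phi> g\<phi> \<longrightarrow>
        compact (closure {x. \<phi> x \<noteq> 0}) \<longrightarrow> closure {x. \<phi> x \<noteq> 0} \<subseteq> \<Omega> \<longrightarrow>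
        (\<forall>i. (LINT x:\<Omega>|lebesgue. u x * g\<phi> x $ i) = - (LINT x:\<Omega>|lebesgue. Du x $ i * \<phi> x)))"

definition H1_with_grad :: "(real^'n) set \<Rightarrow> (real^'n \<Rightarrow> real) \<Rightarrow> (real^'n \<Rightarrow> real^'n) \<Rightarrow> bool" where
  "H1_with_grad \<Omega> u Du \<longleftrightarrow> in_Lp 2 \<Omega> u \<and> (\<forall>i. in_Lp 2 \<Omega> (\<lambda>x. Du x $ i)) \<and>
                            weak_gradient \<Omega> u Du"

text \<open>Weak solution of (P); test functions v \<in> C^\<infinity>(closure \<Omega>) are taken as
  restrictions of smooth functions on R^N.\<close>
definition weak_solution ::
  "(real^'n) set \<Rightarrow> (real^'n \<Rightarrow> real \<Rightarrow> real^'n^'n) \<Rightarrow> (real^'n \<Rightarrow> real \<Rightarrow> real^'n^'n)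
     \<Rightarrow> (real^'n \<Rightarrow> real \<Rightarrow> real) \<Rightarrow> real \<Rightarrow> (real^'n \<Rightarrow> real) \<Rightarrow> bool" where
  "weak_solution \<Omega> A DA g lam u \<longleftrightarrow>
     (\<exists>Du. H1_with_grad \<Omega> u Du \<and>
       (\<forall>v gv. smooth_fun v \<longrightarrow> has_grad v gv \<longrightarrow>
          (LINT x:\<Omega>|lebesgue. (A x (u x) *v Du x) \<bullet> gv x)
          + 1/2 * (LINT x:\<Omega>|lebesgue. v x * ((DA x (u x) *v Du x) \<bullet> Du x))
          = (LINT x:\<Omega>|lebesgue. (g x (u x) - lam * u x) * v x)))"

end

theory Submission
  imports Defs
begin

text \<open>Testing the equation with a truncation \<open>\<phi>(u)\<close> of \<open>u\<close> that vanishes for \<open>\<bar>u\<bar> \<le> k\<close>, \<open>k \<ge> R\<close>, makes the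
  quadratic gradient term nonnegative by (a.3). With \<open>V = 1 + \<bar>\<lambda>\<bar> + \<bar>a\<bar> + \<bar>b\<bar> \<bar>u\<bar>\<^bsup>p-2\<^esup>\<close> and the Sobolev inequality for
  a subcritical exponent \<open>q\<close> close to the critical one, this bounds the square of the \<open>L\<^sup>q\<close> norm of \<open>(\<bar>u\<bar> - k)\<^sup>+\<close> by
  a multiple of \<open>\<integral> V \<bar>u\<bar> (\<bar>u\<bar> - k)\<^sup>+\<close>. Since \<open>r > N/2\<close> and \<open>p\<close> is subcritical, \<open>V\<close> lies in \<open>L\<^sup>s\<close> for some
  \<open>s > q/(q-2)\<close>, and Stampacchia's iteration over the levels \<open>k\<close> bounds \<open>u\<close>. Both the density of smooth functions
  in \<open>H\<^sup>1(\<Omega>)\<close> and the Sobolev inequality rest on the uniform interior cone property of a Lipschitz domain: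
  one mollifies, respectively averages, along the cone directions.\<close>

section \<open>Smooth functions\<close>

text \<open>The equation may be tested only with smooth functions, while its quadratic term is
  merely in L^1 and u need not be bounded. The truncations are therefore smooth bounded functions
  \<phi>_n, so that \<phi>_n(w) is a legitimate test function for every smooth w, and u is
  approached by smooth w_m whose values and gradients converge almost everywhere under one
  integrable majorant. Dominated convergence in m then handles the gradient term and the L^1 terms
  alike, and Fatou's lemma in n removes the smoothing. Strict inequalities pay for everything:
  q/(q-2) decreases to N/2 as q grows to 2N/(N-2), so r > N/2 leaves room for a subcritical q with r
  > q/(q-2), and q > p gives the same for |u|^(p-2), which lies in L^(q/(p-2)). For N = 2 every
  finite q is allowed. The strict inequality s > q/(q-2) is what makes the iteration superlinear;
  equality would only permit the absorption of the integral of V w^2, where w is the positive part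
  of |u| - k.\<close>

lemma has_grad_imp_continuous_on:
  assumes "has_grad f G"
  shows "continuous_on S f"
  using assms unfolding has_grad_def
  by (meson continuous_at_imp_continuous_on has_derivative_continuous)

lemma has_grad_unique:
  fixes f :: "real^'n \<Rightarrow> real"
  assumes "has_grad f G" "has_grad f H"
  shows "G = H"
proof
  fix x
  have "(\<lambda>h. G x \<bullet> h) = (\<lambda>h. H x \<bullet> h)"
    using assms unfolding has_grad_def by (meson has_derivative_unique)
  then show "G x = H x"
    by (metis vector_eq_ldot inner_commute)
qed

lemma Ck_Suc_iff: "Ck (Suc k) f \<longleftrightarrow> (\<exists>G. has_grad f G \<and> (\<forall>i. Ck k (\<lambda>x. G x $ i)))"
  by (simp add: has_grad_def)

lemma Ck_continuous_on: "Ck k f \<Longrightarrow> continuous_on S f"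
proof (cases k)
  case 0
  then show "Ck k f \<Longrightarrow> continuous_on S f" using continuous_on_subset by auto
next
  case (Suc m)
  then show "Ck k f \<Longrightarrow> continuous_on S f"
    using has_grad_imp_continuous_on unfolding Suc Ck_Suc_iff by blast
qed

lemma Ck_SucD: "Ck (Suc k) f \<Longrightarrow> Ck k f"
proof (induction k arbitrary: f)
  case 0
  then show ?case using Ck_continuous_on Ck.simps(1) by blast
next
  case (Suc k)
  then show ?case unfolding Ck_Suc_iff by blast
qed

text \<open>\<open>Ck (Suc k)\<close> supplies a gradient for each k separately; uniqueness of the
  derivative shows that it is the same one for all k, so smoothness can be peeled off one derivative
  at a time.\<close>

lemma smooth_fun_iff_grad:
  "smooth_fun f \<longleftrightarrow> (\<exists>G. has_grad f G \<and> (\<forall>i. smooth_fun (\<lambda>x. G x $ i)))"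
proof
  assume f: "smooth_fun f"
  then have "Ck (Suc 0) f" unfolding smooth_fun_def by blast
  then obtain G where G: "has_grad f G" unfolding Ck_Suc_iff by blast
  have "Ck k (\<lambda>x. G x $ i)" for k i
  proof -
    have "Ck (Suc k) f" using f unfolding smooth_fun_def by blast
    then obtain H where "has_grad f H" "\<forall>i. Ck k (\<lambda>x. H x $ i)" unfolding Ck_Suc_iff by blast
    then show ?thesis using has_grad_unique[OF G] by blast
  qed
  then show "\<exists>G. has_grad f G \<and> (\<forall>i. smooth_fun (\<lambda>x. G x $ i))"
    using G unfolding smooth_fun_def by blast
next
  assume "\<exists>G. has_grad f G \<and> (\<forall>i. smooth_fun (\<lambda>x. G x $ i))"
  then obtain G where G: "has_grad f G" "\<And>i k. Ck k (\<lambda>x. G x $ i)"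
    unfolding smooth_fun_def by blast
  then have "Ck (Suc k) f" for k unfolding Ck_Suc_iff by blast
  then show "smooth_fun f"
    unfolding smooth_fun_def using Ck_SucD by blast
qed

lemma smooth_funE:
  assumes "smooth_fun f"
  obtains G where "has_grad f G" "\<And>i. smooth_fun (\<lambda>x. G x $ i)"
  using assms smooth_fun_iff_grad by blast

lemma smooth_fun_continuous_on: "smooth_fun f \<Longrightarrow> continuous_on S f"
  unfolding smooth_fun_def using Ck_continuous_on by blast

lemma continuous_on_vec_components:
  fixes G :: "'a::topological_space \<Rightarrow> real^'n"
  assumes "\<And>i. continuous_on S (\<lambda>x. G x $ i)"
  shows "continuous_on S G"
proof -
  have "continuous_on S (\<lambda>x. \<chi> i. G x $ i)"
    by (rule continuous_on_vec_lambda) (rule assms)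
  then show ?thesis by simp
qed

lemma smooth_fun_grad_component:
  assumes "smooth_fun f" "has_grad f G"
  shows "smooth_fun (\<lambda>x. G x $ i)"
  using assms has_grad_unique smooth_funE by metis

lemma smooth_fun_grad_continuous_on:
  assumes "smooth_fun f" "has_grad f G"
  shows "continuous_on S G"
  by (intro continuous_on_vec_components smooth_fun_continuous_on smooth_fun_grad_component[OF assms])

section \<open>Calculus rules for gradients and smooth functions\<close>

lemma has_grad_const: "has_grad (\<lambda>x::real^'n. c) (\<lambda>x. 0)"
proof -
  have "(\<lambda>h. (0::real^'n) \<bullet> h) = (\<lambda>h. 0)" by auto
  then show ?thesis unfolding has_grad_def by (auto simp only: has_derivative_const)
qed

lemma has_grad_add:
  assumes "has_grad f F" "has_grad g G"
  shows "has_grad (\<lambda>x. f x + g x) (\<lambda>x. F x + G x)"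
  using assms unfolding has_grad_def
  by (auto simp: inner_add_left intro!: derivative_eq_intros)

lemma has_grad_mult:
  assumes "has_grad f F" "has_grad g G"
  shows "has_grad (\<lambda>x. f x * g x) (\<lambda>x. g x *\<^sub>R F x + f x *\<^sub>R G x)"
  unfolding has_grad_def
proof
  fix x
  have "(f has_derivative (\<lambda>h. F x \<bullet> h)) (at x)" "(g has_derivative (\<lambda>h. G x \<bullet> h)) (at x)"
    using assms unfolding has_grad_def by auto
  then show "((\<lambda>x. f x * g x) has_derivative (\<lambda>h. (g x *\<^sub>R F x + f x *\<^sub>R G x) \<bullet> h)) (at x)"
    by (auto simp: inner_add_left algebra_simps intro!: derivative_eq_intros)
qed

lemma has_grad_compose:
  assumes "has_grad g G" "\<And>x. (f has_real_derivative f' (g x)) (at (g x))"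
  shows "has_grad (\<lambda>x. f (g x)) (\<lambda>x. f' (g x) *\<^sub>R G x)"
  unfolding has_grad_def
proof
  fix x
  have "(g has_derivative (\<lambda>h. G x \<bullet> h)) (at x)"
    using assms unfolding has_grad_def by auto
  from has_derivative_compose[OF this has_field_derivative_imp_has_derivative[OF assms(2)]]
  show "((\<lambda>x. f (g x)) has_derivative (\<lambda>h. (f' (g x) *\<^sub>R G x) \<bullet> h)) (at x)"
    by simp
qed

lemma Ck_const: "Ck k (\<lambda>x. c)"
proof (induction k arbitrary: c)
  case (Suc k)
  then show ?case unfolding Ck_Suc_iff
    by (intro exI[of _ "\<lambda>x. 0"]) (auto simp: has_grad_const)
qed auto

lemma Ck_add: "Ck k f \<Longrightarrow> Ck k g \<Longrightarrow> Ck k (\<lambda>x. f x + g x)"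
proof (induction k arbitrary: f g)
  case 0
  then show ?case by (auto intro: continuous_intros)
next
  case (Suc k)
  then obtain F G where "has_grad f F" "\<And>i. Ck k (\<lambda>x. F x $ i)" "has_grad g G" "\<And>i. Ck k (\<lambda>x. G x $ i)"
    unfolding Ck_Suc_iff by blast
  then show ?case unfolding Ck_Suc_iff
    by (intro exI[of _ "\<lambda>x. F x + G x"]) (auto intro: has_grad_add Suc.IH)
qed

lemma Ck_mult: "Ck k f \<Longrightarrow> Ck k g \<Longrightarrow> Ck k (\<lambda>x. f x * g x)"
proof (induction k arbitrary: f g)
  case 0
  then show ?case by (auto intro: continuous_intros)
next
  case (Suc k)
  then obtain F G where "has_grad f F" "\<And>i. Ck k (\<lambda>x. F x $ i)" "has_grad g G" "\<And>i. Ck k (\<lambda>x. G x $ i)"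
    unfolding Ck_Suc_iff by blast
  moreover have "Ck k f" "Ck k g" using Suc.prems Ck_SucD by blast+
  ultimately show ?case unfolding Ck_Suc_iff
    by (intro exI[of _ "\<lambda>x. g x *\<^sub>R F x + f x *\<^sub>R G x"]) (auto intro!: has_grad_mult Ck_add Suc.IH)
qed

lemma smooth_fun_const: "smooth_fun (\<lambda>x. c)"
  by (simp add: smooth_fun_def Ck_const)

lemma smooth_fun_add: "smooth_fun f \<Longrightarrow> smooth_fun g \<Longrightarrow> smooth_fun (\<lambda>x. f x + g x)"
  by (simp add: smooth_fun_def Ck_add)

lemma smooth_fun_mult: "smooth_fun f \<Longrightarrow> smooth_fun g \<Longrightarrow> smooth_fun (\<lambda>x. f x * g x)"
  by (simp add: smooth_fun_def Ck_mult)

lemma smooth_fun_minus: "smooth_fun f \<Longrightarrow> smooth_fun (\<lambda>x. - f x)"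
  using smooth_fun_mult[OF smooth_fun_const[of "-1"]] by simp

lemma smooth_fun_diff: "smooth_fun f \<Longrightarrow> smooth_fun g \<Longrightarrow> smooth_fun (\<lambda>x. f x - g x)"
  using smooth_fun_add[OF _ smooth_fun_minus] by fastforce

lemma smooth_fun_sum: "(\<And>i. i \<in> I \<Longrightarrow> smooth_fun (f i)) \<Longrightarrow> smooth_fun (\<lambda>x. \<Sum>i\<in>I. f i x)"
  by (induction I rule: infinite_finite_induct) (auto intro: smooth_fun_add smooth_fun_const)

text \<open>The outer function comes with its whole chain of derivatives. The induction has to treat
  all j at once, since the gradient of \<open>F j (g x)\<close> involves
  \<open>F (Suc j) (g x)\<close>.\<close>

lemma smooth_fun_compose_seq:
  assumes F: "\<And>k x. (F k has_real_derivative F (Suc k) x) (at x)"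
    and g: "smooth_fun g"
  shows "smooth_fun (\<lambda>x. F j (g x))"
proof -
  obtain G where G: "has_grad g G" "\<And>i. smooth_fun (\<lambda>x. G x $ i)"
    using g by (rule smooth_funE) blast
  have "Ck k (\<lambda>x. F j (g x))" for k
  proof (induction k arbitrary: j)
    case 0
    have "continuous_on UNIV (F j)"
      by (meson DERIV_continuous continuous_at_imp_continuous_on F)
    then show ?case using smooth_fun_continuous_on[OF g]
      by (simp, metis continuous_on_compose2 subset_UNIV)
  next
    case (Suc k)
    have "Ck k (\<lambda>x. (F (Suc j) (g x) *\<^sub>R G x) $ i)" for i
      using Suc[of "Suc j"] G(2)[of i] by (simp add: Ck_mult smooth_fun_def)
    then show ?case unfolding Ck_Suc_iff
      by (intro exI[of _ "\<lambda>x. F (Suc j) (g x) *\<^sub>R G x"]) (simp add: has_grad_compose[OF G(1) F])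
  qed
  then show ?thesis by (simp add: smooth_fun_def)
qed

lemma smooth_fun_exp: "smooth_fun g \<Longrightarrow> smooth_fun (\<lambda>x. exp (g x))"
  by (rule smooth_fun_compose_seq[of "\<lambda>_. exp" _ 0]) (auto intro: DERIV_exp)

text \<open>The composition lemma asks for derivatives on the whole line, which t -> 1/t does not
  have at 0. Instead, the gradient is again a product of \<open>inverse (g x)\<close> and smooth
  functions, so an induction on the order of differentiability closes.\<close>

lemma smooth_fun_inverse:
  assumes g: "smooth_fun g" and nz: "\<And>x. g x \<noteq> 0"
  shows "smooth_fun (\<lambda>x. inverse (g x))"
proof -
  obtain G where G: "has_grad g G" "\<And>i. smooth_fun (\<lambda>x. G x $ i)"
    using g by (rule smooth_funE) blast
  have *: "has_grad (\<lambda>x. inverse (g x)) (\<lambda>x. - (inverse (g x) * inverse (g x)) *\<^sub>R G x)"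
    by (rule has_grad_compose[OF G(1)]) (auto simp: nz intro!: derivative_eq_intros)
  have "Ck k (\<lambda>x. inverse (g x))" for k
  proof (induction k)
    case 0
    then show ?case using has_grad_imp_continuous_on[OF *] by simp
  next
    case (Suc k)
    have "Ck k (\<lambda>x. (-1) * (inverse (g x) * inverse (g x) * (G x $ i)))" for i
      using G(2)[of i] by (intro Ck_mult Suc Ck_const) (auto simp: smooth_fun_def)
    then show ?case unfolding Ck_Suc_iff
      using * by (intro exI[of _ "\<lambda>x. - (inverse (g x) * inverse (g x)) *\<^sub>R G x"]) (auto simp: mult.assoc)
  qed
  then show ?thesis by (simp add: smooth_fun_def)
qed

lemma smooth_fun_component: "smooth_fun (\<lambda>x::real^'n. x $ i)"
proof -
  have *: "(\<lambda>h. axis i 1 \<bullet> h) = (\<lambda>h::real^'n. h $ i)" by (auto simp: inner_axis')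
  have "has_grad (\<lambda>x. x $ i) (\<lambda>x. axis i 1)"
    unfolding has_grad_def * by (auto intro!: bounded_linear_imp_has_derivative bounded_linear_vec_nth)
  then show ?thesis
    by (subst smooth_fun_iff_grad) (auto simp: smooth_fun_const)
qed

lemma smooth_fun_norm_sq: "smooth_fun (\<lambda>x::real^'n. (norm (x - a))\<^sup>2)"
proof -
  have "smooth_fun (\<lambda>x::real^'n. \<Sum>i\<in>UNIV. (x $ i - a $ i) * (x $ i - a $ i))"
    by (intro smooth_fun_sum smooth_fun_mult smooth_fun_diff smooth_fun_component smooth_fun_const)
  then show ?thesis
    by (simp add: power2_norm_eq_inner inner_vec_def)
qed

section \<open>Flat functions, bumps and cutoffs\<close>

definition flat :: "real poly \<Rightarrow> real \<Rightarrow> real" where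
  "flat P t = (if t > 0 then poly P (1 / t) * exp (- (1 / t)) else 0)"


lemma tendsto_poly_mult_exp_uminus: "((\<lambda>x. poly P x * exp (- x)) \<longlongrightarrow> (0::real)) at_top"
proof -
  have "((\<lambda>x. \<Sum>i\<le>degree P. coeff P i * (x ^ i / exp x)) \<longlongrightarrow> (\<Sum>i\<le>degree P. coeff P i * 0)) at_top"
    by (intro tendsto_intros tendsto_power_div_exp_0)
  then show ?thesis
    by (simp add: poly_altdef sum_distrib_right exp_minus divide_inverse mult.assoc)
qed

lemma tendsto_flat_0: "(flat P \<longlongrightarrow> 0) (at 0)"
proof -
  have "((\<lambda>t. poly P (inverse t) * exp (- inverse t)) \<longlongrightarrow> 0) (at_right 0)"
    by (rule filterlim_compose[OF tendsto_poly_mult_exp_uminus filterlim_inverse_at_top_right])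
  then have "(flat P \<longlongrightarrow> 0) (at_right 0)"
    by (rule Lim_transform_eventually)
      (auto simp: flat_def inverse_eq_divide eventually_at_filter)
  moreover have "(flat P \<longlongrightarrow> 0) (at_left 0)"
    by (rule Lim_transform_eventually[OF tendsto_const]) (auto simp: flat_def eventually_at_filter)
  ultimately show ?thesis
    by (simp add: filterlim_at_split)
qed

text \<open>The functions P(1/t) exp(-1/t), extended by 0 to t \<le> 0, are closed under
  differentiation: the derivative replaces P by X^2 (P - P'). One formula thus provides all
  derivatives of exp(-1/t).\<close>

lemma DERIV_flat: "(flat P has_real_derivative flat (monom 1 2 * (P - pderiv P)) t) (at t)"
proof -
  consider "t > 0" | "t < 0" | "t = 0" by linarith
  then show ?thesis
  proof cases
    case 1
    have d1: "((\<lambda>t. 1 / t) has_real_derivative - (1 / t\<^sup>2)) (at t)"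
      using 1 by (auto intro!: derivative_eq_intros simp: power2_eq_square)
    have d2: "((\<lambda>t. poly P (1 / t)) has_real_derivative poly (pderiv P) (1 / t) * (- (1 / t\<^sup>2))) (at t)"
      by (rule DERIV_chain2[OF poly_DERIV d1])
    have d3: "((\<lambda>t. exp (- (1 / t))) has_real_derivative exp (- (1 / t)) * (1 / t\<^sup>2)) (at t)"
      using DERIV_chain2[OF DERIV_exp DERIV_minus[OF d1]] by simp
    have "flat (monom 1 2 * (P - pderiv P)) t
        = poly (pderiv P) (1 / t) * (- (1 / t\<^sup>2)) * exp (- (1 / t)) + exp (- (1 / t)) * (1 / t\<^sup>2) * poly P (1 / t)"
      using 1 by (simp add: flat_def poly_monom power_divide) (simp add: algebra_simps diff_divide_distrib)
    then have "((\<lambda>t. poly P (1 / t) * exp (- (1 / t))) has_real_derivative flat (monom 1 2 * (P - pderiv P)) t) (at t)"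
      using DERIV_mult[OF d2 d3] by simp
    moreover have e: "eventually (\<lambda>t. flat P t = poly P (1 / t) * exp (- (1 / t))) (nhds t)"
      using eventually_nhds_in_open[of "{0<..}" t] 1 by (auto elim!: eventually_mono simp: flat_def)
    ultimately show ?thesis using iffD2[OF DERIV_cong_ev[OF refl e refl]] by blast
  next
    case 2
    have "((\<lambda>t. 0) has_real_derivative flat (monom 1 2 * (P - pderiv P)) t) (at t)"
      using 2 by (simp add: flat_def)
    moreover have e: "eventually (\<lambda>t. flat P t = 0) (nhds t)"
      using eventually_nhds_in_open[of "{..<0}" t] 2 by (auto elim!: eventually_mono simp: flat_def)
    ultimately show ?thesis using iffD2[OF DERIV_cong_ev[OF refl e refl]] by blast
  next
    case 3
    \<comment> \<open>Dividing by h > 0 multiplies the polynomial in 1/h by its variable, so the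
      difference quotient at 0 is again a flat function and tends to 0.\<close>
    have "((\<lambda>h. (flat P (0 + h) - flat P 0) / h) \<longlongrightarrow> 0) (at 0)"
      by (rule Lim_transform_eventually[OF tendsto_flat_0[of "monom 1 1 * P"]])
        (auto simp: flat_def poly_monom eventually_at_filter)
    then show ?thesis using 3 by (simp add: DERIV_def flat_def)
  qed
qed

lemma smooth_fun_flat:
  assumes "smooth_fun g"
  shows "smooth_fun (\<lambda>x. flat P (g x))"
proof -
  define F where "F k = flat (((\<lambda>P. monom 1 2 * (P - pderiv P)) ^^ k) P)" for k
  have "(F k has_real_derivative F (Suc k) x) (at x)" for k x
    unfolding F_def using DERIV_flat by simp
  from smooth_fun_compose_seq[of F g 0, OF this assms] show ?thesis
    by (simp add: F_def)
qed

lemma flat_1_pos: "t > 0 \<Longrightarrow> flat 1 t > 0"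
  and flat_nonpos: "t \<le> 0 \<Longrightarrow> flat P t = 0"
  by (auto simp: flat_def)

lemma flat_1_nonneg: "flat 1 t \<ge> 0"
  by (auto simp: flat_def)

text \<open>The squared distance is used because, unlike the distance, it is smooth at the centre as
  well.\<close>

lemma smooth_bump:
  fixes a :: "real^'n"
  assumes "r > 0"
  obtains k where "smooth_fun k" "\<And>x. k x \<ge> 0" "\<And>x. k x > 0 \<longleftrightarrow> x \<in> ball a r"
proof
  have "smooth_fun (\<lambda>x. r\<^sup>2 - (norm (x - a))\<^sup>2)"
    by (intro smooth_fun_diff smooth_fun_const smooth_fun_norm_sq)
  then show "smooth_fun (\<lambda>x. flat 1 (r\<^sup>2 - (norm (x - a))\<^sup>2))" by (rule smooth_fun_flat)
  show "flat 1 (r\<^sup>2 - (norm (x - a))\<^sup>2) \<ge> 0" for x by (rule flat_1_nonneg)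
  have "(norm (x - a))\<^sup>2 < r\<^sup>2 \<longleftrightarrow> norm (x - a) < r" for x
    using assms by (smt (verit) norm_ge_zero power2_less_imp_less power_strict_mono zero_less_numeral)
  then show "flat 1 (r\<^sup>2 - (norm (x - a))\<^sup>2) > 0 \<longleftrightarrow> x \<in> ball a r" for x
    unfolding flat_def mem_ball dist_commute[of a] by (simp add: dist_norm)
qed

text \<open>With \<beta> = \<open>flat 1\<close> and n the squared distance to a, the cutoff is
  \<beta>(R^2 - n) divided by \<beta>(R^2 - n) + \<beta>(n - r^2). Because r < R, the two terms of
  the denominator never vanish together, and the second one vanishes on the inner ball.\<close>

lemma smooth_cutoff:
  fixes a :: "real^'n"
  assumes "0 < r" "r < R"
  obtains k where "smooth_fun k" "\<And>x. x \<in> ball a r \<Longrightarrow> k x = 1" "\<And>x. x \<notin> ball a R \<Longrightarrow> k x = 0"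
proof
  define n where "n x = (norm (x - a))\<^sup>2" for x
  define d where "d x = flat 1 (R\<^sup>2 - n x) + flat 1 (n x - r\<^sup>2)" for x
  have rR: "r\<^sup>2 < R\<^sup>2" using assms by (simp add: power_strict_mono)
  have pos: "d x > 0" for x
  proof (cases "n x < R\<^sup>2")
    case True
    then show ?thesis unfolding d_def
      using flat_1_pos[of "R\<^sup>2 - n x"] flat_1_nonneg[of "n x - r\<^sup>2"] by linarith
  next
    case False
    then show ?thesis unfolding d_def
      using flat_1_pos[of "n x - r\<^sup>2"] flat_1_nonneg[of "R\<^sup>2 - n x"] rR by linarith
  qed
  have s: "smooth_fun n" unfolding n_def by (rule smooth_fun_norm_sq)
  have "smooth_fun d" unfolding d_def
    by (intro smooth_fun_add smooth_fun_flat smooth_fun_diff smooth_fun_const s)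
  then show "smooth_fun (\<lambda>x. flat 1 (R\<^sup>2 - n x) * inverse (d x))"
    by (intro smooth_fun_mult smooth_fun_inverse smooth_fun_flat smooth_fun_diff smooth_fun_const s)
      (use pos in \<open>auto simp: less_le\<close>)
  show "flat 1 (R\<^sup>2 - n x) * inverse (d x) = 1" if "x \<in> ball a r" for x
  proof -
    have "n x \<le> r\<^sup>2" using that unfolding n_def
      by (intro power_mono) (auto simp: dist_norm norm_minus_commute)
    then have "d x = flat 1 (R\<^sup>2 - n x)" by (simp add: d_def flat_nonpos)
    then show ?thesis using pos[of x] by auto
  qed
  show "flat 1 (R\<^sup>2 - n x) * inverse (d x) = 0" if "x \<notin> ball a R" for x
  proof -
    have "n x \<ge> R\<^sup>2" using that assms unfolding n_def
      by (intro power_mono) (auto simp: dist_norm norm_minus_commute)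
    then show ?thesis by (simp add: flat_nonpos)
  qed
qed

section \<open>Mollification\<close>

lemma nn_integral_lborel_affine:
  fixes f :: "'a::euclidean_space \<Rightarrow> ennreal"
  assumes [measurable]: "f \<in> borel_measurable borel" and c: "c \<noteq> 0"
  shows "(\<integral>\<^sup>+x. f x \<partial>lborel) = ennreal (\<bar>c\<bar> ^ DIM('a)) * (\<integral>\<^sup>+x. f (t + c *\<^sub>R x) \<partial>lborel)"
  by (subst lborel_affine[OF c, of t])
     (simp add: nn_integral_density nn_integral_distr nn_integral_cmult)

lemma nn_integral_lborel_translate:
  fixes f :: "'a::euclidean_space \<Rightarrow> ennreal"
  assumes "f \<in> borel_measurable borel"
  shows "(\<integral>\<^sup>+x. f (x + t) \<partial>lborel) = (\<integral>\<^sup>+x. f x \<partial>lborel)"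
  using nn_integral_lborel_affine[OF assms, of 1 t] by (simp add: add.commute)

lemma power2_add_le: "((a::real) + b)\<^sup>2 \<le> 2 * a\<^sup>2 + 2 * b\<^sup>2"
  using sum_squares_bound[of a b] by (simp add: power2_sum)

lemma power2_add3_le: "((a::real) + b + c)\<^sup>2 \<le> 4 * a\<^sup>2 + 4 * b\<^sup>2 + 2 * c\<^sup>2"
  using power2_add_le[of "a + b" c] power2_add_le[of a b] by linarith

lemma nn_integral_square_add_le:
  fixes f g :: "'a \<Rightarrow> real"
  assumes [measurable]: "f \<in> borel_measurable M" "g \<in> borel_measurable M"
  shows "(\<integral>\<^sup>+x. ennreal ((f x + g x)\<^sup>2) \<partial>M) \<le> 2 * (\<integral>\<^sup>+x. ennreal ((f x)\<^sup>2) \<partial>M) + 2 * (\<integral>\<^sup>+x. ennreal ((g x)\<^sup>2) \<partial>M)"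
proof -
  have "(\<integral>\<^sup>+x. ennreal ((f x + g x)\<^sup>2) \<partial>M) \<le> (\<integral>\<^sup>+x. 2 * ennreal ((f x)\<^sup>2) + 2 * ennreal ((g x)\<^sup>2) \<partial>M)"
  proof (rule nn_integral_mono)
    fix x
    have "ennreal ((f x + g x)\<^sup>2) \<le> ennreal (2 * (f x)\<^sup>2 + 2 * (g x)\<^sup>2)"
      by (intro ennreal_leI power2_add_le)
    then show "ennreal ((f x + g x)\<^sup>2) \<le> 2 * ennreal ((f x)\<^sup>2) + 2 * ennreal ((g x)\<^sup>2)"
      by (simp add: ennreal_plus ennreal_mult)
  qed
  then show ?thesis by (simp add: nn_integral_add nn_integral_cmult)
qed

section \<open>Continuous approximation and continuity of translations in L^2\<close>

definition trunc_at :: "real \<Rightarrow> real \<Rightarrow> real" where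
  "trunc_at T x = max (- T) (min T x)"

lemma abs_trunc_at_le: "T \<ge> 0 \<Longrightarrow> \<bar>trunc_at T x\<bar> \<le> T"
  by (auto simp: trunc_at_def)

lemma trunc_at_id: "\<bar>x\<bar> \<le> T \<Longrightarrow> trunc_at T x = x"
  by (auto simp: trunc_at_def)

lemma abs_diff_trunc_at_le: "T \<ge> 0 \<Longrightarrow> \<bar>x - trunc_at T x\<bar> \<le> \<bar>x\<bar>"
  by (auto simp: trunc_at_def)

lemma continuous_on_trunc_at [continuous_intros]: "continuous_on S f \<Longrightarrow> continuous_on S (\<lambda>x. trunc_at T (f x))"
  unfolding trunc_at_def by (intro continuous_intros)

lemma tendsto_trunc_at: "(f \<longlongrightarrow> l) F \<Longrightarrow> ((\<lambda>x. trunc_at T (f x)) \<longlongrightarrow> trunc_at T l) F"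
  unfolding trunc_at_def by (intro tendsto_intros)

lemma borel_measurable_trunc_at [measurable]: "f \<in> borel_measurable M \<Longrightarrow> (\<lambda>x. trunc_at T (f x)) \<in> borel_measurable M"
  unfolding trunc_at_def by (intro borel_measurable_max borel_measurable_min) auto

lemma tendsto_ennreal_0_le:
  fixes X :: "nat \<Rightarrow> ennreal"
  assumes "X \<longlonglongrightarrow> 0" "e > 0"
  obtains n where "X n \<le> ennreal e"
proof -
  have "eventually (\<lambda>n. X n < ennreal e) sequentially"
    using assms by (intro order_tendstoD) auto
  then show ?thesis using that by (metis eventually_happens' less_imp_le sequentially_bot)
qed

lemma L2_truncation:
  fixes f :: "'a \<Rightarrow> real"
  assumes [measurable]: "f \<in> borel_measurable M" and fin: "(\<integral>\<^sup>+x. ennreal ((f x)\<^sup>2) \<partial>M) < \<infinity>" and "e > 0"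
  obtains T where "T \<ge> 0" "(\<integral>\<^sup>+x. ennreal ((f x - trunc_at T (f x))\<^sup>2) \<partial>M) \<le> ennreal e"
proof -
  have "(\<lambda>n. \<integral>\<^sup>+x. ennreal ((f x - trunc_at (real n) (f x))\<^sup>2) \<partial>M) \<longlonglongrightarrow> (\<integral>\<^sup>+x. 0 \<partial>M)"
  proof (rule nn_integral_dominated_convergence[where w="\<lambda>x. ennreal ((f x)\<^sup>2)"])
    show "AE x in M. ennreal ((f x - trunc_at (real n) (f x))\<^sup>2) \<le> ennreal ((f x)\<^sup>2)" for n
      by (intro AE_I2 ennreal_leI) (simp add: abs_le_square_iff[symmetric] abs_diff_trunc_at_le)
    show "AE x in M. (\<lambda>n. ennreal ((f x - trunc_at (real n) (f x))\<^sup>2)) \<longlonglongrightarrow> 0"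
    proof (rule AE_I2)
      fix x
      obtain N where N: "\<bar>f x\<bar> \<le> real N" using real_arch_simple by blast
      have "eventually (\<lambda>n. 0 = ennreal ((f x - trunc_at (real n) (f x))\<^sup>2)) sequentially"
        using eventually_ge_at_top[of N] by eventually_elim (use N in \<open>simp add: trunc_at_id\<close>)
      then show "(\<lambda>n. ennreal ((f x - trunc_at (real n) (f x))\<^sup>2)) \<longlonglongrightarrow> 0"
        by (rule Lim_transform_eventually[OF tendsto_const])
    qed
  qed (use fin in auto)
  then have "(\<lambda>n. \<integral>\<^sup>+x. ennreal ((f x - trunc_at (real n) (f x))\<^sup>2) \<partial>M) \<longlonglongrightarrow> 0" by simp
  then obtain n where "(\<integral>\<^sup>+x. ennreal ((f x - trunc_at (real n) (f x))\<^sup>2) \<partial>M) \<le> ennreal e"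
    using tendsto_ennreal_0_le[OF _ \<open>e > 0\<close>] by blast
  then show ?thesis using that[of "real n"] by simp
qed

text \<open>Measurability yields continuous functions converging to f almost everywhere, but without
  a majorant. Truncating f and its approximations at the same level T bounds their differences by 2
  T, which is square integrable on a set of finite measure. Truncating f and approximating the
  truncation each cost e/4, and each is doubled by the inequality for the square of a sum.\<close>

lemma L2_approx_continuous:
  fixes f :: "'a::euclidean_space \<Rightarrow> real"
  assumes [measurable]: "f \<in> borel_measurable borel" "S \<in> sets borel"
    and S: "emeasure lborel S < \<infinity>"
    and fin: "(\<integral>\<^sup>+x. ennreal ((f x)\<^sup>2) \<partial>lborel) < \<infinity>" and e: "e > 0"
  obtains g where "continuous_on UNIV g"
    "(\<integral>\<^sup>+x. ennreal ((f x - g x)\<^sup>2) * indicator S x \<partial>lborel) \<le> ennreal e"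
proof -
  obtain T where T: "T \<ge> 0" "(\<integral>\<^sup>+x. ennreal ((f x - trunc_at T (f x))\<^sup>2) \<partial>lborel) \<le> ennreal (e / 4)"
    using L2_truncation[OF _ fin, of "e / 4"] e by auto
  have "(\<lambda>x. f x) measurable_on UNIV"
    by (rule lebesgue_measurable_imp_measurable_on) (auto simp: measurable_completion)
  then obtain N g where N: "negligible N" and g: "\<And>n::nat. continuous_on UNIV (g n)"
    "\<And>x. x \<notin> N \<Longrightarrow> (\<lambda>n. g n x) \<longlonglongrightarrow> f x"
    unfolding measurable_on_def by auto
  have [measurable]: "g n \<in> borel_measurable borel" for n
    using g(1) by (simp add: borel_measurable_continuous_onI)
  have ae: "AE x in lborel. x \<notin> N"
  proof -
    have "AE x in lebesgue. x \<notin> N"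
      using N by (simp add: negligible_iff_null_sets AE_not_in)
    then show ?thesis by (simp add: AE_completion_iff)
  qed
  have "(\<lambda>n. \<integral>\<^sup>+x. ennreal ((trunc_at T (f x) - trunc_at T (g n x))\<^sup>2) * indicator S x \<partial>lborel) \<longlonglongrightarrow> (\<integral>\<^sup>+(x::'a). 0 \<partial>lborel)"
  proof (rule nn_integral_dominated_convergence[where w="\<lambda>x. ennreal ((2 * T)\<^sup>2) * indicator S x" and u'="\<lambda>x. 0"
      and u="\<lambda>n x. ennreal ((trunc_at T (f x) - trunc_at T (g n x))\<^sup>2) * indicator S x"])
    show "AE x in lborel. ennreal ((trunc_at T (f x) - trunc_at T (g n x))\<^sup>2) * indicator S x \<le> ennreal ((2 * T)\<^sup>2) * indicator S x" for n
    proof (intro AE_I2 mult_right_mono ennreal_leI)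
      fix x
      have "\<bar>trunc_at T (f x) - trunc_at T (g n x)\<bar> \<le> \<bar>2 * T\<bar>"
        using abs_trunc_at_le[OF T(1), of "f x"] abs_trunc_at_le[OF T(1), of "g n x"] by linarith
      then show "(trunc_at T (f x) - trunc_at T (g n x))\<^sup>2 \<le> (2 * T)\<^sup>2" by (simp add: abs_le_square_iff)
    qed auto
    show "AE x in lborel. (\<lambda>n. ennreal ((trunc_at T (f x) - trunc_at T (g n x))\<^sup>2) * indicator S x) \<longlonglongrightarrow> 0"
      using ae
    proof eventually_elim
      fix x assume "x \<notin> N"
      then have "(\<lambda>n. (trunc_at T (f x) - trunc_at T (g n x))\<^sup>2) \<longlonglongrightarrow> (trunc_at T (f x) - trunc_at T (f x))\<^sup>2"
        by (intro tendsto_intros tendsto_trunc_at g)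
      then have "(\<lambda>n. ennreal ((trunc_at T (f x) - trunc_at T (g n x))\<^sup>2)) \<longlonglongrightarrow> 0"
        using tendsto_ennrealI by fastforce
      then show "(\<lambda>n. ennreal ((trunc_at T (f x) - trunc_at T (g n x))\<^sup>2) * indicator S x) \<longlonglongrightarrow> 0"
        by (cases "x \<in> S") auto
    qed
    show "(\<integral>\<^sup>+ x. ennreal ((2 * T)\<^sup>2) * indicator S x \<partial>lborel) < \<infinity>"
      using S by (simp add: nn_integral_cmult ennreal_mult_less_top)
  qed auto
  then have "(\<lambda>n. \<integral>\<^sup>+x. ennreal ((trunc_at T (f x) - trunc_at T (g n x))\<^sup>2) * indicator S x \<partial>lborel) \<longlonglongrightarrow> 0" by simp
  then obtain n where n: "(\<integral>\<^sup>+x. ennreal ((trunc_at T (f x) - trunc_at T (g n x))\<^sup>2) * indicator S x \<partial>lborel) \<le> ennreal (e / 4)"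
    using tendsto_ennreal_0_le[of _ "e / 4"] e by auto
  have ind: "ennreal (a\<^sup>2) * indicator S x = ennreal ((a * indicator S x)\<^sup>2)" for a and x :: 'a
    by (auto simp: indicator_def)
  have "(\<integral>\<^sup>+x. ennreal ((f x - trunc_at T (g n x))\<^sup>2) * indicator S x \<partial>lborel)
      = (\<integral>\<^sup>+x. ennreal (((f x - trunc_at T (f x)) * indicator S x + (trunc_at T (f x) - trunc_at T (g n x)) * indicator S x)\<^sup>2) \<partial>lborel)"
    unfolding ind by (simp add: algebra_simps)
  also have "\<dots> \<le> 2 * (\<integral>\<^sup>+x. ennreal (((f x - trunc_at T (f x)) * indicator S x)\<^sup>2) \<partial>lborel)
     + 2 * (\<integral>\<^sup>+x. ennreal (((trunc_at T (f x) - trunc_at T (g n x)) * indicator S x)\<^sup>2) \<partial>lborel)"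
    by (rule nn_integral_square_add_le) auto
  also have "\<dots> \<le> 2 * (\<integral>\<^sup>+x. ennreal ((f x - trunc_at T (f x))\<^sup>2) \<partial>lborel)
     + 2 * (\<integral>\<^sup>+x. ennreal ((trunc_at T (f x) - trunc_at T (g n x))\<^sup>2) * indicator S x \<partial>lborel)"
    unfolding ind by (intro add_mono mult_left_mono nn_integral_mono ennreal_leI) (auto simp: indicator_def)
  also have "\<dots> \<le> 2 * ennreal (e / 4) + 2 * ennreal (e / 4)"
    by (intro add_mono mult_left_mono T n) auto
  also have "\<dots> = ennreal (2 * (e / 4) + 2 * (e / 4))"
    using e by (simp only: ennreal_plus ennreal_mult) (simp add: ennreal_mult ennreal_plus)
  also have "\<dots> = ennreal e" by simp
  finally show ?thesis by (rule that[rotated]) (intro continuous_intros g)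
qed

lemma L2_translation_continuous:
  fixes f :: "'a::euclidean_space \<Rightarrow> real"
  assumes [measurable]: "f \<in> borel_measurable borel"
    and fin: "(\<integral>\<^sup>+x. ennreal ((f x)\<^sup>2) \<partial>lborel) < \<infinity>"
    and B: "B \<ge> 0" "\<And>x. norm x > B \<Longrightarrow> f x = 0" and e: "e > 0"
  obtains d where "d > 0"
    "\<And>z. norm z < d \<Longrightarrow> (\<integral>\<^sup>+x. ennreal ((f (x + z) - f x)\<^sup>2) \<partial>lborel) \<le> ennreal e"
proof -
  \<comment> \<open>For |z| < 1 the larger ball contains x and x + z whenever x is in the smaller
    one, and off the smaller ball both f(x) and f(x + z) vanish.\<close>
  define S where "S = cball (0::'a) (B + 2)"
  define S1 where "S1 = cball (0::'a) (B + 1)"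
  have [measurable]: "S \<in> sets borel" "S1 \<in> sets borel" by (auto simp: S_def S1_def)
  have "emeasure lborel S < \<infinity>" "emeasure lborel S1 < \<infinity>"
    unfolding S_def S1_def using emeasure_lborel_cball_finite[of "0::'a"] by (auto simp: less_top)
  define m where "m = measure lborel S1"
  have m: "emeasure lborel S1 = ennreal m" "m \<ge> 0"
    using \<open>emeasure lborel S1 < \<infinity>\<close> by (auto simp: m_def emeasure_eq_ennreal_measure)
  obtain g where g: "continuous_on UNIV g"
    and fg: "(\<integral>\<^sup>+x. ennreal ((f x - g x)\<^sup>2) * indicator S x \<partial>lborel) \<le> ennreal (e / 16)"
    using L2_approx_continuous[OF assms(1) \<open>S \<in> sets borel\<close> \<open>emeasure lborel S < \<infinity>\<close> fin, of "e / 16"] e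
    by (metis zero_less_divide_iff zero_less_numeral)
  have [measurable]: "g \<in> borel_measurable borel"
    using g by (simp add: borel_measurable_continuous_onI)
  \<comment> \<open>The modulus w satisfies w^2 m \<le> e/8, where \<open>m + 1\<close> avoids a
    division by zero. The two approximation errors contribute e/4 each and the oscillation of g at
    most e/4.\<close>
  define w where "w = sqrt (e / (8 * (m + 1)))"
  have w: "w > 0" "w\<^sup>2 = e / (8 * (m + 1))" using e m by (auto simp: w_def)
  have "uniformly_continuous_on S g"
    using g by (intro compact_uniformly_continuous) (auto simp: S_def intro: continuous_on_subset)
  then obtain d where d: "d > 0" "\<And>x y. x \<in> S \<Longrightarrow> y \<in> S \<Longrightarrow> dist y x < d \<Longrightarrow> dist (g y) (g x) < w"
    unfolding uniformly_continuous_on_def using w(1) by blast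
  show ?thesis
  proof (rule that[of "min d 1"])
    show "min d 1 > 0" using d by simp
    fix z :: 'a assume z: "norm z < min d 1"
    have ind: "ennreal (a\<^sup>2) * indicator S x = ennreal ((a * indicator S x)\<^sup>2)" for a S and x :: 'a
      by (auto simp: indicator_def)
    have zero: "f (x + z) = 0 \<and> f x = 0" if "x \<notin> S1" for x
    proof -
      have "norm x > B + 1" using that by (auto simp: S1_def)
      moreover have "norm x \<le> norm (x + z) + norm z" by (metis add_diff_cancel_right' norm_triangle_ineq4)
      ultimately show ?thesis using B z by auto
    qed
    have S1: "x + z \<in> S \<and> x \<in> S" if "x \<in> S1" for x
      using that z norm_triangle_ineq[of x z] by (auto simp: S1_def S_def)
    have "(\<integral>\<^sup>+x. ennreal ((f (x + z) - f x)\<^sup>2) \<partial>lborel)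
      \<le> (\<integral>\<^sup>+x. 4 * (ennreal ((f (x + z) - g (x + z))\<^sup>2) * indicator S (x + z))
            + 4 * (ennreal ((f x - g x)\<^sup>2) * indicator S x)
            + 2 * (ennreal (w\<^sup>2) * indicator S1 x) \<partial>lborel)"
    proof (rule nn_integral_mono)
      fix x
      show "ennreal ((f (x + z) - f x)\<^sup>2) \<le> 4 * (ennreal ((f (x + z) - g (x + z))\<^sup>2) * indicator S (x + z))
            + 4 * (ennreal ((f x - g x)\<^sup>2) * indicator S x)
            + 2 * (ennreal (w\<^sup>2) * indicator S1 x)"
      proof (cases "x \<in> S1")
        case True
        have "\<bar>g (x + z) - g x\<bar> \<le> \<bar>w\<bar>"
          using d(2)[of x "x + z"] S1[OF True] z by (auto simp: dist_norm)
        then have "(g (x + z) - g x)\<^sup>2 \<le> w\<^sup>2" by (simp add: abs_le_square_iff)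
        moreover have "f (x + z) - f x = (f (x + z) - g (x + z)) + (g x - f x) + (g (x + z) - g x)" by simp
        then have "(f (x + z) - f x)\<^sup>2 \<le> 4 * (f (x + z) - g (x + z))\<^sup>2 + 4 * (g x - f x)\<^sup>2 + 2 * (g (x + z) - g x)\<^sup>2"
          using power2_add3_le by metis
        moreover have "(g x - f x)\<^sup>2 = (f x - g x)\<^sup>2" by (rule power2_commute)
        ultimately have "(f (x + z) - f x)\<^sup>2 \<le> 4 * (f (x + z) - g (x + z))\<^sup>2 + 4 * (f x - g x)\<^sup>2 + 2 * w\<^sup>2"
          by linarith
        then have "ennreal ((f (x + z) - f x)\<^sup>2) \<le> ennreal (4 * (f (x + z) - g (x + z))\<^sup>2 + 4 * (f x - g x)\<^sup>2 + 2 * w\<^sup>2)"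
          by (rule ennreal_leI)
        then show ?thesis using True S1[OF True]
          by (simp add: ennreal_plus ennreal_mult)
      qed (simp add: zero)
    qed
    also have "\<dots> = 4 * (\<integral>\<^sup>+x. ennreal ((f (x + z) - g (x + z))\<^sup>2) * indicator S (x + z) \<partial>lborel)
       + 4 * (\<integral>\<^sup>+x. ennreal ((f x - g x)\<^sup>2) * indicator S x \<partial>lborel) + 2 * (ennreal (w\<^sup>2) * emeasure lborel S1)"
      by (simp add: nn_integral_add nn_integral_cmult nn_integral_cmult_indicator)
    also have "(\<integral>\<^sup>+x. ennreal ((f (x + z) - g (x + z))\<^sup>2) * indicator S (x + z) \<partial>lborel)
       = (\<integral>\<^sup>+x. ennreal ((f x - g x)\<^sup>2) * indicator S x \<partial>lborel)"
      by (rule nn_integral_lborel_translate) measurable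
    also have "4 * (\<integral>\<^sup>+x. ennreal ((f x - g x)\<^sup>2) * indicator S x \<partial>lborel)
       + 4 * (\<integral>\<^sup>+x. ennreal ((f x - g x)\<^sup>2) * indicator S x \<partial>lborel) + 2 * (ennreal (w\<^sup>2) * emeasure lborel S1)
       \<le> 4 * ennreal (e / 16) + 4 * ennreal (e / 16) + 2 * (ennreal (w\<^sup>2) * ennreal m)"
      unfolding m by (intro add_mono mult_left_mono fg) auto
    also have "\<dots> = ennreal (4 * (e / 16) + 4 * (e / 16) + 2 * (w\<^sup>2 * m))"
    proof -
      have "4 * ennreal (e / 16) = ennreal (4 * (e / 16))" "2 * (ennreal (w\<^sup>2) * ennreal m) = ennreal (2 * (w\<^sup>2 * m))"
        using e m ennreal_mult[of 4 "e / 16"] by (simp_all add: ennreal_mult)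
      then show ?thesis using e m by (simp only: ennreal_plus[symmetric]) simp
    qed
    also have "\<dots> \<le> ennreal e"
    proof (rule ennreal_leI)
      have "w\<^sup>2 * m \<le> e / 8" unfolding w using e m by (simp add: field_simps)
      then show "4 * (e / 16) + 4 * (e / 16) + 2 * (w\<^sup>2 * m) \<le> e" using e by linarith
    qed
    finally show "(\<integral>\<^sup>+x. ennreal ((f (x + z) - f x)\<^sup>2) \<partial>lborel) \<le> ennreal e" .
  qed
qed

text \<open>Jensen's inequality for the square, obtained by expanding the nonnegative variance of h
  with respect to the probability density k. Where the right-hand side is infinite there is nothing
  to show.\<close>

lemma square_weighted_integral_le:
  fixes h k :: "'a \<Rightarrow> real"
  assumes [measurable]: "h \<in> borel_measurable M" and k: "integrable M k" "\<And>x. k x \<ge> 0" "(\<integral>x. k x \<partial>M) = 1"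
  shows "ennreal ((\<integral>x. h x * k x \<partial>M)\<^sup>2) \<le> (\<integral>\<^sup>+x. ennreal ((h x)\<^sup>2 * k x) \<partial>M)"
proof (cases "(\<integral>\<^sup>+x. ennreal ((h x)\<^sup>2 * k x) \<partial>M) < \<infinity>")
  case True
  have [measurable]: "k \<in> borel_measurable M" using k(1) by simp
  have i2: "integrable M (\<lambda>x. (h x)\<^sup>2 * k x)"
    using True k(2) by (intro integrableI_nonneg) auto
  have i1: "integrable M (\<lambda>x. h x * k x)"
  proof (rule Bochner_Integration.integrable_bound[of _ "\<lambda>x. k x + (h x)\<^sup>2 * k x"])
    show "integrable M (\<lambda>x. k x + (h x)\<^sup>2 * k x)" using k i2 by simp
    show "AE x in M. norm (h x * k x) \<le> norm (k x + (h x)\<^sup>2 * k x)"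
    proof (rule AE_I2)
      fix x
      have "\<bar>h x\<bar> \<le> 1 + (h x)\<^sup>2"
        using sum_squares_bound[of "\<bar>h x\<bar>" 1] by auto
      then have "\<bar>h x\<bar> * k x \<le> (1 + (h x)\<^sup>2) * k x" using k(2) by (intro mult_right_mono)
      then show "norm (h x * k x) \<le> norm (k x + (h x)\<^sup>2 * k x)"
        using k(2)[of x] by (auto simp: abs_mult algebra_simps)
    qed
  qed simp
  define m where "m = (\<integral>x. h x * k x \<partial>M)"
  have "0 \<le> (\<integral>x. (h x - m)\<^sup>2 * k x \<partial>M)"
    by (intro Bochner_Integration.integral_nonneg) (simp add: k)
  also have "(\<integral>x. (h x - m)\<^sup>2 * k x \<partial>M) = (\<integral>x. ((h x)\<^sup>2 * k x - (2 * m) * (h x * k x)) + m\<^sup>2 * k x \<partial>M)"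
    by (intro Bochner_Integration.integral_cong) (auto simp: power2_eq_square algebra_simps)
  also have "\<dots> = (\<integral>x. (h x)\<^sup>2 * k x \<partial>M) - (2 * m) * m + m\<^sup>2 * 1"
    using i1 i2 k by (simp add: m_def)
  finally have "m\<^sup>2 \<le> (\<integral>x. (h x)\<^sup>2 * k x \<partial>M)" by (simp add: power2_eq_square)
  then have "ennreal (m\<^sup>2) \<le> ennreal (\<integral>x. (h x)\<^sup>2 * k x \<partial>M)" by (rule ennreal_leI)
  also have "\<dots> = (\<integral>\<^sup>+x. ennreal ((h x)\<^sup>2 * k x) \<partial>M)"
    using i2 k(2) by (intro nn_integral_eq_integral[symmetric]) auto
  finally show ?thesis by (simp add: m_def)
qed (simp add: not_less top_unique)

text \<open>The square of the averaged difference is at most the average of the squares, and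
  Fubini's theorem reduces this to translations by |z| < d. The kernel need not be centred, so it
  may sit on one side of the origin, and d works for every kernel of small support, so one kernel
  can serve several functions.\<close>

lemma mollify_tendsto_L2:
  fixes f :: "'a::euclidean_space \<Rightarrow> real"
  assumes [measurable]: "f \<in> borel_measurable borel"
    and fin: "(\<integral>\<^sup>+x. ennreal ((f x)\<^sup>2) \<partial>lborel) < \<infinity>"
    and B: "B \<ge> 0" "\<And>x. norm x > B \<Longrightarrow> f x = 0" and e: "e > 0"
  obtains d where "d > 0"
    "\<And>k. integrable lborel k \<Longrightarrow> (\<And>z. k z \<ge> 0) \<Longrightarrow> (\<integral>z. k z \<partial>lborel) = 1 \<Longrightarrow>
       (\<And>z. norm z \<ge> d \<Longrightarrow> k z = 0) \<Longrightarrow>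
       (\<And>x. integrable lborel (\<lambda>z. f (x + z) * k z)) \<Longrightarrow>
       (\<integral>\<^sup>+x. ennreal (((\<integral>z. f (x + z) * k z \<partial>lborel) - f x)\<^sup>2) \<partial>lborel) \<le> ennreal e"
proof -
  obtain d where d: "d > 0"
    "\<And>z. norm z < d \<Longrightarrow> (\<integral>\<^sup>+x. ennreal ((f (x + z) - f x)\<^sup>2) \<partial>lborel) \<le> ennreal e"
    using L2_translation_continuous[OF assms] by blast
  show ?thesis
  proof (rule that[OF d(1)])
    fix k :: "'a \<Rightarrow> real"
    assume k: "integrable lborel k" "\<And>z. k z \<ge> 0" "(\<integral>z. k z \<partial>lborel) = 1"
      and kd: "\<And>z. norm z \<ge> d \<Longrightarrow> k z = 0"
      and fk: "\<And>x. integrable lborel (\<lambda>z. f (x + z) * k z)"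
    have [measurable]: "k \<in> borel_measurable borel" using k(1) by auto
    have "(\<integral>\<^sup>+x. ennreal (((\<integral>z. f (x + z) * k z \<partial>lborel) - f x)\<^sup>2) \<partial>lborel)
       \<le> (\<integral>\<^sup>+x. (\<integral>\<^sup>+z. ennreal ((f (x + z) - f x)\<^sup>2 * k z) \<partial>lborel) \<partial>lborel)"
    proof (rule nn_integral_mono)
      fix x
      have "(\<integral>z. f (x + z) * k z \<partial>lborel) - f x = (\<integral>z. f (x + z) * k z - f x * k z \<partial>lborel)"
        using k fk by simp
      also have "\<dots> = (\<integral>z. (f (x + z) - f x) * k z \<partial>lborel)" by (simp add: left_diff_distrib)
      finally show "ennreal (((\<integral>z. f (x + z) * k z \<partial>lborel) - f x)\<^sup>2) \<le> (\<integral>\<^sup>+z. ennreal ((f (x + z) - f x)\<^sup>2 * k z) \<partial>lborel)"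
        using square_weighted_integral_le[of "\<lambda>z. f (x + z) - f x" lborel k] k by simp
    qed
    also have "\<dots> = (\<integral>\<^sup>+z. (\<integral>\<^sup>+x. ennreal ((f (x + z) - f x)\<^sup>2 * k z) \<partial>lborel) \<partial>lborel)"
      by (rule lborel_pair.Fubini') simp
    also have "\<dots> \<le> (\<integral>\<^sup>+z. ennreal e * ennreal (k z) \<partial>lborel)"
    proof (rule nn_integral_mono)
      fix z
      have "(\<integral>\<^sup>+x. ennreal ((f (x + z) - f x)\<^sup>2 * k z) \<partial>lborel) = (\<integral>\<^sup>+x. ennreal ((f (x + z) - f x)\<^sup>2) \<partial>lborel) * ennreal (k z)"
        using k(2) by (simp add: ennreal_mult nn_integral_multc)
      also have "\<dots> \<le> ennreal e * ennreal (k z)"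
        using d(2)[of z] kd[of z] by (cases "norm z < d") (auto intro: mult_right_mono)
      finally show "(\<integral>\<^sup>+x. ennreal ((f (x + z) - f x)\<^sup>2 * k z) \<partial>lborel) \<le> ennreal e * ennreal (k z)" .
    qed
    also have "\<dots> = ennreal e * ennreal (\<integral>z. k z \<partial>lborel)"
      using k by (simp add: nn_integral_cmult nn_integral_eq_integral)
    finally show "(\<integral>\<^sup>+x. ennreal (((\<integral>z. f (x + z) * k z \<partial>lborel) - f x)\<^sup>2) \<partial>lborel) \<le> ennreal e"
      using k by simp
  qed
qed

section \<open>Kernels of compact support and differentiation under the integral\<close>

lemma continuous_compact_support_bounded:
  fixes g :: "'a::euclidean_space \<Rightarrow> 'b::real_normed_vector"
  assumes "continuous_on UNIV g" "\<And>x. norm x > B \<Longrightarrow> g x = 0"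
  obtains K where "K \<ge> 0" "\<And>x. norm (g x) \<le> K"
proof -
  have "compact (g ` cball 0 B)"
    by (intro compact_continuous_image continuous_on_subset[OF assms(1)]) auto
  then obtain K where "\<And>x. x \<in> cball 0 B \<Longrightarrow> norm (g x) \<le> K"
    using compact_imp_bounded bounded_iff by (metis imageI)
  then have "norm (g x) \<le> max K 0" for x
    using assms(2)[of x] by (cases "norm x > B") (auto simp: le_max_iff_disj)
  then show ?thesis using that[of "max K 0"] by simp
qed

text \<open>With the margin 1 around the support, two close points either both lie in the compact
  ball or both lie where g vanishes.\<close>

lemma continuous_compact_support_uniformly:
  fixes g :: "'a::euclidean_space \<Rightarrow> 'b::real_normed_vector"
  assumes "continuous_on UNIV g" "\<And>x. norm x > B \<Longrightarrow> g x = 0"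
  shows "uniformly_continuous_on UNIV g"
  unfolding uniformly_continuous_on_def
proof (intro allI impI)
  fix e :: real assume "e > 0"
  have "uniformly_continuous_on (cball 0 (B + 1)) g"
    by (intro compact_uniformly_continuous continuous_on_subset[OF assms(1)]) auto
  then obtain d where d: "d > 0"
    "\<And>x y. x \<in> cball 0 (B + 1) \<Longrightarrow> y \<in> cball 0 (B + 1) \<Longrightarrow> dist y x < d \<Longrightarrow> dist (g y) (g x) < e"
    unfolding uniformly_continuous_on_def using \<open>e > 0\<close> by blast
  have "dist (g y) (g x) < e" if "dist y x < min d 1" for x y
  proof (cases "x \<in> cball 0 (B + 1) \<and> y \<in> cball 0 (B + 1)")
    case True
    then show ?thesis using d that by auto
  next
    case False
    have "\<bar>norm x - norm y\<bar> < 1"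
      using that norm_triangle_ineq3[of y x] by (auto simp: dist_norm)
    then have "norm x > B" "norm y > B" using False by auto
    then show ?thesis using assms(2) \<open>e > 0\<close> by simp
  qed
  then show "\<exists>d>0. \<forall>x\<in>UNIV. \<forall>x'\<in>UNIV. dist x' x < d \<longrightarrow> dist (g x') (g x) < e"
    using d(1) by (intro exI[of _ "min d 1"]) auto
qed

lemma has_grad_zero_outside:
  assumes "has_grad k G" "\<And>x. norm x > B \<Longrightarrow> k x = 0" "norm x > B"
  shows "G x = 0"
proof -
  have "open {y. norm y > B}" by (intro open_Collect_less continuous_intros)
  then have "eventually (\<lambda>y. k y = 0) (at x)"
    using assms(2,3) by (auto simp: eventually_at_topological)
  moreover have "(k has_derivative (\<lambda>h. G x \<bullet> h)) (at x)" using assms(1) by (auto simp: has_grad_def)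
  ultimately have "((\<lambda>y. 0) has_derivative (\<lambda>h. G x \<bullet> h)) (at x)"
    using has_derivative_transform_eventually[of k "\<lambda>h. G x \<bullet> h" x UNIV "\<lambda>y. 0"] assms(2,3)
    by simp
  then have "(\<lambda>h. G x \<bullet> h) = (\<lambda>h. 0)"
    using has_derivative_const has_derivative_unique by blast
  then show ?thesis by (metis inner_eq_zero_iff)
qed

lemma integrable_mult_kernel:
  fixes f :: "'a::euclidean_space \<Rightarrow> real" and k :: "'a \<Rightarrow> 'b::{banach,second_countable_topology}"
  assumes f: "integrable lborel f" and k: "continuous_on UNIV k" "\<And>x. norm x > B \<Longrightarrow> k x = 0"
  shows "integrable lborel (\<lambda>y. f y *\<^sub>R k (y - x))"
proof -
  obtain K where K: "K \<ge> 0" "\<And>x. norm (k x) \<le> K"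
    using continuous_compact_support_bounded[OF k] by blast
  have [measurable]: "k \<in> borel_measurable borel" using k(1) by (rule borel_measurable_continuous_onI)
  show ?thesis
  proof (rule Bochner_Integration.integrable_bound[of _ "\<lambda>y. K * f y"])
    show "AE y in lborel. norm (f y *\<^sub>R k (y - x)) \<le> norm (K * f y)"
      using K by (auto simp: abs_mult mult.commute[of K] intro!: mult_left_mono)
  qed (use f in auto)
qed

text \<open>Uniform continuity of G makes the linearisation error of k at most |x' - x| e' uniformly
  in y, so it can be integrated against |f|. The minus sign stems from x entering the kernel as y -
  x.\<close>

lemma has_grad_mollify:
  fixes f :: "real^'n \<Rightarrow> real"
  assumes f: "integrable lborel f" and k: "has_grad k G" "continuous_on UNIV G" "\<And>x. norm x > B \<Longrightarrow> k x = 0"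
  shows "has_grad (\<lambda>x. \<integral>y. f y * k (y - x) \<partial>lborel) (\<lambda>x. - (\<integral>y. f y *\<^sub>R G (y - x) \<partial>lborel))"
  unfolding has_grad_def has_derivative_at'
proof (intro allI conjI impI)
  fix x :: "real^'n" and e :: real
  have G0: "\<And>x. norm x > B \<Longrightarrow> G x = 0" using has_grad_zero_outside[OF k(1,3)] by blast
  have ki: "integrable lborel (\<lambda>y. f y * k (y - x))" for x
    using integrable_mult_kernel[OF f has_grad_imp_continuous_on[OF k(1)] k(3), where x=x] by simp
  have Gi: "integrable lborel (\<lambda>y. f y *\<^sub>R G (y - x))" for x
    by (rule integrable_mult_kernel[OF f k(2) G0])
  show "bounded_linear ((\<bullet>) (- (\<integral>y. f y *\<^sub>R G (y - x) \<partial>lborel)))"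
    by (rule bounded_linear_inner_right)
  assume e: "e > 0"
  define I where "I = (\<integral>y. \<bar>f y\<bar> \<partial>lborel)"
  have I: "I \<ge> 0" unfolding I_def by simp
  \<comment> \<open>The factor 2 and the summand 1 give the strict inequality I e' < e even when f
    is zero almost everywhere.\<close>
  define e' where "e' = e / (2 * (I + 1))"
  have e': "e' > 0" using e I by (simp add: e'_def)
  obtain d where d: "d > 0" "\<And>x y. dist y x < d \<Longrightarrow> dist (G y) (G x) < e'"
    using continuous_compact_support_uniformly[OF k(2) G0] e'
    unfolding uniformly_continuous_on_def by (metis UNIV_I)
  have lin: "\<bar>k b - k a - G a \<bullet> (b - a)\<bar> \<le> norm (b - a) * e'" if "norm (b - a) < d" for a b
  proof -
    have "norm (k b - k a - (\<lambda>h. G a \<bullet> h) (b - a)) \<le> norm (b - a) * e'"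
    proof (rule differentiable_bound_linearization[where S="ball a d" and f'="\<lambda>x h. G x \<bullet> h"])
      show "a + t *\<^sub>R (b - a) \<in> ball a d" if "t \<in> {0..1}" for t
      proof -
        have "norm (t *\<^sub>R (b - a)) \<le> 1 * norm (b - a)" using that by (simp add: mult_left_le_one_le)
        then show ?thesis using \<open>norm (b - a) < d\<close> by (simp add: dist_norm)
      qed
      show "(k has_derivative (\<lambda>h. G x \<bullet> h)) (at x within ball a d)" for x
        using k(1) has_derivative_at_withinI unfolding has_grad_def by blast
      show "onorm ((\<lambda>h. G x \<bullet> h) - (\<lambda>h. G a \<bullet> h)) \<le> e'" if "x \<in> ball a d" for x
      proof -
        have "dist (G x) (G a) < e'" using d(2) that by (simp add: dist_commute)
        moreover have "onorm ((\<lambda>h. G x \<bullet> h) - (\<lambda>h. G a \<bullet> h)) \<le> norm (G x - G a)"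
          by (rule onorm_le) (simp add: fun_diff_def inner_diff_left[symmetric] Cauchy_Schwarz_ineq2)
        ultimately show ?thesis by (simp add: dist_norm)
      qed
      show "a \<in> ball a d" using d by simp
    qed
    then show ?thesis by simp
  qed
  show "\<exists>d>0. \<forall>x'. 0 < norm (x' - x) \<and> norm (x' - x) < d \<longrightarrow>
     norm ((\<integral>y. f y * k (y - x') \<partial>lborel) - (\<integral>y. f y * k (y - x) \<partial>lborel) -
       - (\<integral>y. f y *\<^sub>R G (y - x) \<partial>lborel) \<bullet> (x' - x)) / norm (x' - x) < e"
  proof (intro exI conjI allI impI)
    show "d > 0" by fact
    fix x' assume x': "0 < norm (x' - x) \<and> norm (x' - x) < d"
    define R where "R y = k (y - x') - k (y - x) + G (y - x) \<bullet> (x' - x)" for y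
    have R: "\<bar>R y\<bar> \<le> norm (x' - x) * e'" for y
      using lin[of "y - x'" "y - x"] x' by (simp add: R_def norm_minus_commute inner_diff_right)
    have Gi': "integrable lborel (\<lambda>y. f y * (G (y - x) \<bullet> (x' - x)))"
    proof -
      have "integrable lborel (\<lambda>y. (f y *\<^sub>R G (y - x)) \<bullet> (x' - x))"
        by (rule integrable_inner_left) (rule Gi)
      then show ?thesis by simp
    qed
    have Geq: "(\<integral>y. f y *\<^sub>R G (y - x) \<partial>lborel) \<bullet> (x' - x) = (\<integral>y. f y * (G (y - x) \<bullet> (x' - x)) \<partial>lborel)"
    proof -
      have "(\<integral>y. (f y *\<^sub>R G (y - x)) \<bullet> (x' - x) \<partial>lborel) = (\<integral>y. f y *\<^sub>R G (y - x) \<partial>lborel) \<bullet> (x' - x)"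
        by (rule integral_inner_left) (rule Gi)
      then show ?thesis by simp
    qed
    have "(\<integral>y. f y * k (y - x') \<partial>lborel) - (\<integral>y. f y * k (y - x) \<partial>lborel) -
       - (\<integral>y. f y *\<^sub>R G (y - x) \<partial>lborel) \<bullet> (x' - x)
      = (\<integral>y. (f y * k (y - x') - f y * k (y - x)) + f y * (G (y - x) \<bullet> (x' - x)) \<partial>lborel)"
      using ki Gi' by (simp add: Geq)
    also have "\<dots> = (\<integral>y. f y * R y \<partial>lborel)" by (simp add: R_def algebra_simps)
    finally have eq: "(\<integral>y. f y * k (y - x') \<partial>lborel) - (\<integral>y. f y * k (y - x) \<partial>lborel) -
       - (\<integral>y. f y *\<^sub>R G (y - x) \<partial>lborel) \<bullet> (x' - x) = (\<integral>y. f y * R y \<partial>lborel)" .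
    have fR: "integrable lborel (\<lambda>y. f y * R y)"
      using Bochner_Integration.integrable_add[OF Bochner_Integration.integrable_diff[OF ki[of x'] ki[of x]] Gi']
      by (simp add: R_def algebra_simps)
    have "norm (\<integral>y. f y * R y \<partial>lborel) \<le> (\<integral>y. norm (f y * R y) \<partial>lborel)"
      by (rule integral_norm_bound)
    also have "\<dots> \<le> (\<integral>y. \<bar>f y\<bar> * (norm (x' - x) * e') \<partial>lborel)"
      using f fR R by (intro integral_mono integrable_norm) (auto simp: abs_mult intro!: mult_left_mono)
    also have "\<dots> = I * (norm (x' - x) * e')" using f by (simp add: I_def)
    finally have le: "norm (\<integral>y. f y * R y \<partial>lborel) \<le> I * (norm (x' - x) * e')" .
    have "I * e' < e"
    proof -
      have "0 < 2 * (I + 1)" using I by simp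
      then have "2 * (I + 1) \<noteq> 0" by (rule less_imp_neq[THEN not_sym])
      then have "e' * (2 * (I + 1)) = e" unfolding e'_def by (rule iffD1[OF nonzero_eq_divide_eq _, OF _ refl])
      then show ?thesis using e e' by (simp add: algebra_simps)
    qed
    then have "norm (x' - x) * (I * e') < norm (x' - x) * e" using x' by simp
    then have "norm (\<integral>y. f y * R y \<partial>lborel) < norm (x' - x) * e" using le by (simp add: algebra_simps)
    then show "norm ((\<integral>y. f y * k (y - x') \<partial>lborel) - (\<integral>y. f y * k (y - x) \<partial>lborel) -
       - (\<integral>y. f y *\<^sub>R G (y - x) \<partial>lborel) \<bullet> (x' - x)) / norm (x' - x) < e"
      unfolding eq using x' by (simp add: divide_less_eq mult.commute)
  qed
qed

text \<open>The induction varies the kernel: each component of the gradient is minus a mollification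
  of f by a derivative of k, which is again smooth with the same support bound.\<close>

lemma smooth_fun_mollify:
  fixes f :: "real^'n \<Rightarrow> real"
  assumes f: "integrable lborel f" and k: "smooth_fun k" "\<And>x. norm x > B \<Longrightarrow> k x = 0"
  shows "smooth_fun (\<lambda>x. \<integral>y. f y * k (y - x) \<partial>lborel)"
proof -
  have "Ck m (\<lambda>x. \<integral>y. f y * k (y - x) \<partial>lborel)" for m
    using k
  proof (induction m arbitrary: k)
    case 0
    obtain G where G: "has_grad k G" "\<And>i. smooth_fun (\<lambda>x. G x $ i)" using smooth_funE[OF 0(1)] by blast
    show ?case
      using has_grad_mollify[OF f G(1) smooth_fun_grad_continuous_on[OF 0(1) G(1)] 0(2)]
      by (auto dest: has_grad_imp_continuous_on)
  next
    case (Suc m)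
    obtain G where G: "has_grad k G" "\<And>i. smooth_fun (\<lambda>x. G x $ i)" using smooth_funE[OF Suc(2)] by blast
    have Gc: "continuous_on UNIV G" by (rule smooth_fun_grad_continuous_on[OF Suc(2) G(1)])
    have G0: "\<And>x. norm x > B \<Longrightarrow> G x = 0" using has_grad_zero_outside[OF G(1) Suc(3)] by blast
    have c1: "(- (\<integral>y. f y *\<^sub>R G (y - x) \<partial>lborel)) $ i = (-1) * (\<integral>y. f y * (G (y - x) $ i) \<partial>lborel)" for x i
      using integral_bounded_linear[OF bounded_linear_vec_nth[of i] integrable_mult_kernel[OF f Gc G0, where x=x]]
      by simp
    have c2: "Ck m (\<lambda>x. (-1) * (\<integral>y. f y * (G (y - x) $ i) \<partial>lborel))" for i
      by (intro Ck_mult Ck_const Suc.IH G) (simp add: G0)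
    show ?case unfolding Ck_Suc_iff
    proof (intro exI conjI allI)
      show "has_grad (\<lambda>x. \<integral>y. f y * k (y - x) \<partial>lborel) (\<lambda>x. - (\<integral>y. f y *\<^sub>R G (y - x) \<partial>lborel))"
        by (rule has_grad_mollify[OF f G(1) Gc Suc(3)])
      show "Ck m (\<lambda>x. (- (\<integral>y. f y *\<^sub>R G (y - x) \<partial>lborel)) $ i)" for i
        unfolding c1 by (rule c2)
    qed
  qed
  then show ?thesis by (simp add: smooth_fun_def)
qed

section \<open>Interior cones of Lipschitz domains\<close>

definition inner_cone :: "'a::euclidean_space set \<Rightarrow> 'a \<Rightarrow> real \<Rightarrow> 'a \<Rightarrow> real \<Rightarrow> bool" where
  "inner_cone \<Omega> a \<rho> c \<delta> \<longleftrightarrow> \<rho> > 0 \<and> \<delta> > 0 \<and>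
     (\<forall>y\<in>\<Omega> \<inter> ball a \<rho>. \<forall>z\<in>ball c \<delta>. \<forall>t. 0 < t \<and> t \<le> 1 \<longrightarrow> y + t *\<^sub>R z \<in> \<Omega>)"

lemma norm_orthogonal_part_le:
  fixes e w :: "'a::real_inner"
  assumes "norm e = 1"
  shows "norm (w - (w \<bullet> e) *\<^sub>R e) \<le> norm w"
proof -
  have "e \<bullet> e = 1" using assms by (simp add: norm_eq_1)
  then have "(norm (w - (w \<bullet> e) *\<^sub>R e))\<^sup>2 = (norm w)\<^sup>2 - (w \<bullet> e)\<^sup>2"
    unfolding power2_norm_eq_inner
    by (simp add: inner_diff_left inner_diff_right power2_eq_square inner_commute[of e w])
  then have "(norm (w - (w \<bullet> e) *\<^sub>R e))\<^sup>2 \<le> (norm w)\<^sup>2" by simp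
  then show ?thesis by (rule power2_le_imp_le) simp
qed

text \<open>At a boundary point the cone is centred at the upward direction of the graph. A step t z
  with z = h e + w and |w| < \<delta> raises the height by t (h + w . e), while its tangential part
  is at most t \<delta> and lets the graph rise by at most L t \<delta>.\<close>

lemma lipschitz_domain_inner_cone:
  fixes \<Omega> :: "(real^'n) set"
  assumes "lipschitz_domain \<Omega>" "a \<in> closure \<Omega>"
  obtains \<rho> c \<delta> where "inner_cone \<Omega> a \<rho> c \<delta>"
proof (cases "a \<in> \<Omega>")
  case True
  moreover have "open \<Omega>" using assms(1) by (simp add: lipschitz_domain_def)
  ultimately obtain d where d: "d > 0" "ball a d \<subseteq> \<Omega>" using open_contains_ball by blast
  have "inner_cone \<Omega> a (d / 2) 0 (d / 2)"
    unfolding inner_cone_def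
  proof (intro conjI ballI allI impI)
    fix y z :: "real^'n" and t :: real
    assume y: "y \<in> \<Omega> \<inter> ball a (d / 2)" and z: "z \<in> ball 0 (d / 2)" and t: "0 < t \<and> t \<le> 1"
    have "norm (t *\<^sub>R z) \<le> norm z" using t by (simp add: mult_left_le_one_le)
    then have "dist a (y + t *\<^sub>R z) < d"
      using y z dist_triangle[of a "y + t *\<^sub>R z" y] by (auto simp: dist_norm)
    then show "y + t *\<^sub>R z \<in> \<Omega>" using d(2) by auto
  qed (use d in auto)
  then show ?thesis by (rule that)
next
  case False
  have "open \<Omega>" using assms(1) by (simp add: lipschitz_domain_def)
  then have "a \<in> frontier \<Omega>" using False assms(2) by (simp add: frontier_def interior_open)
  then obtain r e \<gamma> L where r: "r > 0" and e: "norm e = 1"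
    and L: "L-lipschitz_on {z. z \<bullet> e = 0} \<gamma>"
    and graph: "\<Omega> \<inter> ball a r = {y \<in> ball a r. y \<bullet> e > \<gamma> (y - (y \<bullet> e) *\<^sub>R e)}"
    using assms(1) unfolding lipschitz_domain_def by blast
  have L0: "L \<ge> 0" using L by (rule lipschitz_on_nonneg)
  have ee: "e \<bullet> e = 1" using e by (simp add: norm_eq_1)
  \<comment> \<open>Steps have length at most 2 h = r/4 and thus stay in the ball of radius r around
    a. With (L + 2) \<delta> = h the vertical gain is at least h - \<delta> = (L + 1) \<delta>,
    which exceeds L \<delta>.\<close>
  define h where "h = r / 8"
  define \<delta> where "\<delta> = h / (L + 2)"
  have h: "h > 0" using r by (simp add: h_def)
  have \<delta>: "\<delta> > 0" "(L + 2) * \<delta> = h" using h L0 by (auto simp: \<delta>_def)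
  have \<delta>h: "\<delta> \<le> h" using \<delta> L0 by (smt (verit) mult_le_cancel_right1)
  define \<pi> where "\<pi> y = y - (y \<bullet> e) *\<^sub>R e" for y
  have \<pi>0: "\<pi> y \<bullet> e = 0" for y by (simp add: \<pi>_def inner_diff_left ee)
  have "inner_cone \<Omega> a (r / 2) (h *\<^sub>R e) \<delta>"
    unfolding inner_cone_def
  proof (intro conjI ballI allI impI)
    fix y z :: "real^'n" and t :: real
    assume y: "y \<in> \<Omega> \<inter> ball a (r / 2)" and z: "z \<in> ball (h *\<^sub>R e) \<delta>" and t: "0 < t \<and> t \<le> 1"
    define w where "w = z - h *\<^sub>R e"
    have w: "norm w < \<delta>" using z by (simp add: w_def dist_norm norm_minus_commute)
    have z_eq: "z = h *\<^sub>R e + w" by (simp add: w_def)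
    have "norm z \<le> norm (h *\<^sub>R e) + norm w" unfolding z_eq by (rule norm_triangle_ineq)
    then have nz: "norm z \<le> 2 * h" using w \<delta>h h e by simp
    have "norm (t *\<^sub>R z) \<le> norm z" using t by (simp add: mult_left_le_one_le)
    then have "dist a (y + t *\<^sub>R z) < r"
      using y nz h dist_triangle[of a "y + t *\<^sub>R z" y] by (auto simp: dist_norm h_def)
    then have in_ball: "y + t *\<^sub>R z \<in> ball a r" by simp
    have "y \<in> \<Omega> \<inter> ball a r" using y r by auto
    then have yg: "y \<bullet> e > \<gamma> (\<pi> y)" unfolding graph \<pi>_def by auto
    have "\<pi> (y + t *\<^sub>R z) - \<pi> y = t *\<^sub>R \<pi> w"
      by (simp add: \<pi>_def z_eq algebra_simps inner_add_left ee)
    moreover have "norm (\<pi> w) \<le> norm w" unfolding \<pi>_def by (rule norm_orthogonal_part_le[OF e])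
    ultimately have a: "dist (\<pi> (y + t *\<^sub>R z)) (\<pi> y) \<le> t * \<delta>"
      using t w by (simp add: dist_norm)
    have b: "dist (\<gamma> (\<pi> (y + t *\<^sub>R z))) (\<gamma> (\<pi> y)) \<le> L * dist (\<pi> (y + t *\<^sub>R z)) (\<pi> y)"
      by (rule lipschitz_onD[OF L]) (simp_all add: \<pi>0)
    have "\<gamma> (\<pi> (y + t *\<^sub>R z)) \<le> \<gamma> (\<pi> y) + L * (t * \<delta>)"
      using b mult_left_mono[OF a L0] by (simp add: dist_real_def)
    moreover have "(y + t *\<^sub>R z) \<bullet> e = y \<bullet> e + t * (h + w \<bullet> e)"
      by (simp add: z_eq inner_add_left ee algebra_simps)
    moreover have "\<bar>w \<bullet> e\<bar> \<le> norm w" using Cauchy_Schwarz_ineq2[of w e] e by simp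
    then have "L * \<delta> \<le> h + w \<bullet> e" using w \<delta> by (simp add: algebra_simps)
    then have "t * (L * \<delta>) \<le> t * (h + w \<bullet> e)" using t by (intro mult_left_mono) auto
    then have "L * (t * \<delta>) \<le> t * (h + w \<bullet> e)" by (simp add: mult.left_commute)
    ultimately have "(y + t *\<^sub>R z) \<bullet> e > \<gamma> (\<pi> (y + t *\<^sub>R z))" using yg by linarith
    then have "y + t *\<^sub>R z \<in> \<Omega> \<inter> ball a r" unfolding graph using in_ball by (simp add: \<pi>_def)
    then show "y + t *\<^sub>R z \<in> \<Omega>" by simp
  qed (use r \<delta> in auto)
  then show ?thesis by (rule that)
qed

text \<open>Compactness of the closure. Half radii are used in the covering so that a cutoff can
  equal 1 on a covering ball and still vanish outside the ball on which the cone is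
  available.\<close>

lemma lipschitz_domain_finite_cones:
  fixes \<Omega> :: "(real^'n) set"
  assumes "lipschitz_domain \<Omega>" "bounded \<Omega>"
  obtains I \<rho> c \<delta> where "finite I" "closure \<Omega> \<subseteq> (\<Union>a\<in>I. ball a (\<rho> a / 2))"
    "\<And>a. a \<in> I \<Longrightarrow> inner_cone \<Omega> a (\<rho> a) (c a) (\<delta> a)"
proof -
  have "\<exists>q. inner_cone \<Omega> a (fst q) (fst (snd q)) (snd (snd q))" if a: "a \<in> closure \<Omega>" for a
  proof -
    obtain \<rho> c \<delta> where "inner_cone \<Omega> a \<rho> c \<delta>" using lipschitz_domain_inner_cone[OF assms(1) a] .
    then show ?thesis by (intro exI[of _ "(\<rho>, c, \<delta>)"]) simp
  qed
  then obtain q where q: "\<And>a. a \<in> closure \<Omega> \<Longrightarrow> inner_cone \<Omega> a (fst (q a)) (fst (snd (q a))) (snd (snd (q a)))"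
    by metis
  have cpt: "compact (closure \<Omega>)" using assms(2) by (simp add: compact_closure)
  have cov: "closure \<Omega> \<subseteq> (\<Union>a\<in>closure \<Omega>. ball a (fst (q a) / 2))"
  proof
    fix a assume "a \<in> closure \<Omega>"
    then have "a \<in> ball a (fst (q a) / 2)" using q[of a] by (simp add: inner_cone_def)
    then show "a \<in> (\<Union>a\<in>closure \<Omega>. ball a (fst (q a) / 2))" using \<open>a \<in> closure \<Omega>\<close> by blast
  qed
  obtain I where "I \<subseteq> closure \<Omega>" "finite I" "closure \<Omega> \<subseteq> (\<Union>a\<in>I. ball a (fst (q a) / 2))"
    by (rule compactE_image[OF cpt open_ball cov])
  then show ?thesis using q
    by (intro that[of I "\<lambda>a. fst (q a)" "\<lambda>a. fst (snd (q a))" "\<lambda>a. snd (snd (q a))"]) auto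
qed

section \<open>Translations and smooth probability kernels\<close>

lemma integral_lborel_translate:
  fixes f :: "'a::euclidean_space \<Rightarrow> 'b::{banach,second_countable_topology}"
  assumes "f \<in> borel_measurable borel"
  shows "(\<integral>z. f (x + z) \<partial>lborel) = (\<integral>z. f z \<partial>lborel)"
  using integral_distr[of "(+) x" lborel borel f] assms by (simp add: lborel_distr_plus)

lemma integrable_lborel_translate_iff:
  fixes f :: "'a::euclidean_space \<Rightarrow> 'b::{banach,second_countable_topology}"
  assumes "f \<in> borel_measurable borel"
  shows "integrable lborel (\<lambda>z. f (x + z)) \<longleftrightarrow> integrable lborel f"
  using integrable_distr_eq[of "(+) x" lborel borel f] assms by (simp add: lborel_distr_plus)

lemma has_grad_translate:
  assumes "has_grad k G"
  shows "has_grad (\<lambda>y. k (y - x)) (\<lambda>y. G (y - x))"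
  unfolding has_grad_def
proof
  fix y
  have "(k has_derivative (\<lambda>h. G (y - x) \<bullet> h)) (at (y - x))" using assms by (simp add: has_grad_def)
  moreover have "((\<lambda>y. y - x) has_derivative (\<lambda>h. h)) (at y)" by (auto intro!: derivative_eq_intros)
  ultimately show "((\<lambda>y. k (y - x)) has_derivative (\<lambda>h. G (y - x) \<bullet> h)) (at y)"
    using has_derivative_compose by blast
qed

lemma smooth_fun_translate:
  assumes "smooth_fun k"
  shows "smooth_fun (\<lambda>y. k (y - x))"
proof -
  have "Ck m (\<lambda>y. k (y - x))" if "Ck m k" for m
    using that
  proof (induction m arbitrary: k)
    case 0
    then have "continuous_on ((\<lambda>y. y - x) ` UNIV) k" by (auto intro: continuous_on_subset)
    then show ?case
      by (auto intro!: continuous_on_compose2[of _ k UNIV "\<lambda>y. y - x"] continuous_intros)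
  next
    case (Suc m)
    then obtain G where "has_grad k G" "\<And>i. Ck m (\<lambda>x. G x $ i)" unfolding Ck_Suc_iff by blast
    then show ?case unfolding Ck_Suc_iff
      using has_grad_translate[of k G x] Suc.IH by (intro exI[of _ "\<lambda>y. G (y - x)"]) auto
  qed
  then show ?thesis using assms by (simp add: smooth_fun_def)
qed

lemma smooth_kernel:
  fixes a :: "real^'n"
  assumes "r > 0"
  obtains k where "smooth_fun k" "\<And>x. k x \<ge> 0" "\<And>x. k x \<noteq> 0 \<longleftrightarrow> x \<in> ball a r"
    "integrable lborel k" "(\<integral>x. k x \<partial>lborel) = 1"
proof -
  obtain k where k: "smooth_fun k" "\<And>x. k x \<ge> 0" "\<And>x. k x > 0 \<longleftrightarrow> x \<in> ball a r"
    using smooth_bump[OF assms] by blast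
  have c: "continuous_on UNIV k" using k(1) by (rule smooth_fun_continuous_on)
  have [measurable]: "k \<in> borel_measurable borel" using c by (rule borel_measurable_continuous_onI)
  have k0: "k x = 0" if "x \<notin> ball a r" for x using k(2)[of x] k(3)[of x] that by linarith
  have "set_integrable lborel (cball a r) k"
    unfolding set_integrable_def
    by (rule borel_integrable_compact) (auto intro: continuous_on_subset[OF c])
  moreover have "(\<lambda>x. indicator (cball a r) x *\<^sub>R k x) = k"
  proof
    show "indicator (cball a r) x *\<^sub>R k x = k x" for x
      using k0[of x] by (auto simp: indicator_def)
  qed
  ultimately have i: "integrable lborel k" by (simp add: set_integrable_def)
  \<comment> \<open>A vanishing integral would make the bump zero almost everywhere, and the ball on
    which it is positive would be a null set.\<close>
  have "(\<integral>x. k x \<partial>lborel) \<noteq> 0"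
  proof
    assume "(\<integral>x. k x \<partial>lborel) = 0"
    then have "AE x in lborel. k x = 0"
      using integral_nonneg_eq_0_iff_AE[OF i] k(2) by auto
    then have "AE x in lborel. x \<notin> ball a r"
      by eventually_elim (use k(3) in force)
    then have "emeasure lborel (ball a r) = 0"
      by (subst (asm) AE_iff_measurable[of "ball a r"]) auto
    then show False
      using content_ball_pos[OF assms, where c=a] by (simp add: Sigma_Algebra.measure_def)
  qed
  then have pos: "(\<integral>x. k x \<partial>lborel) > 0" using Bochner_Integration.integral_nonneg[of lborel k] k(2) by (simp add: order_less_le)
  define C where "C = (\<integral>x. k x \<partial>lborel)"
  show ?thesis
  proof (rule that[of "\<lambda>x. (1 / C) * k x"])
    show "smooth_fun (\<lambda>x. (1 / C) * k x)" by (intro smooth_fun_mult smooth_fun_const k)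
    show "(1 / C) * k x \<noteq> 0 \<longleftrightarrow> x \<in> ball a r" for x
      using pos k(3)[of x] k0[of x] by (auto simp: C_def)
  qed (use pos i k in \<open>auto simp: C_def\<close>)
qed


section \<open>Density of smooth functions\<close>

text \<open>These are the pairs in the H^1 closure of smooth functions paired with their gradients.
  F is not asked to be a weak gradient of f, so products and sums need only the classical rules for
  the smooth approximants. The nonnegative integral expresses finiteness and smallness of the
  distance at once.\<close>

definition H1_approximable :: "(real^'n) set \<Rightarrow> (real^'n \<Rightarrow> real) \<Rightarrow> (real^'n \<Rightarrow> real^'n) \<Rightarrow> bool" where
  "H1_approximable \<Omega> f F \<longleftrightarrow> (\<forall>e>0. \<exists>w G. smooth_fun w \<and> has_grad w G \<and>
     (\<integral>\<^sup>+x\<in>\<Omega>. ennreal ((w x - f x)\<^sup>2 + (norm (G x - F x))\<^sup>2) \<partial>lborel) \<le> ennreal e)"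

lemma H1_approximable_add:
  fixes f g :: "real^'n \<Rightarrow> real"
  assumes [measurable]: "\<Omega> \<in> sets borel" "f \<in> borel_measurable borel" "F \<in> borel_measurable borel"
    "g \<in> borel_measurable borel" "G \<in> borel_measurable borel"
    and f: "H1_approximable \<Omega> f F" and g: "H1_approximable \<Omega> g G"
  shows "H1_approximable \<Omega> (\<lambda>x. f x + g x) (\<lambda>x. F x + G x)"
  unfolding H1_approximable_def
proof (intro allI impI)
  fix e :: real assume e: "e > 0"
  obtain v V where v: "smooth_fun v" "has_grad v V"
    and vf: "(\<integral>\<^sup>+x\<in>\<Omega>. ennreal ((v x - f x)\<^sup>2 + (norm (V x - F x))\<^sup>2) \<partial>lborel) \<le> ennreal (e / 4)"
    using f e unfolding H1_approximable_def by (meson zero_less_divide_iff zero_less_numeral)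
  obtain w W where w: "smooth_fun w" "has_grad w W"
    and wg: "(\<integral>\<^sup>+x\<in>\<Omega>. ennreal ((w x - g x)\<^sup>2 + (norm (W x - G x))\<^sup>2) \<partial>lborel) \<le> ennreal (e / 4)"
    using g e unfolding H1_approximable_def by (meson zero_less_divide_iff zero_less_numeral)
  have [measurable]: "v \<in> borel_measurable borel" "V \<in> borel_measurable borel"
    "w \<in> borel_measurable borel" "W \<in> borel_measurable borel"
    using v w smooth_fun_continuous_on smooth_fun_grad_continuous_on
    by (blast intro: borel_measurable_continuous_onI)+
  have pt: "(v x + w x - (f x + g x))\<^sup>2 + (norm (V x + W x - (F x + G x)))\<^sup>2
      \<le> 2 * ((v x - f x)\<^sup>2 + (norm (V x - F x))\<^sup>2) + 2 * ((w x - g x)\<^sup>2 + (norm (W x - G x))\<^sup>2)" for x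
  proof -
    have "(v x + w x - (f x + g x))\<^sup>2 \<le> 2 * (v x - f x)\<^sup>2 + 2 * (w x - g x)\<^sup>2"
      using power2_add_le[of "v x - f x" "w x - g x"] by (simp add: algebra_simps)
    moreover have "(norm (V x + W x - (F x + G x)))\<^sup>2 \<le> (norm (V x - F x) + norm (W x - G x))\<^sup>2"
      using norm_triangle_ineq[of "V x - F x" "W x - G x"] by (intro power_mono) (auto simp: algebra_simps)
    moreover have "(norm (V x - F x) + norm (W x - G x))\<^sup>2 \<le> 2 * (norm (V x - F x))\<^sup>2 + 2 * (norm (W x - G x))\<^sup>2"
      by (rule power2_add_le)
    moreover have "A + B \<le> 2 * (a + c) + 2 * (b + d)"
      if "A \<le> 2 * a + 2 * b" "B \<le> X" "X \<le> 2 * c + 2 * d" for A B X a b c d :: real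
      using that by argo
    ultimately show ?thesis by blast
  qed
  have "(\<integral>\<^sup>+x\<in>\<Omega>. ennreal ((v x + w x - (f x + g x))\<^sup>2 + (norm (V x + W x - (F x + G x)))\<^sup>2) \<partial>lborel)
    \<le> (\<integral>\<^sup>+x. 2 * (ennreal ((v x - f x)\<^sup>2 + (norm (V x - F x))\<^sup>2) * indicator \<Omega> x)
         + 2 * (ennreal ((w x - g x)\<^sup>2 + (norm (W x - G x))\<^sup>2) * indicator \<Omega> x) \<partial>lborel)"
  proof (rule nn_integral_mono)
    fix x
    have "ennreal ((v x + w x - (f x + g x))\<^sup>2 + (norm (V x + W x - (F x + G x)))\<^sup>2)
      \<le> 2 * ennreal ((v x - f x)\<^sup>2 + (norm (V x - F x))\<^sup>2) + 2 * ennreal ((w x - g x)\<^sup>2 + (norm (W x - G x))\<^sup>2)"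
      using ennreal_leI[OF pt[of x]] by (simp add: ennreal_plus ennreal_mult del: ennreal_plus[symmetric])
    then show "ennreal ((v x + w x - (f x + g x))\<^sup>2 + (norm (V x + W x - (F x + G x)))\<^sup>2) * indicator \<Omega> x
      \<le> 2 * (ennreal ((v x - f x)\<^sup>2 + (norm (V x - F x))\<^sup>2) * indicator \<Omega> x)
         + 2 * (ennreal ((w x - g x)\<^sup>2 + (norm (W x - G x))\<^sup>2) * indicator \<Omega> x)"
      by (cases "x \<in> \<Omega>") auto
  qed
  also have "\<dots> = 2 * (\<integral>\<^sup>+x\<in>\<Omega>. ennreal ((v x - f x)\<^sup>2 + (norm (V x - F x))\<^sup>2) \<partial>lborel)
       + 2 * (\<integral>\<^sup>+x\<in>\<Omega>. ennreal ((w x - g x)\<^sup>2 + (norm (W x - G x))\<^sup>2) \<partial>lborel)"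
    by (simp add: nn_integral_add nn_integral_cmult)
  also have "\<dots> \<le> 2 * ennreal (e / 4) + 2 * ennreal (e / 4)"
    by (intro add_mono mult_left_mono vf wg) auto
  also have "\<dots> = ennreal e"
    using ennreal_mult[of 2 "e / 4"] ennreal_plus[of "e / 2" "e / 2"] e by simp
  finally show "\<exists>w G'. smooth_fun w \<and> has_grad w G' \<and>
     (\<integral>\<^sup>+x\<in>\<Omega>. ennreal ((w x - (f x + g x))\<^sup>2 + (norm (G' x - (F x + G x)))\<^sup>2) \<partial>lborel) \<le> ennreal e"
    using v w by (intro exI[of _ "\<lambda>x. v x + w x"] exI[of _ "\<lambda>x. V x + W x"])
      (auto intro: smooth_fun_add has_grad_add)
qed

lemma smooth_fun_bounded_on:
  fixes P :: "real^'n \<Rightarrow> real"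
  assumes "smooth_fun P" "has_grad P G" "bounded \<Omega>"
  obtains K where "K \<ge> 0" "\<And>x. x \<in> \<Omega> \<Longrightarrow> \<bar>P x\<bar> \<le> K" "\<And>x. x \<in> \<Omega> \<Longrightarrow> norm (G x) \<le> K"
proof -
  have c: "compact (closure \<Omega>)" using assms(3) by (simp add: compact_closure)
  have "compact (P ` closure \<Omega>)" "compact (G ` closure \<Omega>)"
    by (intro compact_continuous_image c smooth_fun_continuous_on[OF assms(1)] smooth_fun_grad_continuous_on[OF assms(1,2)])+
  then have "\<exists>K. \<forall>x\<in>closure \<Omega>. norm (P x) \<le> K" "\<exists>K. \<forall>x\<in>closure \<Omega>. norm (G x) \<le> K"
    by (auto dest!: compact_imp_bounded simp: bounded_iff)
  then obtain K1 K2 where "\<And>x. x \<in> closure \<Omega> \<Longrightarrow> norm (P x) \<le> K1" "\<And>x. x \<in> closure \<Omega> \<Longrightarrow> norm (G x) \<le> K2"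
    by blast
  then show ?thesis
    using closure_subset[of \<Omega>] by (intro that[of "max 0 (max K1 K2)"]) (force simp: le_max_iff_disj)+
qed

lemma H1_approximable_smooth_mult:
  fixes f P :: "real^'n \<Rightarrow> real"
  assumes [measurable]: "\<Omega> \<in> sets borel" "f \<in> borel_measurable borel" "F \<in> borel_measurable borel"
    and f: "H1_approximable \<Omega> f F" and P: "smooth_fun P" "has_grad P G" and \<Omega>: "bounded \<Omega>"
  shows "H1_approximable \<Omega> (\<lambda>x. P x * f x) (\<lambda>x. f x *\<^sub>R G x + P x *\<^sub>R F x)"
  unfolding H1_approximable_def
proof (intro allI impI)
  fix e :: real assume e: "e > 0"
  obtain K where K: "K \<ge> 0" "\<And>x. x \<in> \<Omega> \<Longrightarrow> \<bar>P x\<bar> \<le> K" "\<And>x. x \<in> \<Omega> \<Longrightarrow> norm (G x) \<le> K"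
    using smooth_fun_bounded_on[OF P \<Omega>] by blast
  \<comment> \<open>One K^2 comes from the values and 2 K^2 from the term (v - f) G of the gradient;
    the summand 1 makes C positive when K = 0.\<close>
  define C where "C = 3 * K\<^sup>2 + 1"
  have C: "C > 0" unfolding C_def using zero_le_power2[of K] by linarith
  then have "e / C > 0" using e by simp
  then obtain v V where v: "smooth_fun v" "has_grad v V"
    and vf: "(\<integral>\<^sup>+x\<in>\<Omega>. ennreal ((v x - f x)\<^sup>2 + (norm (V x - F x))\<^sup>2) \<partial>lborel) \<le> ennreal (e / C)"
    using f unfolding H1_approximable_def by meson
  have [measurable]: "v \<in> borel_measurable borel" "V \<in> borel_measurable borel"
    using v smooth_fun_continuous_on smooth_fun_grad_continuous_on
    by (blast intro: borel_measurable_continuous_onI)+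
  have pt: "(P x * v x - P x * f x)\<^sup>2 + (norm ((v x *\<^sub>R G x + P x *\<^sub>R V x) - (f x *\<^sub>R G x + P x *\<^sub>R F x)))\<^sup>2
      \<le> C * ((v x - f x)\<^sup>2 + (norm (V x - F x))\<^sup>2)" if x: "x \<in> \<Omega>" for x
  proof -
    have 1: "(P x * v x - P x * f x)\<^sup>2 \<le> K\<^sup>2 * (v x - f x)\<^sup>2"
    proof -
      have "(P x * v x - P x * f x)\<^sup>2 = \<bar>P x\<bar>\<^sup>2 * (v x - f x)\<^sup>2"
        by (simp add: right_diff_distrib[symmetric] power_mult_distrib)
      also have "\<dots> \<le> K\<^sup>2 * (v x - f x)\<^sup>2" using K(2)[OF x] by (intro mult_right_mono power_mono) auto
      finally show ?thesis .
    qed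
    have "(v x *\<^sub>R G x + P x *\<^sub>R V x) - (f x *\<^sub>R G x + P x *\<^sub>R F x) = (v x - f x) *\<^sub>R G x + P x *\<^sub>R (V x - F x)"
      by (simp add: algebra_simps)
    then have "norm ((v x *\<^sub>R G x + P x *\<^sub>R V x) - (f x *\<^sub>R G x + P x *\<^sub>R F x))
       \<le> \<bar>v x - f x\<bar> * norm (G x) + \<bar>P x\<bar> * norm (V x - F x)"
      using norm_triangle_ineq[of "(v x - f x) *\<^sub>R G x" "P x *\<^sub>R (V x - F x)"] by simp
    also have "\<dots> \<le> \<bar>v x - f x\<bar> * K + K * norm (V x - F x)"
      using K(2,3)[OF x] by (intro add_mono mult_left_mono mult_right_mono) auto
    finally have "(norm ((v x *\<^sub>R G x + P x *\<^sub>R V x) - (f x *\<^sub>R G x + P x *\<^sub>R F x)))\<^sup>2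
       \<le> (\<bar>v x - f x\<bar> * K + K * norm (V x - F x))\<^sup>2" by (intro power_mono) auto
    also have "\<dots> \<le> 2 * (\<bar>v x - f x\<bar> * K)\<^sup>2 + 2 * (K * norm (V x - F x))\<^sup>2" by (rule power2_add_le)
    also have "\<dots> = 2 * K\<^sup>2 * (v x - f x)\<^sup>2 + 2 * K\<^sup>2 * (norm (V x - F x))\<^sup>2"
      by (simp add: power_mult_distrib)
    finally have "(P x * v x - P x * f x)\<^sup>2 + (norm ((v x *\<^sub>R G x + P x *\<^sub>R V x) - (f x *\<^sub>R G x + P x *\<^sub>R F x)))\<^sup>2
      \<le> 3 * K\<^sup>2 * (v x - f x)\<^sup>2 + 2 * K\<^sup>2 * (norm (V x - F x))\<^sup>2" using 1 by linarith
    also have "\<dots> \<le> C * (v x - f x)\<^sup>2 + C * (norm (V x - F x))\<^sup>2"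
      unfolding C_def using zero_le_power2[of K] by (intro add_mono mult_right_mono) auto
    finally show ?thesis by (simp add: distrib_left)
  qed
  have "(\<integral>\<^sup>+x\<in>\<Omega>. ennreal ((P x * v x - P x * f x)\<^sup>2 + (norm ((v x *\<^sub>R G x + P x *\<^sub>R V x) - (f x *\<^sub>R G x + P x *\<^sub>R F x)))\<^sup>2) \<partial>lborel)
    \<le> (\<integral>\<^sup>+x. ennreal C * (ennreal ((v x - f x)\<^sup>2 + (norm (V x - F x))\<^sup>2) * indicator \<Omega> x) \<partial>lborel)"
  proof (rule nn_integral_mono)
    fix x
    show "ennreal ((P x * v x - P x * f x)\<^sup>2 + (norm ((v x *\<^sub>R G x + P x *\<^sub>R V x) - (f x *\<^sub>R G x + P x *\<^sub>R F x)))\<^sup>2) * indicator \<Omega> x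
      \<le> ennreal C * (ennreal ((v x - f x)\<^sup>2 + (norm (V x - F x))\<^sup>2) * indicator \<Omega> x)"
      using ennreal_leI[OF pt[of x]] C by (cases "x \<in> \<Omega>") (auto simp: ennreal_mult)
  qed
  also have "\<dots> = ennreal C * (\<integral>\<^sup>+x\<in>\<Omega>. ennreal ((v x - f x)\<^sup>2 + (norm (V x - F x))\<^sup>2) \<partial>lborel)"
    by (simp add: nn_integral_cmult)
  also have "\<dots> \<le> ennreal C * ennreal (e / C)" by (intro mult_left_mono vf) auto
  also have "\<dots> = ennreal e" using C e by (simp add: ennreal_mult[symmetric])
  finally show "\<exists>w G'. smooth_fun w \<and> has_grad w G' \<and>
     (\<integral>\<^sup>+x\<in>\<Omega>. ennreal ((w x - P x * f x)\<^sup>2 + (norm (G' x - (f x *\<^sub>R G x + P x *\<^sub>R F x)))\<^sup>2) \<partial>lborel) \<le> ennreal e"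
    using v P by (intro exI[of _ "\<lambda>x. P x * v x"] exI[of _ "\<lambda>x. v x *\<^sub>R G x + P x *\<^sub>R V x"])
      (auto intro: smooth_fun_mult has_grad_mult)
qed

text \<open>On the bounded support, |f| is at most the integrable function 1 + f^2.\<close>

lemma nn_integral_square_integrable:
  fixes f :: "'a::euclidean_space \<Rightarrow> real"
  assumes [measurable]: "f \<in> borel_measurable borel"
    and fin: "(\<integral>\<^sup>+x. ennreal ((f x)\<^sup>2) \<partial>lborel) < \<infinity>" and B: "\<And>x. norm x > B \<Longrightarrow> f x = 0"
  shows "integrable lborel f"
proof (rule Bochner_Integration.integrable_bound)
  have "integrable lborel (\<lambda>x. (f x)\<^sup>2)"
    using fin by (intro integrableI_nonneg) auto
  moreover have "integrable lborel (\<lambda>x::'a. indicator (cball 0 B) x :: real)"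
    using emeasure_lborel_cball_finite[of "0::'a" B] by (intro integrable_real_indicator) auto
  ultimately show "integrable lborel (\<lambda>x. indicator (cball 0 B) x + (f x)\<^sup>2)"
    by (rule Bochner_Integration.integrable_add[rotated])
  show "AE x in lborel. norm (f x) \<le> norm (indicator (cball 0 B) x + (f x)\<^sup>2 :: real)"
  proof (rule AE_I2)
    fix x
    have "\<bar>f x\<bar> \<le> 1 + (f x)\<^sup>2" using sum_squares_bound[of "\<bar>f x\<bar>" 1] by auto
    then show "norm (f x) \<le> norm (indicator (cball 0 B) x + (f x)\<^sup>2 :: real)"
      using B[of x] by (cases "norm x > B") (auto simp: indicator_def)
  qed
qed simp

lemma mollify_eq_translate:
  fixes f k :: "'a::euclidean_space \<Rightarrow> real"
  assumes [measurable]: "f \<in> borel_measurable borel" "k \<in> borel_measurable borel"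
  shows "(\<integral>y. f y * k (y - x) \<partial>lborel) = (\<integral>z. f (x + z) * k z \<partial>lborel)"
  using integral_lborel_translate[of "\<lambda>y. f y * k (y - x)" x] by simp

lemma borel_measurable_vec_component:
  fixes f :: "'a \<Rightarrow> real^'n"
  assumes "f \<in> borel_measurable M"
  shows "(\<lambda>x. f x $ i) \<in> borel_measurable M"
  by (rule borel_measurable_continuous_on[OF _ assms]) (intro continuous_intros)

lemma norm_squared_vec: "(norm (x::real^'n))\<^sup>2 = (\<Sum>i\<in>UNIV. (x $ i)\<^sup>2)"
  unfolding power2_norm_eq_inner by (simp add: inner_vec_def power2_eq_square)

text \<open>Mollifying with a kernel supported in the cone direction keeps the averages at points of
  \<open>\<Omega> \<inter> ball a \<rho>\<close> inside \<open>\<Omega>\<close>, so the weak gradient may be mollified up to the boundary.\<close>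

lemma H1_approximable_local:
  fixes \<Omega> :: "(real^'n) set" and u :: "real^'n \<Rightarrow> real" and D :: "real^'n \<Rightarrow> real^'n"
  assumes \<Omega>: "open \<Omega>" "bounded \<Omega>" and cone: "inner_cone \<Omega> a \<rho> c \<delta>"
    and [measurable]: "u \<in> borel_measurable borel" "D \<in> borel_measurable borel"
    and u0: "\<And>x. x \<notin> \<Omega> \<Longrightarrow> u x = 0" and D0: "\<And>x. x \<notin> \<Omega> \<Longrightarrow> D x = 0"
    and u2: "(\<integral>\<^sup>+x. ennreal ((u x)\<^sup>2) \<partial>lborel) < \<infinity>"
    and D2: "\<And>i. (\<integral>\<^sup>+x. ennreal ((D x $ i)\<^sup>2) \<partial>lborel) < \<infinity>"
    and weak: "\<And>\<phi> g i. smooth_fun \<phi> \<Longrightarrow> has_grad \<phi> g \<Longrightarrow> compact (closure {x. \<phi> x \<noteq> 0}) \<Longrightarrow>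
        closure {x. \<phi> x \<noteq> 0} \<subseteq> \<Omega> \<Longrightarrow>
        (\<integral>x. u x * (g x $ i) \<partial>lborel) = - (\<integral>x. (D x $ i) * \<phi> x \<partial>lborel)"
    and P: "smooth_fun P" "has_grad P G" and P0: "\<And>x. x \<notin> ball a \<rho> \<Longrightarrow> P x = 0"
  shows "H1_approximable \<Omega> (\<lambda>x. P x * u x) (\<lambda>x. u x *\<^sub>R G x + P x *\<^sub>R D x)"
  unfolding H1_approximable_def
proof (intro allI impI)
  fix e :: real assume e: "e > 0"
  obtain K where K: "K \<ge> 0" "\<And>x. x \<in> \<Omega> \<Longrightarrow> \<bar>P x\<bar> \<le> K" "\<And>x. x \<in> \<Omega> \<Longrightarrow> norm (G x) \<le> K"
    using smooth_fun_bounded_on[OF P \<Omega>(2)] by blast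
  obtain B where B: "B \<ge> 0" "\<Omega> \<subseteq> cball 0 B"
  proof -
    obtain B where "\<And>x. x \<in> \<Omega> \<Longrightarrow> norm x \<le> B" using \<Omega>(2) by (auto simp: bounded_iff)
    then show ?thesis by (intro that[of "max 0 B"]) (auto simp: le_max_iff_disj)
  qed
  have out: "\<And>x. norm x > B \<Longrightarrow> x \<notin> \<Omega>" using B(2) by (auto simp: subset_iff not_le[symmetric])
  have uB: "\<And>x. norm x > B \<Longrightarrow> u x = 0" and DB: "\<And>x i. norm x > B \<Longrightarrow> D x $ i = 0"
    by (simp_all add: u0 D0 out)
  have [measurable]: "(\<lambda>x. D x $ i) \<in> borel_measurable borel" for i
    by (rule borel_measurable_vec_component) simp
  have ui: "integrable lborel u" and Di: "\<And>i. integrable lborel (\<lambda>x. D x $ i)"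
    by (rule nn_integral_square_integrable[OF _ _ uB] nn_integral_square_integrable[OF _ _ DB]; use u2 D2 in simp)+
  define N where "N = real CARD('n)"
  \<comment> \<open>The final estimate has 3 K^2 times the error for u and 2 K^2 times the errors
    for the N components of D, each of which will be at most \<eta>.\<close>
  define C where "C = 3 * K\<^sup>2 + 2 * K\<^sup>2 * N + 1"
  have C: "C > 0" unfolding C_def N_def using zero_le_power2[of K] by (simp add: add_nonneg_pos)
  define \<eta> where "\<eta> = e / C"
  have \<eta>: "\<eta> > 0" using e C by (simp add: \<eta>_def)
  have [measurable]: "\<Omega> \<in> sets borel" using \<Omega>(1) by simp

  define mol where "mol k f x = (\<integral>z. f (x + z) * k z \<partial>lborel)" for k f :: "real^'n \<Rightarrow> real" and x
  define adm where "adm d k \<longleftrightarrow> integrable lborel k \<and> (\<forall>z. k z \<ge> 0) \<and> (\<integral>z. k z \<partial>lborel) = 1 \<and>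
     (\<forall>z. norm z \<ge> d \<longrightarrow> k z = 0)" for d and k :: "real^'n \<Rightarrow> real"
  obtain d0 where d0: "d0 > 0" "\<And>k. adm d0 k \<Longrightarrow> (\<And>x. integrable lborel (\<lambda>z. u (x + z) * k z)) \<Longrightarrow>
       (\<integral>\<^sup>+x. ennreal ((mol k u x - u x)\<^sup>2) \<partial>lborel) \<le> ennreal \<eta>"
    unfolding mol_def adm_def by (rule mollify_tendsto_L2[OF _ u2 B(1) uB \<eta>]) auto
  define good where "good i d \<longleftrightarrow> d > 0 \<and> (\<forall>k. adm d k \<longrightarrow> (\<forall>x. integrable lborel (\<lambda>z. D (x + z) $ i * k z)) \<longrightarrow>
       (\<integral>\<^sup>+x. ennreal ((mol k (\<lambda>x. D x $ i) x - D x $ i)\<^sup>2) \<partial>lborel) \<le> ennreal \<eta>)" for i d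
  have "\<exists>d. good i d" for i
    unfolding good_def mol_def adm_def by (rule mollify_tendsto_L2[where f="\<lambda>x. D x $ i", OF _ D2 B(1) DB \<eta>]) auto
  then obtain d1 where "\<And>i. good i (d1 i)" by metis
  then have d1: "\<And>i. d1 i > 0" "\<And>i k. adm (d1 i) k \<Longrightarrow> (\<And>x. integrable lborel (\<lambda>z. D (x + z) $ i * k z)) \<Longrightarrow>
       (\<integral>\<^sup>+x. ennreal ((mol k (\<lambda>x. D x $ i) x - D x $ i)\<^sup>2) \<partial>lborel) \<le> ennreal \<eta>"
    unfolding good_def by blast+
  \<comment> \<open>A single kernel has to serve u and all components of D, hence the minimum of the
    finitely many thresholds.\<close>
  define d where "d = min d0 (Min (range d1))"
  have d: "d > 0" "d \<le> d0" "\<And>i. d \<le> d1 i"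
    using d0(1) d1(1) by (auto simp: d_def intro!: min.coboundedI2)
  have adm_mono: "adm d' k" if "adm d k" "d \<le> d'" for d' k
    using that unfolding adm_def by auto
  have cone': "\<rho> > 0" "\<delta> > 0" "\<And>y z t. y \<in> \<Omega> \<Longrightarrow> y \<in> ball a \<rho> \<Longrightarrow> z \<in> ball c \<delta> \<Longrightarrow> 0 < t \<Longrightarrow> t \<le> 1 \<Longrightarrow> y + t *\<^sub>R z \<in> \<Omega>"
    using cone unfolding inner_cone_def by auto
  \<comment> \<open>Shrinking the cone by t brings the ball around t c within distance d of the
    origin. Half the radius, \<delta>/2, is used for the kernel so that its closed support remains
    inside the open cone.\<close>
  define t where "t = min 1 (d / (norm c + \<delta>))"
  have nc: "norm c + \<delta> > 0" using cone'(2) by (simp add: add_nonneg_pos)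
  have t: "0 < t" "t \<le> 1" "t * (norm c + \<delta>) \<le> d"
    using d nc by (auto simp: t_def min_def divide_simps)
  obtain k where k: "smooth_fun k" "\<And>x. k x \<ge> 0" "\<And>x. k x \<noteq> 0 \<longleftrightarrow> x \<in> ball (t *\<^sub>R c) (t * (\<delta> / 2))"
    "integrable lborel k" "(\<integral>x. k x \<partial>lborel) = 1"
    using smooth_kernel[of "t * (\<delta> / 2)" "t *\<^sub>R c"] t cone' by auto
  obtain H where H: "has_grad k H" "\<And>i. smooth_fun (\<lambda>x. H x $ i)" using smooth_funE[OF k(1)] by blast
  have Hc: "continuous_on UNIV H" by (rule smooth_fun_grad_continuous_on[OF k(1) H(1)])
  have kc: "continuous_on UNIV k" by (rule smooth_fun_continuous_on[OF k(1)])
  have [measurable]: "k \<in> borel_measurable borel" using kc by (rule borel_measurable_continuous_onI)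
  have supp: "norm x < d" if "k x \<noteq> 0" for x
  proof -
    have "norm (x - t *\<^sub>R c) < t * (\<delta> / 2)" using that k(3)[of x] by (simp add: dist_norm norm_minus_commute)
    moreover have "t * (\<delta> / 2) < t * \<delta>" using t cone' by simp
    moreover have "norm x \<le> norm (x - t *\<^sub>R c) + norm (t *\<^sub>R c)" using norm_triangle_ineq[of "x - t *\<^sub>R c" "t *\<^sub>R c"] by simp
    ultimately show ?thesis using t by (simp add: algebra_simps)
  qed
  then have kd: "k x = 0" if "norm x > d" for x using that by force
  have admk: "adm d k" unfolding adm_def using k supp by (auto simp: not_less[symmetric])
  have int_mol: "integrable lborel (\<lambda>z. f (x + z) * k z)" if "integrable lborel f" for f :: "real^'n \<Rightarrow> real" and x
  proof -
    have [measurable]: "f \<in> borel_measurable borel" using that by auto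
    have "integrable lborel (\<lambda>y. f y *\<^sub>R k (y - x))" by (rule integrable_mult_kernel[OF that kc kd])
    then show ?thesis using integrable_lborel_translate_iff[of "\<lambda>y. f y *\<^sub>R k (y - x)" x] by simp
  qed
  have mu: "(\<integral>\<^sup>+x. ennreal ((mol k u x - u x)\<^sup>2) \<partial>lborel) \<le> ennreal \<eta>"
    by (rule d0(2)[OF adm_mono[OF admk d(2)] int_mol[OF ui]])
  have mD: "(\<integral>\<^sup>+x. ennreal ((mol k (\<lambda>x. D x $ i) x - D x $ i)\<^sup>2) \<partial>lborel) \<le> ennreal \<eta>" for i
    by (rule d1(2)[OF adm_mono[OF admk d(3)] int_mol[OF Di]])

  have mol_u: "mol k u = (\<lambda>x. \<integral>y. u y * k (y - x) \<partial>lborel)"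
    unfolding mol_def by (intro ext mollify_eq_translate[symmetric]) auto
  define M where "M x = - (\<integral>y. u y *\<^sub>R H (y - x) \<partial>lborel)" for x
  have sm: "smooth_fun (mol k u)" unfolding mol_u by (rule smooth_fun_mollify[OF ui k(1) kd])
  have gm: "has_grad (mol k u) M" unfolding mol_u M_def by (rule has_grad_mollify[OF ui H(1) Hc kd])
  have Hd: "H x = 0" if "norm x > d" for x using has_grad_zero_outside[OF H(1) kd that] by simp
  \<comment> \<open>The function y -> k(y - x) is supported in x plus the shrunken cone, which lies
    in \<Omega>, so it is a test function for the weak gradient. The minus sign of the weak identity
    cancels the one in the definition of \<open>M\<close>.\<close>
  have M_eq: "M x $ i = mol k (\<lambda>x. D x $ i) x" if x: "x \<in> \<Omega>" "x \<in> ball a \<rho>" for x i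
  proof -
    have "M x $ i = - (\<integral>y. u y * (H (y - x) $ i) \<partial>lborel)"
      unfolding M_def
      using integral_bounded_linear[OF bounded_linear_vec_nth[of i] integrable_mult_kernel[OF ui Hc Hd, where x=x]]
      by simp
    also have "(\<integral>y. u y * (H (y - x) $ i) \<partial>lborel) = - (\<integral>y. (D y $ i) * k (y - x) \<partial>lborel)"
    proof (rule weak)
      show "smooth_fun (\<lambda>y. k (y - x))" by (rule smooth_fun_translate[OF k(1)])
      show "has_grad (\<lambda>y. k (y - x)) (\<lambda>y. H (y - x))" by (rule has_grad_translate[OF H(1)])
      have "{y. k (y - x) \<noteq> 0} \<subseteq> cball (x + t *\<^sub>R c) (t * (\<delta> / 2))"
        using k(3) by (auto simp: dist_norm algebra_simps)
      then have sub: "closure {y. k (y - x) \<noteq> 0} \<subseteq> cball (x + t *\<^sub>R c) (t * (\<delta> / 2))"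
        by (rule closure_minimal) simp
      then show "compact (closure {y. k (y - x) \<noteq> 0})"
        using bounded_subset[OF bounded_cball] by (auto simp: compact_eq_bounded_closed)
      have "cball (x + t *\<^sub>R c) (t * (\<delta> / 2)) \<subseteq> \<Omega>"
      proof
        fix y assume "y \<in> cball (x + t *\<^sub>R c) (t * (\<delta> / 2))"
        then have y: "norm (y - x - t *\<^sub>R c) \<le> t * (\<delta> / 2)" by (simp add: dist_norm norm_minus_commute algebra_simps)
        define z where "z = (1 / t) *\<^sub>R (y - x)"
        have z: "y = x + t *\<^sub>R z" using t by (simp add: z_def)
        have "t *\<^sub>R (z - c) = y - x - t *\<^sub>R c" by (simp add: z algebra_simps)
        then have "t * norm (z - c) \<le> t * (\<delta> / 2)" using y t by (metis abs_of_pos norm_scaleR)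
        then have "norm (z - c) \<le> \<delta> / 2" using t by simp
        then have "z \<in> ball c \<delta>" using cone'(2) by (simp add: dist_norm norm_minus_commute)
        then show "y \<in> \<Omega>" unfolding z using cone'(3)[OF x] t by auto
      qed
      then show "closure {y. k (y - x) \<noteq> 0} \<subseteq> \<Omega>" using sub by blast
    qed
    also have "(\<integral>y. (D y $ i) * k (y - x) \<partial>lborel) = mol k (\<lambda>x. D x $ i) x"
      unfolding mol_def by (rule mollify_eq_translate) auto
    finally show ?thesis by simp
  qed
  define E where "E x = (mol k u x - u x)\<^sup>2" for x
  define F where "F i x = (mol k (\<lambda>x. D x $ i) x - D x $ i)\<^sup>2" for i x
  have mol_meas: "(\<lambda>x. mol k f x) \<in> borel_measurable borel" if "f \<in> borel_measurable borel" for f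
  proof -
    have [measurable]: "f \<in> borel_measurable borel" by fact
    show ?thesis unfolding mol_def by measurable
  qed
  have [measurable]: "E \<in> borel_measurable borel" "F i \<in> borel_measurable borel" for i
    unfolding E_def F_def using mol_meas by measurable
  have EF: "E x \<ge> 0" "F i x \<ge> 0" for i x by (auto simp: E_def F_def)
  have pt: "(P x * mol k u x - P x * u x)\<^sup>2 + (norm ((mol k u x *\<^sub>R G x + P x *\<^sub>R M x) - (u x *\<^sub>R G x + P x *\<^sub>R D x)))\<^sup>2
      \<le> 3 * K\<^sup>2 * E x + 2 * K\<^sup>2 * (\<Sum>i\<in>UNIV. F i x)" if x: "x \<in> \<Omega>" for x
  proof -
    have 1: "(P x * mol k u x - P x * u x)\<^sup>2 \<le> K\<^sup>2 * E x"
    proof -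
      have "(P x * mol k u x - P x * u x)\<^sup>2 = \<bar>P x\<bar>\<^sup>2 * E x"
        by (simp add: E_def right_diff_distrib[symmetric] power_mult_distrib)
      also have "\<dots> \<le> K\<^sup>2 * E x" using K(2)[OF x] EF by (intro mult_right_mono power_mono) auto
      finally show ?thesis .
    qed
    \<comment> \<open>The identity \<open>M_eq\<close> is available only in the ball; outside it P
      vanishes.\<close>
    have 2: "(norm (P x *\<^sub>R (M x - D x)))\<^sup>2 \<le> K\<^sup>2 * (\<Sum>i\<in>UNIV. F i x)"
    proof (cases "x \<in> ball a \<rho>")
      case True
      have "(norm (M x - D x))\<^sup>2 = (\<Sum>i\<in>UNIV. F i x)"
        by (simp add: norm_squared_vec F_def M_eq[OF x True])
      moreover have "\<bar>P x\<bar>\<^sup>2 * (norm (M x - D x))\<^sup>2 \<le> K\<^sup>2 * (norm (M x - D x))\<^sup>2"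
        using K(2)[OF x] by (intro mult_right_mono power_mono) auto
      ultimately show ?thesis by (simp add: power_mult_distrib)
    next
      case False
      then show ?thesis using P0[of x] EF by (simp add: sum_nonneg)
    qed
    have 3: "(norm ((mol k u x - u x) *\<^sub>R G x))\<^sup>2 \<le> K\<^sup>2 * E x"
    proof -
      have "(norm ((mol k u x - u x) *\<^sub>R G x))\<^sup>2 = (norm (G x))\<^sup>2 * E x"
        by (simp add: E_def power_mult_distrib)
      also have "\<dots> \<le> K\<^sup>2 * E x" using K(3)[OF x] EF by (intro mult_right_mono power_mono) auto
      finally show ?thesis .
    qed
    have "(mol k u x *\<^sub>R G x + P x *\<^sub>R M x) - (u x *\<^sub>R G x + P x *\<^sub>R D x) = (mol k u x - u x) *\<^sub>R G x + P x *\<^sub>R (M x - D x)"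
      by (simp add: algebra_simps)
    then have "(norm ((mol k u x *\<^sub>R G x + P x *\<^sub>R M x) - (u x *\<^sub>R G x + P x *\<^sub>R D x)))\<^sup>2
       \<le> (norm ((mol k u x - u x) *\<^sub>R G x) + norm (P x *\<^sub>R (M x - D x)))\<^sup>2"
      using norm_triangle_ineq[of "(mol k u x - u x) *\<^sub>R G x" "P x *\<^sub>R (M x - D x)"] by (intro power_mono) auto
    also have "\<dots> \<le> 2 * (norm ((mol k u x - u x) *\<^sub>R G x))\<^sup>2 + 2 * (norm (P x *\<^sub>R (M x - D x)))\<^sup>2"
      by (rule power2_add_le)
    finally have 4: "(norm ((mol k u x *\<^sub>R G x + P x *\<^sub>R M x) - (u x *\<^sub>R G x + P x *\<^sub>R D x)))\<^sup>2
      \<le> 2 * (norm ((mol k u x - u x) *\<^sub>R G x))\<^sup>2 + 2 * (norm (P x *\<^sub>R (M x - D x)))\<^sup>2" .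
    have "A + X \<le> 3 * b + 2 * s" if "A \<le> b" "X \<le> 2 * Y + 2 * Z" "Y \<le> b" "Z \<le> s" for A X Y Z b s :: real
      using that by argo
    from this[OF 1 4 3 2] show ?thesis by (simp add: mult.assoc)
  qed
  have "(\<integral>\<^sup>+x\<in>\<Omega>. ennreal ((P x * mol k u x - P x * u x)\<^sup>2 + (norm ((mol k u x *\<^sub>R G x + P x *\<^sub>R M x) - (u x *\<^sub>R G x + P x *\<^sub>R D x)))\<^sup>2) \<partial>lborel)
    \<le> (\<integral>\<^sup>+x. ennreal (3 * K\<^sup>2) * ennreal (E x) + ennreal (2 * K\<^sup>2) * (\<Sum>i\<in>UNIV. ennreal (F i x)) \<partial>lborel)"
  proof (rule nn_integral_mono)
    fix x
    have "ennreal (3 * K\<^sup>2) * ennreal (E x) + ennreal (2 * K\<^sup>2) * (\<Sum>i\<in>UNIV. ennreal (F i x))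
      = ennreal (3 * K\<^sup>2 * E x + 2 * K\<^sup>2 * (\<Sum>i\<in>UNIV. F i x))"
      using EF by (simp add: ennreal_mult[symmetric] ennreal_plus[symmetric] sum_nonneg sum_ennreal del: ennreal_plus)
    then show "ennreal ((P x * mol k u x - P x * u x)\<^sup>2 + (norm ((mol k u x *\<^sub>R G x + P x *\<^sub>R M x) - (u x *\<^sub>R G x + P x *\<^sub>R D x)))\<^sup>2) * indicator \<Omega> x
       \<le> ennreal (3 * K\<^sup>2) * ennreal (E x) + ennreal (2 * K\<^sup>2) * (\<Sum>i\<in>UNIV. ennreal (F i x))"
      using ennreal_leI[OF pt[of x]] by (cases "x \<in> \<Omega>") auto
  qed
  also have "\<dots> = ennreal (3 * K\<^sup>2) * (\<integral>\<^sup>+x. ennreal (E x) \<partial>lborel) + ennreal (2 * K\<^sup>2) * (\<Sum>i\<in>UNIV. \<integral>\<^sup>+x. ennreal (F i x) \<partial>lborel)"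
    by (simp add: nn_integral_add nn_integral_cmult nn_integral_sum)
  also have "\<dots> \<le> ennreal (3 * K\<^sup>2) * ennreal \<eta> + ennreal (2 * K\<^sup>2) * (\<Sum>i\<in>(UNIV::'n set). ennreal \<eta>)"
    using mu mD unfolding E_def F_def by (intro add_mono mult_left_mono sum_mono) auto
  also have "\<dots> = ennreal (3 * K\<^sup>2 * \<eta> + 2 * K\<^sup>2 * (N * \<eta>))"
    using \<eta> by (simp add: ennreal_mult[symmetric] ennreal_plus[symmetric] sum_ennreal N_def del: ennreal_plus sum_constant) (simp add: ennreal_mult)
  also have "\<dots> \<le> ennreal e"
  proof (rule ennreal_leI)
    have "C * \<eta> = e" using C by (simp add: \<eta>_def)
    then show "3 * K\<^sup>2 * \<eta> + 2 * K\<^sup>2 * (N * \<eta>) \<le> e" using \<eta> by (simp add: C_def algebra_simps)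
  qed
  finally show "\<exists>w G'. smooth_fun w \<and> has_grad w G' \<and>
     (\<integral>\<^sup>+x\<in>\<Omega>. ennreal ((w x - P x * u x)\<^sup>2 + (norm (G' x - (u x *\<^sub>R G x + P x *\<^sub>R D x)))\<^sup>2) \<partial>lborel) \<le> ennreal e"
    using sm gm P by (intro exI[of _ "\<lambda>x. P x * mol k u x"] exI[of _ "\<lambda>x. mol k u x *\<^sub>R G x + P x *\<^sub>R M x"])
      (auto intro: smooth_fun_mult has_grad_mult)
qed

lemma H1_approximable_cong:
  assumes "\<And>x. x \<in> \<Omega> \<Longrightarrow> f x = f' x" "\<And>x. x \<in> \<Omega> \<Longrightarrow> F x = F' x" "H1_approximable \<Omega> f F"
  shows "H1_approximable \<Omega> f' F'"
proof -
  have "(\<integral>\<^sup>+x\<in>\<Omega>. ennreal ((w x - f x)\<^sup>2 + (norm (G x - F x))\<^sup>2) \<partial>lborel)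
      = (\<integral>\<^sup>+x\<in>\<Omega>. ennreal ((w x - f' x)\<^sup>2 + (norm (G x - F' x))\<^sup>2) \<partial>lborel)" for w G
    using assms(1,2) by (intro nn_integral_cong) (simp add: indicator_def)
  then show ?thesis using assms(3) unfolding H1_approximable_def by simp
qed

lemma has_grad_zero_locally_constant:
  assumes "has_grad P G" "open \<Omega>" "x \<in> \<Omega>" "\<And>y. y \<in> \<Omega> \<Longrightarrow> P y = c"
  shows "G x = 0"
proof -
  have "(P has_derivative (\<lambda>h. G x \<bullet> h)) (at x)" using assms(1) by (auto simp: has_grad_def)
  then have "((\<lambda>y. c) has_derivative (\<lambda>h. G x \<bullet> h)) (at x)"
    by (rule has_derivative_transform_within_open[OF _ assms(2,3)]) (simp add: assms(4))
  then have "(\<lambda>h. G x \<bullet> h) = (\<lambda>h. 0)"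
    using has_derivative_const has_derivative_unique by blast
  then show ?thesis by (metis inner_eq_zero_iff)
qed

text \<open>The partition of unity is implicit: for cutoffs \<open>k\<^sub>a\<close> equal to 1 on the covering balls,
  \<open>P = 1 - \<Prod>\<^sub>a (1 - k\<^sub>a)\<close> equals 1 on \<open>\<Omega>\<close> and is built by \<open>P + (1 - P) k\<^sub>a\<close>.\<close>

lemma H1_approximable_lipschitz_domain:
  fixes \<Omega> :: "(real^'n) set" and u :: "real^'n \<Rightarrow> real" and D :: "real^'n \<Rightarrow> real^'n"
  assumes \<Omega>: "lipschitz_domain \<Omega>" "bounded \<Omega>"
    and [measurable]: "u \<in> borel_measurable borel" "D \<in> borel_measurable borel"
    and u0: "\<And>x. x \<notin> \<Omega> \<Longrightarrow> u x = 0" and D0: "\<And>x. x \<notin> \<Omega> \<Longrightarrow> D x = 0"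
    and u2: "(\<integral>\<^sup>+x. ennreal ((u x)\<^sup>2) \<partial>lborel) < \<infinity>"
    and D2: "\<And>i. (\<integral>\<^sup>+x. ennreal ((D x $ i)\<^sup>2) \<partial>lborel) < \<infinity>"
    and weak: "\<And>\<phi> g i. smooth_fun \<phi> \<Longrightarrow> has_grad \<phi> g \<Longrightarrow> compact (closure {x. \<phi> x \<noteq> 0}) \<Longrightarrow>
        closure {x. \<phi> x \<noteq> 0} \<subseteq> \<Omega> \<Longrightarrow>
        (\<integral>x. u x * (g x $ i) \<partial>lborel) = - (\<integral>x. (D x $ i) * \<phi> x \<partial>lborel)"
  shows "H1_approximable \<Omega> u D"
proof -
  have op: "open \<Omega>" using \<Omega>(1) by (simp add: lipschitz_domain_def)
  then have [measurable]: "\<Omega> \<in> sets borel" by simp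
  obtain I \<rho> c \<delta> where I: "finite I" "closure \<Omega> \<subseteq> (\<Union>a\<in>I. ball a (\<rho> a / 2))"
    "\<And>a. a \<in> I \<Longrightarrow> inner_cone \<Omega> a (\<rho> a) (c a) (\<delta> a)"
    using lipschitz_domain_finite_cones[OF \<Omega>] by blast
  have "\<exists>P G. smooth_fun P \<and> has_grad P G \<and> (\<forall>x\<in>(\<Union>a\<in>J. ball a (\<rho> a / 2)). P x = 1) \<and>
     H1_approximable \<Omega> (\<lambda>x. P x * u x) (\<lambda>x. u x *\<^sub>R G x + P x *\<^sub>R D x)" if "J \<subseteq> I" for J
    using finite_subset[OF that I(1)] that
  proof (induction J rule: finite_induct)
    case empty
    have "H1_approximable \<Omega> (\<lambda>x. 0 * u x) (\<lambda>x. u x *\<^sub>R 0 + 0 *\<^sub>R D x)"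
      unfolding H1_approximable_def
      by (auto intro!: exI[of _ "\<lambda>x. 0"] smooth_fun_const has_grad_const)
    then show ?case
      by (intro exI[of _ "\<lambda>x. 0"]) (auto intro: smooth_fun_const has_grad_const)
  next
    case (insert a J)
    then have "J \<subseteq> I" by simp
    from insert.IH[OF this] obtain P G where P: "smooth_fun P" "has_grad P G" "\<forall>x\<in>(\<Union>a\<in>J. ball a (\<rho> a / 2)). P x = 1"
      and PA: "H1_approximable \<Omega> (\<lambda>x. P x * u x) (\<lambda>x. u x *\<^sub>R G x + P x *\<^sub>R D x)"
      by (elim exE conjE)
    have cone: "inner_cone \<Omega> a (\<rho> a) (c a) (\<delta> a)" using insert.prems I(3) by auto
    then have \<rho>: "\<rho> a > 0" by (simp add: inner_cone_def)
    obtain k where k: "smooth_fun k" "\<And>x. x \<in> ball a (\<rho> a / 2) \<Longrightarrow> k x = 1" "\<And>x. x \<notin> ball a (\<rho> a) \<Longrightarrow> k x = 0"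
      using smooth_cutoff[of "\<rho> a / 2" "\<rho> a" a] \<rho> by auto
    obtain H where H: "has_grad k H" using smooth_funE[OF k(1)] by blast
    have [measurable]: "P \<in> borel_measurable borel" "G \<in> borel_measurable borel" "k \<in> borel_measurable borel" "H \<in> borel_measurable borel"
      using P(1,2) k(1) H smooth_fun_continuous_on smooth_fun_grad_continuous_on
      by (blast intro: borel_measurable_continuous_onI)+
    have Q: "smooth_fun (\<lambda>x. 1 - P x)" "has_grad (\<lambda>x. 1 - P x) (\<lambda>x. - G x)"
    proof -
      show "smooth_fun (\<lambda>x. 1 - P x)" by (intro smooth_fun_diff smooth_fun_const P)
      show "has_grad (\<lambda>x. 1 - P x) (\<lambda>x. - G x)"
        using has_grad_add[OF has_grad_const[of 1] has_grad_mult[OF has_grad_const[of "-1"] P(2)]] by simp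
    qed
    have "H1_approximable \<Omega> (\<lambda>x. k x * u x) (\<lambda>x. u x *\<^sub>R H x + k x *\<^sub>R D x)"
      by (rule H1_approximable_local[OF op \<Omega>(2) cone _ _ u0 D0 u2 D2 weak k(1) H k(3)]) auto
    from H1_approximable_smooth_mult[OF _ _ _ this Q \<Omega>(2)]
    have "H1_approximable \<Omega> (\<lambda>x. (1 - P x) * (k x * u x))
        (\<lambda>x. (k x * u x) *\<^sub>R (- G x) + (1 - P x) *\<^sub>R (u x *\<^sub>R H x + k x *\<^sub>R D x))"
      by measurable
    from H1_approximable_add[OF _ _ _ _ _ PA this]
    have "H1_approximable \<Omega> (\<lambda>x. P x * u x + (1 - P x) * (k x * u x))
       (\<lambda>x. u x *\<^sub>R G x + P x *\<^sub>R D x + ((k x * u x) *\<^sub>R (- G x) + (1 - P x) *\<^sub>R (u x *\<^sub>R H x + k x *\<^sub>R D x)))"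
      by measurable
    then have "H1_approximable \<Omega> (\<lambda>x. (P x + (1 - P x) * k x) * u x)
       (\<lambda>x. u x *\<^sub>R (G x + (k x *\<^sub>R (- G x) + (1 - P x) *\<^sub>R H x)) + (P x + (1 - P x) * k x) *\<^sub>R D x)"
      by (rule H1_approximable_cong[rotated 2]) (simp_all add: algebra_simps)
    moreover have "smooth_fun (\<lambda>x. P x + (1 - P x) * k x)"
      by (intro smooth_fun_add smooth_fun_mult Q k P)
    moreover have "has_grad (\<lambda>x. P x + (1 - P x) * k x) (\<lambda>x. G x + (k x *\<^sub>R (- G x) + (1 - P x) *\<^sub>R H x))"
      by (intro has_grad_add has_grad_mult Q H P)
    moreover have "P x + (1 - P x) * k x = 1" if "x \<in> (\<Union>a\<in>insert a J. ball a (\<rho> a / 2))" for x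
    proof (cases "x \<in> ball a (\<rho> a / 2)")
      case True
      then show ?thesis using k(2) by simp
    next
      case False
      then have "P x = 1" using that by (intro bspec[OF P(3)]) simp
      then show ?thesis by simp
    qed
    ultimately show ?case by (intro exI conjI) auto
  qed
  from this[OF order_refl] obtain P G where P: "smooth_fun P" "has_grad P G"
    "\<forall>x\<in>(\<Union>a\<in>I. ball a (\<rho> a / 2)). P x = 1"
    "H1_approximable \<Omega> (\<lambda>x. P x * u x) (\<lambda>x. u x *\<^sub>R G x + P x *\<^sub>R D x)" by (elim exE conjE)
  have P1: "P x = 1" if "x \<in> \<Omega>" for x
    using that I(2) closure_subset by (intro bspec[OF P(3)]) blast
  have G0: "G x = 0" if "x \<in> \<Omega>" for x
    by (rule has_grad_zero_locally_constant[OF P(2) op that P1])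
  show ?thesis
    by (rule H1_approximable_cong[OF _ _ P(4)]) (simp_all add: P1 G0)
qed

text \<open>Approximants with squared errors 2^(-n) have an integrable sum of pointwise squared
  errors. Where that sum is finite, its terms tend to 0, which gives convergence almost everywhere,
  and they are bounded by it, which gives the majorant.\<close>

lemma H1_approximable_dominated_sequence:
  fixes u :: "real^'n \<Rightarrow> real" and D :: "real^'n \<Rightarrow> real^'n"
  assumes [measurable]: "\<Omega> \<in> sets borel" "u \<in> borel_measurable borel" "D \<in> borel_measurable borel"
    and app: "H1_approximable \<Omega> u D"
    and u2: "(\<integral>\<^sup>+x. ennreal ((u x)\<^sup>2) \<partial>lborel) < \<infinity>"
    and D2: "\<And>i. (\<integral>\<^sup>+x. ennreal ((D x $ i)\<^sup>2) \<partial>lborel) < \<infinity>"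
  obtains w G W where "\<And>n::nat. smooth_fun (w n)" "\<And>n. has_grad (w n) (G n)"
    "W \<in> borel_measurable borel" "\<And>x. W x \<ge> 0" "integrable lborel W"
    "AE x in lborel. x \<in> \<Omega> \<longrightarrow> (\<lambda>n. w n x) \<longlonglongrightarrow> u x \<and> (\<lambda>n. G n x) \<longlonglongrightarrow> D x
       \<and> (\<forall>n. (w n x)\<^sup>2 + (norm (G n x))\<^sup>2 \<le> W x)"
proof -
  define Q where "Q n w G \<longleftrightarrow> smooth_fun w \<and> has_grad w G \<and>
     (\<integral>\<^sup>+x\<in>\<Omega>. ennreal ((w x - u x)\<^sup>2 + (norm (G x - D x))\<^sup>2) \<partial>lborel) \<le> ennreal ((1 / 2) ^ n)" for n :: nat and w G
  have "\<exists>w G. Q n w G" for n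
    using app unfolding H1_approximable_def Q_def by simp
  then obtain w G where "\<And>n. Q n (w n) (G n)" by metis
  then have w: "\<And>n. smooth_fun (w n)" "\<And>n. has_grad (w n) (G n)"
    "\<And>n. (\<integral>\<^sup>+x\<in>\<Omega>. ennreal ((w n x - u x)\<^sup>2 + (norm (G n x - D x))\<^sup>2) \<partial>lborel) \<le> ennreal ((1 / 2) ^ n)"
    unfolding Q_def by blast+
  have [measurable]: "w n \<in> borel_measurable borel" "G n \<in> borel_measurable borel" for n
    using w(1,2)[of n] smooth_fun_continuous_on smooth_fun_grad_continuous_on
    by (blast intro: borel_measurable_continuous_onI)+
  define E where "E n x = ((w n x - u x)\<^sup>2 + (norm (G n x - D x))\<^sup>2) * indicator \<Omega> x" for n x
  have [measurable]: "E n \<in> borel_measurable borel" for n unfolding E_def by measurable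
  have E0: "E n x \<ge> 0" for n x by (simp add: E_def)
  have E_int: "(\<integral>\<^sup>+x. ennreal (E n x) \<partial>lborel) \<le> ennreal ((1 / 2) ^ n)" for n
  proof -
    have "(\<integral>\<^sup>+x. ennreal (E n x) \<partial>lborel) = (\<integral>\<^sup>+x\<in>\<Omega>. ennreal ((w n x - u x)\<^sup>2 + (norm (G n x - D x))\<^sup>2) \<partial>lborel)"
      unfolding E_def by (intro nn_integral_cong) (simp add: indicator_def)
    then show ?thesis using w(3) by simp
  qed
  have "(\<integral>\<^sup>+x. (\<Sum>n. ennreal (E n x)) \<partial>lborel) = (\<Sum>n. \<integral>\<^sup>+x. ennreal (E n x) \<partial>lborel)"
    by (rule nn_integral_suminf) simp
  also have "\<dots> \<le> (\<Sum>n. ennreal ((1 / 2) ^ n))" by (intro suminf_le E_int) auto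
  also have "\<dots> = ennreal (\<Sum>n. (1 / 2) ^ n)" by (intro suminf_ennreal2 summable_geometric) auto
  finally have sfin: "(\<integral>\<^sup>+x. (\<Sum>n. ennreal (E n x)) \<partial>lborel) < \<infinity>"
    by (simp add: less_top top_unique[symmetric] order_le_less_trans)
  then have ae: "AE x in lborel. (\<Sum>n. ennreal (E n x)) \<noteq> \<infinity>"
    by (intro nn_integral_noteq_infinite) auto
  define S where "S x = enn2real (\<Sum>n. ennreal (E n x))" for x
  \<comment> \<open>By (a + b)^2 \<le> 2 a^2 + 2 b^2, applied to the error and the limit, where
    \<open>S\<close> bounds the squared error of every approximant.\<close>
  define W where "W x = 2 * ((u x)\<^sup>2 + (\<Sum>i\<in>UNIV. (D x $ i)\<^sup>2)) + 2 * S x" for x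
  have [measurable]: "S \<in> borel_measurable borel" unfolding S_def by measurable
  have [measurable]: "(\<lambda>x. D x $ i) \<in> borel_measurable borel" for i
    by (rule borel_measurable_vec_component) simp
  have iS: "integrable lborel S"
  proof (rule integrableI_nonneg)
    have "(\<integral>\<^sup>+x. ennreal (S x) \<partial>lborel) \<le> (\<integral>\<^sup>+x. (\<Sum>n. ennreal (E n x)) \<partial>lborel)"
      unfolding S_def by (intro nn_integral_mono) (simp add: ennreal_enn2real_if)
    then show "(\<integral>\<^sup>+x. ennreal (S x) \<partial>lborel) < \<infinity>" using sfin by (rule order_le_less_trans)
  qed (auto simp: S_def)
  have iu: "integrable lborel (\<lambda>x. (u x)\<^sup>2)" using u2 by (intro integrableI_nonneg) auto
  have iD: "integrable lborel (\<lambda>x. (D x $ i)\<^sup>2)" for i using D2[of i] by (intro integrableI_nonneg) auto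
  have iW: "integrable lborel W"
    unfolding W_def using iS iu iD by (intro Bochner_Integration.integrable_add integrable_mult_right Bochner_Integration.integrable_sum)
  have W0: "W x \<ge> 0" for x by (simp add: W_def S_def sum_nonneg)
  show ?thesis
  proof (rule that[OF w(1,2) _ W0 iW])
    show "W \<in> borel_measurable borel" using iW by auto
    show "AE x in lborel. x \<in> \<Omega> \<longrightarrow> (\<lambda>n. w n x) \<longlonglongrightarrow> u x \<and> (\<lambda>n. G n x) \<longlonglongrightarrow> D x
       \<and> (\<forall>n. (w n x)\<^sup>2 + (norm (G n x))\<^sup>2 \<le> W x)"
      using ae
    proof (eventually_elim, intro impI)
      fix x assume fin: "(\<Sum>n. ennreal (E n x)) \<noteq> \<infinity>" and x: "x \<in> \<Omega>"
      have Ex: "E n x = (w n x - u x)\<^sup>2 + (norm (G n x - D x))\<^sup>2" for n using x by (simp add: E_def)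
      have sm: "summable (\<lambda>n. E n x)"
        using fin E0 by (intro summable_suminf_not_top) auto
      have Sx: "S x = (\<Sum>n. E n x)"
        unfolding S_def using suminf_ennreal2[OF E0 sm] suminf_nonneg[OF sm E0] by simp
      have ES: "E n x \<le> S x" for n
        unfolding Sx using sum_le_suminf[OF sm, of "{n}"] E0 by simp
      have E_lim: "(\<lambda>n. E n x) \<longlonglongrightarrow> 0" by (rule summable_LIMSEQ_zero[OF sm])
      have "(\<lambda>n. (w n x - u x)\<^sup>2) \<longlonglongrightarrow> 0"
        by (rule tendsto_sandwich[OF _ _ tendsto_const E_lim]) (auto simp: Ex)
      then have "(\<lambda>n. \<bar>w n x - u x\<bar>) \<longlonglongrightarrow> 0" using tendsto_real_sqrt by fastforce
      then have 1: "(\<lambda>n. w n x) \<longlonglongrightarrow> u x" by (simp add: LIM_zero_iff tendsto_rabs_zero_iff)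
      have "(\<lambda>n. (norm (G n x - D x))\<^sup>2) \<longlonglongrightarrow> 0"
        by (rule tendsto_sandwich[OF _ _ tendsto_const E_lim]) (auto simp: Ex)
      then have "(\<lambda>n. norm (G n x - D x)) \<longlonglongrightarrow> 0" using tendsto_real_sqrt by fastforce
      then have 2: "(\<lambda>n. G n x) \<longlonglongrightarrow> D x" by (simp add: LIM_zero_iff tendsto_norm_zero_iff)
      have "(w n x)\<^sup>2 + (norm (G n x))\<^sup>2 \<le> W x" for n
      proof -
        have a: "(w n x)\<^sup>2 \<le> 2 * (w n x - u x)\<^sup>2 + 2 * (u x)\<^sup>2"
          using power2_add_le[of "w n x - u x" "u x"] by simp
        have "(norm (G n x))\<^sup>2 \<le> (norm (G n x - D x) + norm (D x))\<^sup>2"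
          using norm_triangle_ineq[of "G n x - D x" "D x"] by (intro power_mono) auto
        then have b: "(norm (G n x))\<^sup>2 \<le> 2 * (norm (G n x - D x))\<^sup>2 + 2 * (norm (D x))\<^sup>2"
          using power2_add_le[of "norm (G n x - D x)" "norm (D x)"] by (rule order_trans)
        have c: "(w n x - u x)\<^sup>2 + (norm (G n x - D x))\<^sup>2 \<le> S x" using ES[of n] by (simp add: Ex)
        have "A + B \<le> 2 * (a + b) + 2 * s" if "A \<le> 2 * p + 2 * a" "B \<le> 2 * q + 2 * b" "p + q \<le> s"
          for A B a b p q s :: real using that by argo
        from this[OF a b c] show ?thesis unfolding W_def norm_squared_vec[of "D x"] .
      qed
      with 1 2 show "(\<lambda>n. w n x) \<longlonglongrightarrow> u x \<and> (\<lambda>n. G n x) \<longlonglongrightarrow> D x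
         \<and> (\<forall>n. (w n x)\<^sup>2 + (norm (G n x))\<^sup>2 \<le> W x)" by blast
    qed
  qed
qed

section \<open>Sobolev inequality\<close>

text \<open>The convex power lies above its tangent at A. This is Young's inequality for x and
  A^(q-1) with conjugate exponents q and q/(q-1).\<close>

lemma powr_tangent_le:
  fixes x A q :: real
  assumes "q > 1" "x \<ge> 0" "A \<ge> 0"
  shows "A powr q + q * A powr (q - 1) * (x - A) \<le> x powr q"
proof (cases "A = 0")
  case False
  define r where "r = q / (q - 1)"
  have r: "r > 1" "1 / q + 1 / r = 1" using assms by (auto simp: r_def field_simps)
  have "x * A powr (q - 1) \<le> x powr q / q + (A powr (q - 1)) powr r / r"
    using assms r by (intro Youngs_inequality) auto
  also have "(A powr (q - 1)) powr r = A powr q" using assms by (simp add: powr_powr r_def)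
  finally have "x * A powr (q - 1) \<le> x powr q / q + A powr q / r" .
  then have "q * (x * A powr (q - 1)) \<le> q * (x powr q / q + A powr q / r)"
    using assms by (intro mult_left_mono) auto
  also have "\<dots> = x powr q + (q - 1) * A powr q" using assms by (simp add: r_def field_simps)
  finally have "q * (x * A powr (q - 1)) \<le> x powr q + (q - 1) * A powr q" .
  moreover have "A powr (q - 1) * A = A powr q"
    using assms False by (simp add: powr_mult_base[symmetric] powr_diff)
  ultimately show ?thesis by (simp add: algebra_simps)
qed (use assms in auto)

text \<open>Jensen's inequality: the tangent inequality at the mean value A is integrated against k,
  and the linear term drops out. Boundedness of f supplies the integrability.\<close>

lemma powr_weighted_integral_le:
  fixes f k :: "'a \<Rightarrow> real"
  assumes [measurable]: "f \<in> borel_measurable M" and f: "\<And>x. 0 \<le> f x" "\<And>x. f x \<le> K"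
    and k: "integrable M k" "\<And>x. k x \<ge> 0" "(\<integral>x. k x \<partial>M) = 1" and q: "q > 1"
  shows "ennreal ((\<integral>x. f x * k x \<partial>M) powr q) \<le> (\<integral>\<^sup>+x. ennreal (f x powr q * k x) \<partial>M)"
proof -
  have [measurable]: "k \<in> borel_measurable M" using k(1) by simp
  define A where "A = (\<integral>x. f x * k x \<partial>M)"
  have A: "A \<ge> 0" unfolding A_def using f k by (intro Bochner_Integration.integral_nonneg) simp
  have i1: "integrable M (\<lambda>x. f x * k x)"
  proof (rule Bochner_Integration.integrable_bound[of _ "\<lambda>x. K * k x"])
    show "AE x in M. norm (f x * k x) \<le> norm (K * k x)"
    proof (rule AE_I2)
      fix x
      show "norm (f x * k x) \<le> norm (K * k x)"
        using f[of x] k(2)[of x] by (auto simp: abs_mult intro!: mult_right_mono)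
    qed
  qed (use k in auto)
  have i2: "integrable M (\<lambda>x. f x powr q * k x)"
  proof (rule Bochner_Integration.integrable_bound[of _ "\<lambda>x. K powr q * k x"])
    show "AE x in M. norm (f x powr q * k x) \<le> norm (K powr q * k x)"
    proof (rule AE_I2)
      fix x
      show "norm (f x powr q * k x) \<le> norm (K powr q * k x)"
        using f[of x] k(2)[of x] q by (auto simp: abs_mult intro!: mult_right_mono powr_mono2)
    qed
  qed (use k in auto)
  have "A powr q = (\<integral>x. (A powr q - q * A powr (q - 1) * A) * k x + q * A powr (q - 1) * (f x * k x) \<partial>M)"
    using i1 k by (simp add: A_def[symmetric])
  also have "\<dots> \<le> (\<integral>x. f x powr q * k x \<partial>M)"
  proof (rule integral_mono)
    fix x
    have "(A powr q + q * A powr (q - 1) * (f x - A)) * k x \<le> f x powr q * k x"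
      using powr_tangent_le[OF q f(1) A] k(2) by (intro mult_right_mono)
    then show "(A powr q - q * A powr (q - 1) * A) * k x + q * A powr (q - 1) * (f x * k x) \<le> f x powr q * k x"
      by (simp add: algebra_simps)
  qed (use i1 i2 k in auto)
  finally have "ennreal (A powr q) \<le> ennreal (\<integral>x. f x powr q * k x \<partial>M)" by (rule ennreal_leI)
  also have "\<dots> = (\<integral>\<^sup>+x. ennreal (f x powr q * k x) \<partial>M)"
    using i2 k(2) by (intro nn_integral_eq_integral[symmetric]) auto
  finally show ?thesis by (simp add: A_def)
qed

text \<open>The averages \<open>\<integral> F (x + t z) k z dz\<close> lie in \<open>L\<^sup>2\<close> uniformly in \<open>t\<close> and in \<open>L\<^sup>\<infinity>\<close> with norm of
  order \<open>t\<close> to the power \<open>- N / 2\<close>; interpolation gives the \<open>L\<^sup>q\<close> bound.\<close>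

lemma dilated_average_L2_Lq:
  fixes F k :: "'a::euclidean_space \<Rightarrow> real"
  assumes [measurable]: "F \<in> borel_measurable borel"
    and k: "integrable lborel k" "\<And>x. k x \<ge> 0" "(\<integral>x. k x \<partial>lborel) = 1" and kb: "\<And>x. k x \<le> b"
    and S: "(\<integral>\<^sup>+x. ennreal ((F x)\<^sup>2) \<partial>lborel) = ennreal S" "S \<ge> 0" and t: "t > 0" and q: "q > 2"
    and F: "\<And>x. F x \<ge> 0"
  shows "(\<integral>\<^sup>+x. ennreal ((\<integral>z. F (x + t *\<^sub>R z) * k z \<partial>lborel) powr q) \<partial>lborel)
     \<le> ennreal ((b * S / t ^ DIM('a)) powr ((q - 2) / 2) * S)"
proof -
  define H where "H x = (\<integral>z. F (x + t *\<^sub>R z) * k z \<partial>lborel)" for x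
  have [measurable]: "k \<in> borel_measurable borel" using k(1) by auto
  have H0: "H x \<ge> 0" for x unfolding H_def using F k by (intro Bochner_Integration.integral_nonneg) simp
  have H_le: "ennreal ((H x)\<^sup>2) \<le> (\<integral>\<^sup>+z. ennreal ((F (x + t *\<^sub>R z))\<^sup>2 * k z) \<partial>lborel)" for x
    unfolding H_def by (rule square_weighted_integral_le[OF _ k]) simp
  have b: "b \<ge> 0" using kb[of 0] k(2)[of 0] by linarith
  \<comment> \<open>Here k is estimated by b, and the substitution of x + t z for z costs the factor
    t^(-N), where N is the dimension.\<close>
  have Hmax: "(H x)\<^sup>2 \<le> b * S / t ^ DIM('a)" for x
  proof -
    have "ennreal (t ^ DIM('a)) * (\<integral>\<^sup>+z. ennreal ((F (x + t *\<^sub>R z))\<^sup>2) \<partial>lborel) = ennreal S"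
      using nn_integral_lborel_affine[of "\<lambda>x. ennreal ((F x)\<^sup>2)" t x] t S by simp
    then have eq: "(\<integral>\<^sup>+z. ennreal ((F (x + t *\<^sub>R z))\<^sup>2) \<partial>lborel) = ennreal (S / t ^ DIM('a))"
    proof -
      define X where "X = (\<integral>\<^sup>+z. ennreal ((F (x + t *\<^sub>R z))\<^sup>2) \<partial>lborel)"
      have X: "ennreal (t ^ DIM('a)) * X = ennreal S" unfolding X_def by fact
      have "X = ennreal (1 / t ^ DIM('a)) * (ennreal (t ^ DIM('a)) * X)"
        using t by (simp add: mult.assoc[symmetric] ennreal_mult[symmetric])
      also have "\<dots> = ennreal (S / t ^ DIM('a))"
        unfolding X using t S by (simp add: ennreal_mult[symmetric])
      finally show ?thesis by (simp add: X_def)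
    qed
    have "ennreal ((H x)\<^sup>2) \<le> (\<integral>\<^sup>+z. ennreal b * ennreal ((F (x + t *\<^sub>R z))\<^sup>2) \<partial>lborel)"
    proof (rule order_trans[OF H_le nn_integral_mono])
      fix z
      show "ennreal ((F (x + t *\<^sub>R z))\<^sup>2 * k z) \<le> ennreal b * ennreal ((F (x + t *\<^sub>R z))\<^sup>2)"
        using kb[of z] b k(2)[of z] by (subst ennreal_mult[symmetric])
          (auto simp: mult.commute[of b] intro!: ennreal_leI mult_left_mono)
    qed
    also have "\<dots> = ennreal b * ennreal (S / t ^ DIM('a))" by (simp add: nn_integral_cmult eq)
    also have "\<dots> = ennreal (b * S / t ^ DIM('a))" using b S t by (simp add: ennreal_mult[symmetric])
    finally show ?thesis using b S t by (subst (asm) ennreal_le_iff) auto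
  qed
  have [measurable]: "H \<in> borel_measurable borel" unfolding H_def by measurable
  have HL2: "(\<integral>\<^sup>+x. ennreal ((H x)\<^sup>2) \<partial>lborel) \<le> ennreal S"
  proof -
    have "(\<integral>\<^sup>+x. ennreal ((H x)\<^sup>2) \<partial>lborel) \<le> (\<integral>\<^sup>+x. (\<integral>\<^sup>+z. ennreal ((F (x + t *\<^sub>R z))\<^sup>2 * k z) \<partial>lborel) \<partial>lborel)"
      by (intro nn_integral_mono H_le)
    also have "\<dots> = (\<integral>\<^sup>+z. (\<integral>\<^sup>+x. ennreal ((F (x + t *\<^sub>R z))\<^sup>2 * k z) \<partial>lborel) \<partial>lborel)"
      by (rule lborel_pair.Fubini') simp
    also have "\<dots> = (\<integral>\<^sup>+z. ennreal S * ennreal (k z) \<partial>lborel)"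
    proof (rule nn_integral_cong)
      fix z
      have "(\<integral>\<^sup>+x. ennreal ((F (x + t *\<^sub>R z))\<^sup>2 * k z) \<partial>lborel) = (\<integral>\<^sup>+x. ennreal ((F (x + t *\<^sub>R z))\<^sup>2) \<partial>lborel) * ennreal (k z)"
        using k(2) by (simp add: ennreal_mult nn_integral_multc)
      also have "(\<integral>\<^sup>+x. ennreal ((F (x + t *\<^sub>R z))\<^sup>2) \<partial>lborel) = ennreal S"
        using nn_integral_lborel_translate[of "\<lambda>x. ennreal ((F x)\<^sup>2)" "t *\<^sub>R z"] S by simp
      finally show "(\<integral>\<^sup>+x. ennreal ((F (x + t *\<^sub>R z))\<^sup>2 * k z) \<partial>lborel) = ennreal S * ennreal (k z)" .
    qed
    also have "\<dots> = ennreal S" using k by (simp add: nn_integral_cmult nn_integral_eq_integral)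
    finally show ?thesis .
  qed
  have "(\<integral>\<^sup>+x. ennreal (H x powr q) \<partial>lborel)
     \<le> (\<integral>\<^sup>+x. ennreal ((b * S / t ^ DIM('a)) powr ((q - 2) / 2)) * ennreal ((H x)\<^sup>2) \<partial>lborel)"
  proof (rule nn_integral_mono)
    fix x
    \<comment> \<open>This is the interpolation: all but two of the q powers are estimated by the
      supremum bound, the remaining square is integrated.\<close>
    have "H x powr q = ((H x)\<^sup>2) powr ((q - 2) / 2) * (H x)\<^sup>2"
    proof (cases "H x = 0")
      case False
      then have "H x > 0" using H0[of x] by simp
      then have sq: "(H x)\<^sup>2 = H x powr 2" by simp
      have "2 * ((q - 2) / 2) = q - 2" by simp
      then have "(H x powr 2) powr ((q - 2) / 2) = H x powr (q - 2)"
        by (simp only: powr_powr)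
      then show ?thesis unfolding sq by (simp add: powr_add[symmetric])
    qed (use q in simp)
    also have "\<dots> \<le> (b * S / t ^ DIM('a)) powr ((q - 2) / 2) * (H x)\<^sup>2"
      using Hmax q by (intro mult_right_mono powr_mono2) auto
    finally show "ennreal (H x powr q) \<le> ennreal ((b * S / t ^ DIM('a)) powr ((q - 2) / 2)) * ennreal ((H x)\<^sup>2)"
      by (subst ennreal_mult[symmetric]) (auto intro: ennreal_leI)
  qed
  also have "\<dots> = ennreal ((b * S / t ^ DIM('a)) powr ((q - 2) / 2)) * (\<integral>\<^sup>+x. ennreal ((H x)\<^sup>2) \<partial>lborel)"
    by (simp add: nn_integral_cmult)
  also have "\<dots> \<le> ennreal ((b * S / t ^ DIM('a)) powr ((q - 2) / 2)) * ennreal S"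
    by (intro mult_left_mono HL2) auto
  also have "\<dots> = ennreal ((b * S / t ^ DIM('a)) powr ((q - 2) / 2) * S)"
    using S by (simp add: ennreal_mult)
  finally show ?thesis unfolding H_def .
qed

text \<open>The curve s -> x + s^m z starts at x because m \<ge> 1, and its velocity m s^(m-1) z
  supplies the weight that is needed later.\<close>

lemma has_grad_segment_FTC:
  fixes v :: "real^'n \<Rightarrow> real"
  assumes v: "has_grad v G" "continuous_on UNIV G" and m: "m \<ge> 1"
  shows "v (x + z) - v x = (\<integral>s. (G (x + s ^ m *\<^sub>R z) \<bullet> z) * (real m * s ^ (m - 1)) * indicator {0..1} s \<partial>lborel)"
proof -
  have "(\<integral>s. (G (x + s ^ m *\<^sub>R z) \<bullet> z) * (real m * s ^ (m - 1)) * indicator {0..1} s \<partial>lborel)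
     = v (x + 1 ^ m *\<^sub>R z) - v (x + 0 ^ m *\<^sub>R z)"
  proof (rule integral_FTC_Icc_real)
    fix s :: real
    have "((\<lambda>s. x + s ^ m *\<^sub>R z) has_derivative (\<lambda>h. (h * (real m * s ^ (m - 1))) *\<^sub>R z)) (at s)"
      by (auto intro!: derivative_eq_intros simp: mult_ac)
    moreover have "(v has_derivative (\<lambda>h. G (x + s ^ m *\<^sub>R z) \<bullet> h)) (at (x + s ^ m *\<^sub>R z))"
      using v(1) by (simp add: has_grad_def)
    ultimately have "((\<lambda>s. v (x + s ^ m *\<^sub>R z)) has_derivative (\<lambda>h. G (x + s ^ m *\<^sub>R z) \<bullet> ((h * (real m * s ^ (m - 1))) *\<^sub>R z))) (at s)"
      by (rule has_derivative_compose)
    then show "DERIV (\<lambda>s. v (x + s ^ m *\<^sub>R z)) s :> (G (x + s ^ m *\<^sub>R z) \<bullet> z) * (real m * s ^ (m - 1))"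
      by (rule has_derivative_imp_has_field_derivative) (simp add: mult_ac)
    have "continuous_on UNIV (\<lambda>s. (G (x + s ^ m *\<^sub>R z) \<bullet> z) * (real m * s ^ (m - 1)))"
      by (intro continuous_intros continuous_on_compose2[OF v(2)]) auto
    then show "isCont (\<lambda>s. (G (x + s ^ m *\<^sub>R z) \<bullet> z) * (real m * s ^ (m - 1))) s"
      by (simp add: continuous_on_eq_continuous_at)
  qed simp
  then show ?thesis using m by (simp add: power_0_left)
qed

lemma powr_add_le:
  fixes a b q :: real
  assumes "a \<ge> 0" "b \<ge> 0" "q > 0"
  shows "(a + b) powr q \<le> 2 powr q * (a powr q + b powr q)"
proof -
  have "(a + b) powr q \<le> (2 * max a b) powr q" using assms by (intro powr_mono2) auto
  also have "\<dots> = 2 powr q * (max a b) powr q" using assms by (simp add: powr_mult)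
  also have "(max a b) powr q \<le> a powr q + b powr q" by (cases "a \<le> b") (auto simp: max_def)
  finally show ?thesis by simp
qed

text \<open>Integrating along \<open>s \<mapsto> x + s\<^sup>m z\<close> instead of \<open>x + t z\<close> supplies a factor \<open>s\<^bsup>m-1\<^esup>\<close>, which for large
  \<open>m\<close> absorbs the growth of the \<open>L\<^sup>q\<close> norms of the averages as \<open>s \<rightarrow> 0\<close>, so that no singular integral appears.\<close>

lemma sobolev_inequality_cone:
  fixes \<Omega> :: "(real^'n) set"
  assumes \<Omega>: "open \<Omega>" "bounded \<Omega>" and cone: "inner_cone \<Omega> a \<rho> c \<delta>"
    and q: "q > 2" "q * (real CARD('n) - 2) < 2 * real CARD('n)"
  obtains K where "K \<ge> 0" "\<And>v G. smooth_fun v \<Longrightarrow> has_grad v G \<Longrightarrow>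
     (\<integral>\<^sup>+x\<in>\<Omega> \<inter> ball a \<rho>. ennreal (\<bar>v x\<bar> powr q) \<partial>lborel)
       \<le> ennreal (K * (\<integral>x\<in>\<Omega>. (v x)\<^sup>2 + (norm (G x))\<^sup>2 \<partial>lborel) powr (q / 2))"
proof -
  define N where "N = CARD('n)"
  define e where "e = (q - 2) / 2"
  have e: "e > 0" using q by (simp add: e_def)
  have cone': "\<rho> > 0" "\<delta> > 0" "\<And>y z t. y \<in> \<Omega> \<Longrightarrow> y \<in> ball a \<rho> \<Longrightarrow> z \<in> ball c \<delta> \<Longrightarrow> 0 < t \<Longrightarrow> t \<le> 1 \<Longrightarrow> y + t *\<^sub>R z \<in> \<Omega>"
    using cone unfolding inner_cone_def by auto
  define \<beta> where "\<beta> = measure lborel (ball c \<delta>)"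
  have \<beta>: "\<beta> > 0" unfolding \<beta>_def using cone' by (simp add: content_ball_pos)
  define k where "k z = indicator (ball c \<delta>) z / \<beta>" for z
  define b where "b = 1 / \<beta>"
  have b: "b > 0" using \<beta> by (simp add: b_def)
  have [measurable]: "ball c \<delta> \<in> sets borel" by simp
  have [measurable]: "k \<in> borel_measurable borel" unfolding k_def by (intro borel_measurable_divide) auto
  have ib: "integrable lborel (indicator (ball c \<delta>) :: _ \<Rightarrow> real)"
    using emeasure_lborel_ball_finite[of c \<delta>] by (intro integrable_real_indicator) auto
  have k: "integrable lborel k" "\<And>x. k x \<ge> 0" "(\<integral>x. k x \<partial>lborel) = 1" "\<And>x. k x \<le> b"
  proof -
    show "integrable lborel k" unfolding k_def using ib by simp
    show "k x \<ge> 0" "k x \<le> b" for x using \<beta> by (auto simp: k_def b_def indicator_def)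
    have "(\<integral>x. k x \<partial>lborel) = measure lborel (ball c \<delta>) / \<beta>" unfolding k_def by simp
    then show "(\<integral>x. k x \<partial>lborel) = 1" using \<beta> by (simp add: \<beta>_def)
  qed
  define m0 where "m0 = norm c + \<delta>"
  have m0: "m0 > 0" using cone' by (simp add: m0_def add_nonneg_pos)
  \<comment> \<open>Subcriticality enters here: q - N (q - 2)/2 > 0 is the same as q (N - 2) < 2
    N.\<close>
  have gap: "q - N * e > 0" using q by (simp add: N_def e_def field_simps)
  \<comment> \<open>The condition amounts to (m - 1) q \<ge> m N e, so that s^((m-1) q) outweighs
    the factor s^(-m N e) from the averages at scale s^m.\<close>
  obtain m :: nat where m: "m \<ge> 2" "real m * (q - N * e) \<ge> q"
  proof -
    obtain n :: nat where "q / (q - N * e) \<le> real n" using real_arch_simple by blast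
    then have "q \<le> real n * (q - N * e)" using gap by (simp add: field_simps)
    also have "\<dots> \<le> real (max n 2) * (q - N * e)" using gap by (intro mult_right_mono) auto
    finally show ?thesis by (intro that[of "max n 2"]) auto
  qed
  define K where "K = 2 powr q * (1 + (m0 * m) powr q) * b powr e * 2 powr (q / 2)"
  show ?thesis
  proof (rule that[of K])
    show "K \<ge> 0" by (simp add: K_def)
    fix v :: "real^'n \<Rightarrow> real" and G :: "real^'n \<Rightarrow> real^'n"
    assume v: "smooth_fun v" "has_grad v G"
    define E where "E = (\<integral>x\<in>\<Omega>. (v x)\<^sup>2 + (norm (G x))\<^sup>2 \<partial>lborel)"
    have Gc: "continuous_on UNIV G" by (rule smooth_fun_grad_continuous_on[OF v])
    have [measurable]: "v \<in> borel_measurable borel" "G \<in> borel_measurable borel"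
      using smooth_fun_continuous_on[OF v(1)] Gc by (blast intro: borel_measurable_continuous_onI)+
    have [measurable]: "\<Omega> \<in> sets borel" using \<Omega>(1) by simp
    obtain Kv where Kv: "Kv \<ge> 0" "\<And>x. x \<in> \<Omega> \<Longrightarrow> \<bar>v x\<bar> \<le> Kv" "\<And>x. x \<in> \<Omega> \<Longrightarrow> norm (G x) \<le> Kv"
      using smooth_fun_bounded_on[OF v \<Omega>(2)] by blast
    \<comment> \<open>Extension by zero loses nothing, since the curves along the cone that start in
      \<Omega> near a do not leave \<Omega>. It makes the averages meaningful on the whole space,
      where translation invariance applies.\<close>
    define F where "F y = indicator \<Omega> y * (\<bar>v y\<bar> + norm (G y))" for y
    have [measurable]: "F \<in> borel_measurable borel" unfolding F_def by measurable
    define KF where "KF = 2 * Kv"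
    have F: "F y \<ge> 0" "F y \<le> KF" for y
      using Kv(1) Kv(2)[of y] Kv(3)[of y] by (auto simp: F_def KF_def indicator_def)
    have KF: "KF \<ge> 0" using Kv by (simp add: KF_def)
    have i\<Omega>: "integrable lborel (indicator \<Omega> :: _ \<Rightarrow> real)"
      using emeasure_bounded_finite[OF \<Omega>(2)] by (intro integrable_real_indicator) auto
    have iF2: "integrable lborel (\<lambda>x. (F x)\<^sup>2)"
    proof (rule Bochner_Integration.integrable_bound[of _ "\<lambda>x. KF\<^sup>2 * indicator \<Omega> x"])
      show "AE x in lborel. norm ((F x)\<^sup>2) \<le> norm (KF\<^sup>2 * indicator \<Omega> x)"
      proof (rule AE_I2)
        fix x show "norm ((F x)\<^sup>2) \<le> norm (KF\<^sup>2 * indicator \<Omega> x)"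
          using F[of x] by (cases "x \<in> \<Omega>") (auto simp: F_def intro!: power_mono)
      qed
    qed (use i\<Omega> in auto)
    have iE: "integrable lborel (\<lambda>x. indicator \<Omega> x * ((v x)\<^sup>2 + (norm (G x))\<^sup>2))"
    proof (rule Bochner_Integration.integrable_bound[OF iF2])
      show "AE x in lborel. norm (indicator \<Omega> x * ((v x)\<^sup>2 + (norm (G x))\<^sup>2)) \<le> norm ((F x)\<^sup>2)"
        by (intro AE_I2) (simp add: F_def indicator_def power2_sum)
    qed simp
    define S where "S = (\<integral>x. (F x)\<^sup>2 \<partial>lborel)"
    have S: "(\<integral>\<^sup>+x. ennreal ((F x)\<^sup>2) \<partial>lborel) = ennreal S" "S \<ge> 0"
      unfolding S_def using iF2 by (auto intro!: nn_integral_eq_integral Bochner_Integration.integral_nonneg)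
    have SE: "S \<le> 2 * E"
    proof -
      have "S \<le> (\<integral>x. 2 * (indicator \<Omega> x * ((v x)\<^sup>2 + (norm (G x))\<^sup>2)) \<partial>lborel)"
        unfolding S_def
      proof (rule integral_mono[OF iF2])
        show "(F x)\<^sup>2 \<le> 2 * (indicator \<Omega> x * ((v x)\<^sup>2 + (norm (G x))\<^sup>2))" for x
          using power2_add_le[of "\<bar>v x\<bar>" "norm (G x)"] by (simp add: F_def indicator_def)
      qed (use iE in simp)
      then show ?thesis by (simp add: E_def set_lebesgue_integral_def)
    qed
    have E0: "E \<ge> 0" using SE S by linarith

    define H where "H t x = (\<integral>z. F (x + t *\<^sub>R z) * k z \<partial>lborel)" for t x
    have Hm [measurable]: "(\<lambda>p. H (fst p) (snd p)) \<in> borel_measurable (borel \<Otimes>\<^sub>M borel)"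
      unfolding H_def by measurable
    have Hm2: "(\<lambda>x. H (f x) (g x)) \<in> borel_measurable M"
      if "f \<in> borel_measurable M" "g \<in> borel_measurable M" for f g and M :: "'z measure"
      using measurable_compose[OF measurable_Pair[OF that] Hm] by simp
    have Hs [measurable]: "(\<lambda>s. H (s ^ m) x) \<in> borel_measurable borel" for x
      using Hm2[of "\<lambda>s. s ^ m" borel "\<lambda>s. x"] by simp
    have Hx [measurable]: "(\<lambda>x. H t x) \<in> borel_measurable borel" for t
      using Hm2[of "\<lambda>x. t" borel "\<lambda>x. x"] by simp
    have iFk: "integrable lborel (\<lambda>z. F (x + t *\<^sub>R z) * k z)" for t x
    proof (rule Bochner_Integration.integrable_bound[of _ "\<lambda>z. KF * k z"])
      show "AE z in lborel. norm (F (x + t *\<^sub>R z) * k z) \<le> norm (KF * k z)"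
        using F k(2) KF by (intro AE_I2) (auto simp: abs_mult intro!: mult_right_mono)
    qed (use k in auto)
    have H: "0 \<le> H t x" "H t x \<le> KF" for t x
    proof -
      show "0 \<le> H t x" unfolding H_def using F k by (intro Bochner_Integration.integral_nonneg) simp
      have "H t x \<le> (\<integral>z. KF * k z \<partial>lborel)"
        unfolding H_def using F k by (intro integral_mono iFk) (auto intro!: mult_right_mono)
      then show "H t x \<le> KF" using k by simp
    qed
    have Hnn: "(\<integral>\<^sup>+z. ennreal (F (x + t *\<^sub>R z) * k z) \<partial>lborel) = ennreal (H t x)" for t x
      unfolding H_def using F k by (intro nn_integral_eq_integral iFk) auto

    \<comment> \<open>The indicator of the unit interval occurs twice: the first belongs to the
      function, the second is the probability density for Jensen's inequality.\<close>
    define J where "J x = (\<integral>s. (indicator {0..1} s * s ^ (m - 1) * H (s ^ m) x) * indicator {0..1} s \<partial>lborel)" for x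
    have Jb: "0 \<le> indicator {0..1} s * s ^ (m - 1) * H (s ^ m) x" "indicator {0..1} s * s ^ (m - 1) * H (s ^ m) x \<le> KF" for s :: real and x
    proof -
      show "0 \<le> indicator {0..1} s * s ^ (m - 1) * H (s ^ m) x" using H by (auto simp: indicator_def)
      show "indicator {0..1} s * s ^ (m - 1) * H (s ^ m) x \<le> KF"
      proof (cases "s \<in> {0..1}")
        case True
        then have "s ^ (m - 1) \<le> 1" "0 \<le> s ^ (m - 1)" by (auto intro: power_le_one)
        then have "s ^ (m - 1) * H (s ^ m) x \<le> 1 * KF" using H KF by (intro mult_mono) auto
        then show ?thesis using True by simp
      qed (use KF in simp)
    qed
    have Jn: "0 \<le> (indicator {0..1} s * s ^ (m - 1) * H (s ^ m) x) * indicator {0..1} s" for s :: real and x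
      by (rule mult_nonneg_nonneg[OF Jb(1)]) simp
    have J0: "J x \<ge> 0" for x
      unfolding J_def by (intro Bochner_Integration.integral_nonneg Jn)
    have i01: "integrable lborel (indicator {0..1::real} :: _ \<Rightarrow> real)" "(\<integral>s. indicator {0..1::real} s \<partial>lborel) = (1::real)"
      by (auto intro!: integrable_real_indicator)
    have iJ: "integrable lborel (\<lambda>s. (indicator {0..1} s * s ^ (m - 1) * H (s ^ m) x) * indicator {0..1} s)" for x
    proof (rule Bochner_Integration.integrable_bound[of _ "\<lambda>s. KF * indicator {0..1} s"])
      show "(\<lambda>s. indicator {0..1} s * s ^ (m - 1) * H (s ^ m) x * indicator {0..1} s) \<in> borel_measurable lborel"
        by measurable
      show "AE s in lborel. norm (indicator {0..1} s * s ^ (m - 1) * H (s ^ m) x * indicator {0..1} s) \<le> norm (KF * indicator {0..1} s)"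
      proof (rule AE_I2)
        have "norm (a * indicator {0..1} s) \<le> norm (KF * indicator {0..1} s)" if "0 \<le> a" "a \<le> KF" for a s :: real
          using that by (auto simp: abs_mult intro!: mult_right_mono)
        from this[OF Jb] show "norm (indicator {0..1} s * s ^ (m - 1) * H (s ^ m) x * indicator {0..1} s) \<le> norm (KF * indicator {0..1} s)" for s .
      qed
    qed (use i01 in auto)

    \<comment> \<open>The value v(x) is v(x + z) minus the integral of the derivative along the
      curve, averaged over z with weight k. Working with nonnegative extended integrals, the z and s
      integrations may be exchanged without integrability conditions.\<close>
    have pt: "\<bar>v x\<bar> \<le> H 1 x + (m0 * m) * J x" if x: "x \<in> \<Omega>" "x \<in> ball a \<rho>" for x
    proof -
      have zb: "ennreal (\<bar>v x\<bar> * k z) \<le> ennreal (F (x + 1 *\<^sub>R z) * k z)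
         + (\<integral>\<^sup>+s. ennreal (m0 * m * s ^ (m - 1) * indicator {0..1} s) * ennreal (F (x + s ^ m *\<^sub>R z) * k z) \<partial>lborel)" for z
      proof (cases "z \<in> ball c \<delta>")
        case z: True
        have nz: "norm z \<le> m0"
          using z norm_triangle_ineq[of "z - c" c] by (simp add: m0_def dist_norm norm_minus_commute)
        have in\<Omega>: "x + s ^ m *\<^sub>R z \<in> \<Omega>" if "s \<in> {0..1}" for s :: real
        proof (cases "s = 0")
          case False
          then show ?thesis using that by (intro cone'(3) x z) (auto intro: power_le_one)
        qed (use m x in \<open>simp add: power_0_left\<close>)
        define f where "f s = (G (x + s ^ m *\<^sub>R z) \<bullet> z) * (real m * s ^ (m - 1)) * indicator {0..1} s" for s :: real
        have ftc: "v (x + z) - v x = (\<integral>s. f s \<partial>lborel)"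
          unfolding f_def by (rule has_grad_segment_FTC[OF v(2) Gc]) (use m in simp)
        have [measurable]: "f \<in> borel_measurable borel" unfolding f_def by measurable
        have fle: "\<bar>f s\<bar> \<le> m0 * m * s ^ (m - 1) * indicator {0..1} s * F (x + s ^ m *\<^sub>R z)" for s
        proof (cases "s \<in> {0..1}")
          case True
          have "\<bar>G (x + s ^ m *\<^sub>R z) \<bullet> z\<bar> \<le> norm (G (x + s ^ m *\<^sub>R z)) * norm z" by (rule Cauchy_Schwarz_ineq2)
          also have "\<dots> \<le> F (x + s ^ m *\<^sub>R z) * m0"
            using in\<Omega>[OF True] nz F by (intro mult_mono) (auto simp: F_def)
          finally have "\<bar>G (x + s ^ m *\<^sub>R z) \<bullet> z\<bar> * (real m * s ^ (m - 1)) \<le> F (x + s ^ m *\<^sub>R z) * m0 * (real m * s ^ (m - 1))"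
            using True by (intro mult_right_mono) auto
          then show ?thesis using True by (simp add: f_def abs_mult mult_ac)
        qed (simp add: f_def)
        have "ennreal \<bar>\<integral>s. f s \<partial>lborel\<bar> \<le> (\<integral>\<^sup>+s. ennreal \<bar>f s\<bar> \<partial>lborel)"
        proof (cases "integrable lborel f")
          case True
          then show ?thesis using integral_norm_bound_ennreal[OF True] by simp
        qed (simp add: not_integrable_integral_eq)
        also have "\<dots> \<le> (\<integral>\<^sup>+s. ennreal (m0 * m * s ^ (m - 1) * indicator {0..1} s * F (x + s ^ m *\<^sub>R z)) \<partial>lborel)"
          by (intro nn_integral_mono ennreal_leI fle)
        finally have A: "ennreal \<bar>v (x + z) - v x\<bar> \<le> (\<integral>\<^sup>+s. ennreal (m0 * m * s ^ (m - 1) * indicator {0..1} s * F (x + s ^ m *\<^sub>R z)) \<partial>lborel)"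
          unfolding ftc .
        have "\<bar>v (x + z)\<bar> \<le> F (x + 1 *\<^sub>R z)" using in\<Omega>[of 1] by (simp add: F_def)
        then have tri: "\<bar>v x\<bar> \<le> F (x + 1 *\<^sub>R z) + \<bar>v (x + z) - v x\<bar>" by linarith
        have "ennreal \<bar>v x\<bar> \<le> ennreal (F (x + 1 *\<^sub>R z)) + ennreal \<bar>v (x + z) - v x\<bar>"
          using ennreal_leI[OF tri] F by simp
        then have "ennreal \<bar>v x\<bar> \<le> ennreal (F (x + 1 *\<^sub>R z))
           + (\<integral>\<^sup>+s. ennreal (m0 * m * s ^ (m - 1) * indicator {0..1} s * F (x + s ^ m *\<^sub>R z)) \<partial>lborel)"
          using A by (rule order_trans[OF _ add_left_mono])
        then have "ennreal \<bar>v x\<bar> * ennreal (k z) \<le> (ennreal (F (x + 1 *\<^sub>R z))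
           + (\<integral>\<^sup>+s. ennreal (m0 * m * s ^ (m - 1) * indicator {0..1} s * F (x + s ^ m *\<^sub>R z)) \<partial>lborel)) * ennreal (k z)"
          by (rule mult_right_mono) simp
        also have "\<dots> = ennreal (F (x + 1 *\<^sub>R z)) * ennreal (k z)
           + (\<integral>\<^sup>+s. ennreal (m0 * m * s ^ (m - 1) * indicator {0..1} s * F (x + s ^ m *\<^sub>R z)) * ennreal (k z) \<partial>lborel)"
          by (simp add: distrib_right nn_integral_multc)
        also have "(\<integral>\<^sup>+s. ennreal (m0 * m * s ^ (m - 1) * indicator {0..1} s * F (x + s ^ m *\<^sub>R z)) * ennreal (k z) \<partial>lborel)
           = (\<integral>\<^sup>+s. ennreal (m0 * m * s ^ (m - 1) * indicator {0..1} s) * ennreal (F (x + s ^ m *\<^sub>R z) * k z) \<partial>lborel)"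
          using m0 F k(2) by (intro nn_integral_cong) (auto simp: ennreal_mult[symmetric] indicator_def mult_ac)
        finally show ?thesis using F k(2) by (simp add: ennreal_mult)
      qed (simp add: k_def)
      have "ennreal \<bar>v x\<bar> = (\<integral>\<^sup>+z. ennreal (\<bar>v x\<bar> * k z) \<partial>lborel)"
        using k by (simp add: ennreal_mult nn_integral_cmult nn_integral_eq_integral)
      also have "\<dots> \<le> (\<integral>\<^sup>+z. ennreal (F (x + 1 *\<^sub>R z) * k z)
         + (\<integral>\<^sup>+s. ennreal (m0 * m * s ^ (m - 1) * indicator {0..1} s) * ennreal (F (x + s ^ m *\<^sub>R z) * k z) \<partial>lborel) \<partial>lborel)"
        by (intro nn_integral_mono zb)
      also have "\<dots> = (\<integral>\<^sup>+z. ennreal (F (x + 1 *\<^sub>R z) * k z) \<partial>lborel)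
         + (\<integral>\<^sup>+z. (\<integral>\<^sup>+s. ennreal (m0 * m * s ^ (m - 1) * indicator {0..1} s) * ennreal (F (x + s ^ m *\<^sub>R z) * k z) \<partial>lborel) \<partial>lborel)"
        by (rule nn_integral_add) measurable
      also have "(\<integral>\<^sup>+z. (\<integral>\<^sup>+s. ennreal (m0 * m * s ^ (m - 1) * indicator {0..1} s) * ennreal (F (x + s ^ m *\<^sub>R z) * k z) \<partial>lborel) \<partial>lborel)
         = (\<integral>\<^sup>+s. (\<integral>\<^sup>+z. ennreal (m0 * m * s ^ (m - 1) * indicator {0..1} s) * ennreal (F (x + s ^ m *\<^sub>R z) * k z) \<partial>lborel) \<partial>lborel)"
        by (rule lborel_pair.Fubini') measurable
      also have "\<dots> = (\<integral>\<^sup>+s. ennreal (m0 * m) * ennreal ((indicator {0..1} s * s ^ (m - 1) * H (s ^ m) x) * indicator {0..1} s) \<partial>lborel)"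
      proof (rule nn_integral_cong)
        fix s :: real
        have "(\<integral>\<^sup>+z. ennreal (m0 * m * s ^ (m - 1) * indicator {0..1} s) * ennreal (F (x + s ^ m *\<^sub>R z) * k z) \<partial>lborel)
          = ennreal (m0 * m * s ^ (m - 1) * indicator {0..1} s) * (\<integral>\<^sup>+z. ennreal (F (x + s ^ m *\<^sub>R z) * k z) \<partial>lborel)"
          by (rule nn_integral_cmult) measurable
        also have "\<dots> = ennreal (m0 * m * s ^ (m - 1) * indicator {0..1} s) * ennreal (H (s ^ m) x)"
          unfolding Hnn ..
        also have "\<dots> = ennreal (m0 * m * s ^ (m - 1) * indicator {0..1} s * H (s ^ m) x)"
          using m0 H by (intro ennreal_mult[symmetric]) (auto simp: indicator_def)
        also have "\<dots> = ennreal ((m0 * m) * ((indicator {0..1} s * s ^ (m - 1) * H (s ^ m) x) * indicator {0..1} s))"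
          by (simp add: indicator_def mult_ac)
        also have "\<dots> = ennreal (m0 * m) * ennreal ((indicator {0..1} s * s ^ (m - 1) * H (s ^ m) x) * indicator {0..1} s)"
          using m0 H by (intro ennreal_mult) (auto simp: indicator_def)
        finally show "(\<integral>\<^sup>+z. ennreal (m0 * m * s ^ (m - 1) * indicator {0..1} s) * ennreal (F (x + s ^ m *\<^sub>R z) * k z) \<partial>lborel)
          = ennreal (m0 * m) * ennreal ((indicator {0..1} s * s ^ (m - 1) * H (s ^ m) x) * indicator {0..1} s)" .
      qed
      also have "\<dots> = ennreal (m0 * m) * (\<integral>\<^sup>+s. ennreal ((indicator {0..1} s * s ^ (m - 1) * H (s ^ m) x) * indicator {0..1} s) \<partial>lborel)"
        by (intro nn_integral_cmult) measurable
      also have "(\<integral>\<^sup>+s. ennreal ((indicator {0..1} s * s ^ (m - 1) * H (s ^ m) x) * indicator {0..1} s) \<partial>lborel) = ennreal (J x)"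
        unfolding J_def by (intro nn_integral_eq_integral iJ AE_I2 Jn)
      also have "(\<integral>\<^sup>+z. ennreal (F (x + 1 *\<^sub>R z) * k z) \<partial>lborel) = ennreal (H 1 x)" by (rule Hnn)
      also have "ennreal (H 1 x) + ennreal (m0 * m) * ennreal (J x) = ennreal (H 1 x + (m0 * m) * J x)"
        using m0 H J0[of x] by (simp add: ennreal_mult ennreal_plus)
      finally show ?thesis
        using H[of 1 x] m0 J0[of x] by (subst (asm) ennreal_le_iff) auto
    qed
    define T where "T = (b * S) powr e * S"
    have T0: "T \<ge> 0" unfolding T_def using S by simp
    have HL: "(\<integral>\<^sup>+x. ennreal (H t x powr q) \<partial>lborel) \<le> ennreal ((b * S / t ^ N) powr e * S)" if "t > 0" for t
      using dilated_average_L2_Lq[OF _ k S that q(1) F(1)] unfolding H_def e_def N_def by simp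
    have H1: "(\<integral>\<^sup>+x. ennreal (H 1 x powr q) \<partial>lborel) \<le> ennreal T"
      using HL[of 1] by (simp add: T_def)
    define fJ where "fJ s x = indicator {0..1} s * s ^ (m - 1) * H (s ^ m) x" for s x
    have fJm [measurable]: "(\<lambda>p. fJ (fst p) (snd p)) \<in> borel_measurable (borel \<Otimes>\<^sub>M borel)"
    proof -
      have [measurable]: "(\<lambda>p. H (fst p ^ m) (snd p)) \<in> borel_measurable (borel \<Otimes>\<^sub>M borel)"
        by (intro Hm2) measurable
      show ?thesis unfolding fJ_def by measurable
    qed
    have J_le: "ennreal (J x powr q) \<le> (\<integral>\<^sup>+s. ennreal (fJ s x powr q * indicator {0..1} s) \<partial>lborel)" for x
    proof -
      have "(\<lambda>s. fJ s x) \<in> borel_measurable lborel" unfolding fJ_def by measurable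
      then show ?thesis
        unfolding J_def fJ_def[symmetric]
        by (rule powr_weighted_integral_le[where K=KF]) (use Jb i01 q in \<open>auto simp: fJ_def\<close>)
    qed
    have fJ_le: "(\<integral>\<^sup>+x. ennreal (fJ s x powr q * indicator {0..1} s) \<partial>lborel) \<le> ennreal T * indicator {0..1} s" for s
    proof (cases "s \<in> {0<..1}")
      case s: True
      have "(\<integral>\<^sup>+x. ennreal (fJ s x powr q * indicator {0..1} s) \<partial>lborel)
        = (\<integral>\<^sup>+x. ennreal ((s ^ (m - 1)) powr q) * ennreal (H (s ^ m) x powr q) \<partial>lborel)"
        using s H by (intro nn_integral_cong) (simp add: fJ_def powr_mult ennreal_mult)
      also have "\<dots> = ennreal ((s ^ (m - 1)) powr q) * (\<integral>\<^sup>+x. ennreal (H (s ^ m) x powr q) \<partial>lborel)"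
        by (rule nn_integral_cmult) measurable
      also have "\<dots> \<le> ennreal ((s ^ (m - 1)) powr q) * ennreal ((b * S / (s ^ m) ^ N) powr e * S)"
        using s by (intro mult_left_mono HL) auto
      also have "\<dots> = ennreal ((s ^ (m - 1)) powr q * ((b * S / (s ^ m) ^ N) powr e * S))"
        using S by (intro ennreal_mult[symmetric]) auto
      also have "\<dots> \<le> ennreal T"
      proof (rule ennreal_leI)
        have 1: "(s ^ (m - 1)) powr q = s powr (real (m - 1) * q)"
          using s by (simp add: powr_realpow[symmetric] powr_powr)
        have 2: "((s ^ m) ^ N) powr e = s powr (real m * N * e)"
          using s by (simp add: powr_realpow[symmetric] powr_powr)
        \<comment> \<open>The choice of m, rearranged. Since s \<le> 1, the larger exponent gives
          the smaller power.\<close>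
        have "real m * N * e \<le> real (m - 1) * q" using m by (simp add: of_nat_diff algebra_simps)
        then have 3: "s powr (real (m - 1) * q) \<le> s powr (real m * N * e)"
          using s by (intro powr_mono') auto
        have pos: "s powr (real m * N * e) > 0" using s by simp
        have "(s ^ (m - 1)) powr q * (b * S / (s ^ m) ^ N) powr e
          = (b * S) powr e * (s powr (real (m - 1) * q) / s powr (real m * N * e))"
        proof -
          have "(b * S / (s ^ m) ^ N) powr e = (b * S) powr e / ((s ^ m) ^ N) powr e"
            using s b S by (simp add: powr_divide)
          then show ?thesis unfolding 1 2 by simp
        qed
        also have "\<dots> \<le> (b * S) powr e * 1"
          using 3 pos by (intro mult_left_mono) (auto simp: divide_le_eq_1)
        finally have "(s ^ (m - 1)) powr q * (b * S / (s ^ m) ^ N) powr e \<le> (b * S) powr e" by simp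
        then show "(s ^ (m - 1)) powr q * ((b * S / (s ^ m) ^ N) powr e * S) \<le> T"
          unfolding T_def mult.assoc[symmetric] using S by (intro mult_right_mono)
      qed
      finally show ?thesis using s by simp
    next
      case False
      \<comment> \<open>Outside the unit interval the indicator vanishes, and at s = 0 the factor
        s^(m-1) does, because m \<ge> 2.\<close>
      then have z: "fJ s x powr q * indicator {0..1} s = 0" for x
        using m q by (cases "s = 0") (auto simp: fJ_def indicator_def power_0_left)
      show ?thesis unfolding z by simp
    qed
    have Jq: "(\<integral>\<^sup>+x. ennreal (J x powr q) \<partial>lborel) \<le> ennreal T"
    proof -
      have "(\<integral>\<^sup>+x. ennreal (J x powr q) \<partial>lborel) \<le> (\<integral>\<^sup>+x. (\<integral>\<^sup>+s. ennreal (fJ s x powr q * indicator {0..1} s) \<partial>lborel) \<partial>lborel)"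
        by (intro nn_integral_mono J_le)
      also have "\<dots> = (\<integral>\<^sup>+s. (\<integral>\<^sup>+x. ennreal (fJ s x powr q * indicator {0..1} s) \<partial>lborel) \<partial>lborel)"
      proof (rule lborel_pair.Fubini')
        have [measurable]: "(\<lambda>(s, x). fJ s x) \<in> borel_measurable (borel \<Otimes>\<^sub>M borel)"
          using fJm by (simp add: case_prod_beta')
        show "(\<lambda>(s, x). ennreal (fJ s x powr q * indicator {0..1} s)) \<in> borel_measurable (lborel \<Otimes>\<^sub>M lborel)"
          by measurable
      qed
      also have "\<dots> \<le> (\<integral>\<^sup>+s. ennreal T * indicator {0..1::real} s \<partial>lborel)"
        by (intro nn_integral_mono fJ_le)
      also have "\<dots> = ennreal T" by (simp add: nn_integral_cmult_indicator)
      finally show ?thesis .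
    qed
    have Jm [measurable]: "J \<in> borel_measurable borel"
    proof -
      have "(\<lambda>p. fJ (snd p) (fst p)) \<in> borel_measurable (borel \<Otimes>\<^sub>M borel)"
        using measurable_compose[OF measurable_Pair[OF measurable_snd measurable_fst] fJm] by simp
      then have [measurable]: "(\<lambda>(x, s). fJ s x) \<in> borel_measurable (borel \<Otimes>\<^sub>M borel)"
        by (simp add: case_prod_beta')
      show ?thesis unfolding J_def fJ_def[symmetric] by measurable
    qed
    have "(\<integral>\<^sup>+x\<in>\<Omega> \<inter> ball a \<rho>. ennreal (\<bar>v x\<bar> powr q) \<partial>lborel)
       \<le> (\<integral>\<^sup>+x. ennreal (2 powr q) * (ennreal (H 1 x powr q) + ennreal ((m0 * m) powr q) * ennreal (J x powr q)) \<partial>lborel)"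
    proof (rule nn_integral_mono)
      fix x
      show "ennreal (\<bar>v x\<bar> powr q) * indicator (\<Omega> \<inter> ball a \<rho>) x
        \<le> ennreal (2 powr q) * (ennreal (H 1 x powr q) + ennreal ((m0 * m) powr q) * ennreal (J x powr q))"
      proof (cases "x \<in> \<Omega> \<inter> ball a \<rho>")
        case True
        have "\<bar>v x\<bar> powr q \<le> (H 1 x + (m0 * m) * J x) powr q"
          using pt[of x] True q by (intro powr_mono2) auto
        also have "\<dots> \<le> 2 powr q * (H 1 x powr q + ((m0 * m) * J x) powr q)"
          using H m0 J0 q by (intro powr_add_le) auto
        also have "((m0 * m) * J x) powr q = (m0 * m) powr q * J x powr q"
          using m0 J0 by (simp add: powr_mult)
        finally have "\<bar>v x\<bar> powr q \<le> 2 powr q * (H 1 x powr q + (m0 * m) powr q * J x powr q)" .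
        then have "ennreal (\<bar>v x\<bar> powr q) \<le> ennreal (2 powr q * (H 1 x powr q + (m0 * m) powr q * J x powr q))"
          by (rule ennreal_leI)
        then show ?thesis using True by (simp add: ennreal_mult)
      qed simp
    qed
    also have "\<dots> = ennreal (2 powr q) * ((\<integral>\<^sup>+x. ennreal (H 1 x powr q) \<partial>lborel)
        + ennreal ((m0 * m) powr q) * (\<integral>\<^sup>+x. ennreal (J x powr q) \<partial>lborel))"
      by (simp add: nn_integral_cmult nn_integral_add)
    also have "\<dots> \<le> ennreal (2 powr q) * (ennreal T + ennreal ((m0 * m) powr q) * ennreal T)"
      by (intro mult_left_mono add_mono H1 Jq) auto
    also have "\<dots> = ennreal (2 powr q * (1 + (m0 * m) powr q) * T)"
      using T0 by (simp add: ennreal_mult[symmetric] ennreal_plus[symmetric] algebra_simps del: ennreal_plus)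
    also have "\<dots> \<le> ennreal (K * E powr (q / 2))"
    proof (rule ennreal_leI)
      \<comment> \<open>Since e + 1 = q/2, the bound has the homogeneity required of the Sobolev
        inequality.\<close>
      have "T = b powr e * S powr (q / 2)"
      proof (cases "S = 0")
        case False
        then have "S powr e * S = S powr (e + 1)" using S by (simp add: powr_add)
        also have "e + 1 = q / 2" by (simp add: e_def field_simps)
        finally show ?thesis using b S by (simp add: T_def powr_mult)
      qed (use q in \<open>simp add: T_def\<close>)
      also have "\<dots> \<le> b powr e * (2 * E) powr (q / 2)"
        using SE S q by (intro mult_left_mono powr_mono2) auto
      also have "\<dots> = b powr e * 2 powr (q / 2) * E powr (q / 2)"
        using E0 by (simp add: powr_mult)
      finally have "2 powr q * (1 + (m0 * m) powr q) * T
        \<le> 2 powr q * (1 + (m0 * m) powr q) * (b powr e * 2 powr (q / 2) * E powr (q / 2))"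
        by (intro mult_left_mono) auto
      then show "2 powr q * (1 + (m0 * m) powr q) * T \<le> K * E powr (q / 2)"
        by (simp add: K_def mult.assoc)
    qed
    finally show "(\<integral>\<^sup>+x\<in>\<Omega> \<inter> ball a \<rho>. ennreal (\<bar>v x\<bar> powr q) \<partial>lborel)
       \<le> ennreal (K * (\<integral>x\<in>\<Omega>. (v x)\<^sup>2 + (norm (G x))\<^sup>2 \<partial>lborel) powr (q / 2))"
      unfolding E_def .
  qed
qed

text \<open>Finitely many balls with a cone cover \<Omega>, and the local constants add up.\<close>

lemma sobolev_inequality_lipschitz_domain:
  fixes \<Omega> :: "(real^'n) set"
  assumes \<Omega>: "lipschitz_domain \<Omega>" "bounded \<Omega>"
    and q: "q > 2" "q * (real CARD('n) - 2) < 2 * real CARD('n)"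
  obtains K where "K \<ge> 0" "\<And>v G. smooth_fun v \<Longrightarrow> has_grad v G \<Longrightarrow>
     (\<integral>\<^sup>+x\<in>\<Omega>. ennreal (\<bar>v x\<bar> powr q) \<partial>lborel)
       \<le> ennreal (K * (\<integral>x\<in>\<Omega>. (v x)\<^sup>2 + (norm (G x))\<^sup>2 \<partial>lborel) powr (q / 2))"
proof -
  have op: "open \<Omega>" using \<Omega>(1) by (simp add: lipschitz_domain_def)
  then have [measurable]: "\<Omega> \<in> sets borel" by simp
  obtain I \<rho> c \<delta> where I: "finite I" "closure \<Omega> \<subseteq> (\<Union>a\<in>I. ball a (\<rho> a / 2))"
    "\<And>a. a \<in> I \<Longrightarrow> inner_cone \<Omega> a (\<rho> a) (c a) (\<delta> a)"
    using lipschitz_domain_finite_cones[OF \<Omega>] by blast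
  define Q where "Q a K \<longleftrightarrow> K \<ge> 0 \<and> (\<forall>v G. smooth_fun v \<longrightarrow> has_grad v G \<longrightarrow>
     (\<integral>\<^sup>+x\<in>\<Omega> \<inter> ball a (\<rho> a). ennreal (\<bar>v x\<bar> powr q) \<partial>lborel)
       \<le> ennreal (K * (\<integral>x\<in>\<Omega>. (v x)\<^sup>2 + (norm (G x))\<^sup>2 \<partial>lborel) powr (q / 2)))" for a K
  have "\<exists>K. Q a K" if "a \<in> I" for a
    unfolding Q_def by (rule sobolev_inequality_cone[OF op \<Omega>(2) I(3)[OF that] q]) blast
  then obtain K where K: "\<And>a. a \<in> I \<Longrightarrow> Q a (K a)" by metis
  show ?thesis
  proof (rule that[of "sum K I"])
    show "sum K I \<ge> 0" using K unfolding Q_def by (intro sum_nonneg) blast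
    fix v :: "real^'n \<Rightarrow> real" and G :: "real^'n \<Rightarrow> real^'n"
    assume v: "smooth_fun v" "has_grad v G"
    have [measurable]: "v \<in> borel_measurable borel"
      using smooth_fun_continuous_on[OF v(1)] by (rule borel_measurable_continuous_onI)
    define E where "E = (\<integral>x\<in>\<Omega>. (v x)\<^sup>2 + (norm (G x))\<^sup>2 \<partial>lborel) powr (q / 2)"
    have "(\<integral>\<^sup>+x\<in>\<Omega>. ennreal (\<bar>v x\<bar> powr q) \<partial>lborel)
      \<le> (\<integral>\<^sup>+x. (\<Sum>a\<in>I. ennreal (\<bar>v x\<bar> powr q) * indicator (\<Omega> \<inter> ball a (\<rho> a)) x) \<partial>lborel)"
    proof (rule nn_integral_mono)
      fix x
      show "ennreal (\<bar>v x\<bar> powr q) * indicator \<Omega> x \<le> (\<Sum>a\<in>I. ennreal (\<bar>v x\<bar> powr q) * indicator (\<Omega> \<inter> ball a (\<rho> a)) x)"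
      proof (cases "x \<in> \<Omega>")
        case True
        then obtain a where a: "a \<in> I" "x \<in> ball a (\<rho> a / 2)" using I(2) closure_subset by blast
        have "\<rho> a > 0" using I(3)[OF a(1)] by (simp add: inner_cone_def)
        then have "x \<in> \<Omega> \<inter> ball a (\<rho> a)" using a(2) True by auto
        then have "ennreal (\<bar>v x\<bar> powr q) * indicator \<Omega> x \<le> ennreal (\<bar>v x\<bar> powr q) * indicator (\<Omega> \<inter> ball a (\<rho> a)) x"
          by simp
        also have "\<dots> \<le> (\<Sum>a\<in>I. ennreal (\<bar>v x\<bar> powr q) * indicator (\<Omega> \<inter> ball a (\<rho> a)) x)"
          using I(1) a(1) by (intro member_le_sum) auto
        finally show ?thesis .
      qed simp
    qed
    also have "\<dots> = (\<Sum>a\<in>I. \<integral>\<^sup>+x\<in>\<Omega> \<inter> ball a (\<rho> a). ennreal (\<bar>v x\<bar> powr q) \<partial>lborel)"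
    proof (rule nn_integral_sum)
      fix a assume "a \<in> I"
      have [measurable]: "ball a (\<rho> a) \<in> sets borel" by simp
      show "(\<lambda>x. ennreal (\<bar>v x\<bar> powr q) * indicator (\<Omega> \<inter> ball a (\<rho> a)) x) \<in> borel_measurable lborel"
        by measurable
    qed
    also have "\<dots> \<le> (\<Sum>a\<in>I. ennreal (K a * E))"
      using K v unfolding Q_def E_def by (intro sum_mono) blast
    also have "\<dots> = ennreal (sum K I * E)"
      using K unfolding Q_def by (subst sum_ennreal) (auto simp: E_def sum_distrib_right)
    finally show "(\<integral>\<^sup>+x\<in>\<Omega>. ennreal (\<bar>v x\<bar> powr q) \<partial>lborel)
       \<le> ennreal (sum K I * (\<integral>x\<in>\<Omega>. (v x)\<^sup>2 + (norm (G x))\<^sup>2 \<partial>lborel) powr (q / 2))"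
      unfolding E_def .
  qed
qed

section \<open>Stampacchia's iteration\<close>

text \<open>Young's inequality gives integrability directly, and the estimate after both factors are
  divided by their norms. If a norm is zero, that factor and hence the product vanish almost
  everywhere.\<close>

lemma holder_inequality_integral:
  fixes f g :: "'a \<Rightarrow> real"
  assumes [measurable]: "f \<in> borel_measurable M" "g \<in> borel_measurable M"
    and nn: "\<And>x. f x \<ge> 0" "\<And>x. g x \<ge> 0" and PQ: "P > 1" "Q > 1" "1 / P + 1 / Q = 1"
    and i: "integrable M (\<lambda>x. f x powr P)" "integrable M (\<lambda>x. g x powr Q)"
  shows "integrable M (\<lambda>x. f x * g x)"
    and "(\<integral>x. f x * g x \<partial>M) \<le> (\<integral>x. f x powr P \<partial>M) powr (1 / P) * (\<integral>x. g x powr Q \<partial>M) powr (1 / Q)"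
proof -
  show int: "integrable M (\<lambda>x. f x * g x)"
  proof (rule Bochner_Integration.integrable_bound)
    show "integrable M (\<lambda>x. f x powr P / P + g x powr Q / Q)" using i by simp
    show "AE x in M. norm (f x * g x) \<le> norm (f x powr P / P + g x powr Q / Q)"
    proof (rule AE_I2)
      fix x
      have "f x * g x \<le> f x powr P / P + g x powr Q / Q" by (rule Youngs_inequality[OF PQ nn])
      moreover have "0 \<le> f x * g x" using nn by simp
      ultimately show "norm (f x * g x) \<le> norm (f x powr P / P + g x powr Q / Q)" by simp
    qed
  qed simp
  define a where "a = (\<integral>x. f x powr P \<partial>M)"
  define b where "b = (\<integral>x. g x powr Q \<partial>M)"
  have ab: "a \<ge> 0" "b \<ge> 0" by (simp_all add: a_def b_def)
  have "(\<integral>x. f x * g x \<partial>M) \<le> a powr (1 / P) * b powr (1 / Q)"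
  proof (cases "a = 0 \<or> b = 0")
    case True
    then have "AE x in M. f x powr P = 0 \<or> g x powr Q = 0"
      using integral_nonneg_eq_0_iff_AE[OF i(1)] integral_nonneg_eq_0_iff_AE[OF i(2)]
      unfolding a_def b_def by auto
    then have "AE x in M. f x * g x = 0"
    proof eventually_elim
      case (elim x)
      then show ?case by (metis mult_eq_0_iff powr_eq_0_iff)
    qed
    then have "(\<integral>x. f x * g x \<partial>M) = 0" by (rule integral_eq_zero_AE)
    then show ?thesis by simp
  next
    case False
    then have pos: "a > 0" "b > 0" using ab by auto
    define \<alpha> where "\<alpha> = a powr (1 / P)"
    define \<beta> where "\<beta> = b powr (1 / Q)"
    have \<alpha>\<beta>: "\<alpha> > 0" "\<beta> > 0" "\<alpha> powr P = a" "\<beta> powr Q = b"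
      using pos PQ by (auto simp: \<alpha>_def \<beta>_def powr_powr)
    have "(\<integral>x. f x * g x \<partial>M) \<le> (\<integral>x. (\<alpha> * \<beta>) * (f x powr P / a / P + g x powr Q / b / Q) \<partial>M)"
    proof (rule integral_mono[OF int])
      fix x
      have "(f x / \<alpha>) * (g x / \<beta>) \<le> (f x / \<alpha>) powr P / P + (g x / \<beta>) powr Q / Q"
        using nn \<alpha>\<beta> by (intro Youngs_inequality PQ) auto
      also have "\<dots> = f x powr P / a / P + g x powr Q / b / Q"
        using nn \<alpha>\<beta> by (simp add: powr_divide)
      finally have "(\<alpha> * \<beta>) * ((f x / \<alpha>) * (g x / \<beta>)) \<le> (\<alpha> * \<beta>) * (f x powr P / a / P + g x powr Q / b / Q)"
        by (rule mult_left_mono) (use \<alpha>\<beta> in simp)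
      moreover have "(\<alpha> * \<beta>) * ((f x / \<alpha>) * (g x / \<beta>)) = f x * g x" using \<alpha>\<beta> by simp
      ultimately show "f x * g x \<le> (\<alpha> * \<beta>) * (f x powr P / a / P + g x powr Q / b / Q)" by argo
    qed (use i in simp)
    also have "\<dots> = (\<alpha> * \<beta>) * (a / a / P + b / b / Q)"
      using i by (simp add: a_def b_def)
    also have "\<dots> = \<alpha> * \<beta>" using pos PQ by simp
    finally show ?thesis by (simp add: \<alpha>_def \<beta>_def)
  qed
  then show "(\<integral>x. f x * g x \<partial>M) \<le> (\<integral>x. f x powr P \<partial>M) powr (1 / P) * (\<integral>x. g x powr Q \<partial>M) powr (1 / Q)"
    by (simp add: a_def b_def)
qed

lemma power_powr_commute:
  fixes x a :: real
  assumes "x > 0"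
  shows "(x ^ n) powr a = (x powr a) ^ n"
  using assms by (induction n) (auto simp: powr_mult)

text \<open>The bound y_n \<le> \<eta> \<theta>^n propagates: \<theta> is chosen so that
  (\<theta>^n)^\<epsilon> = b^(-n) cancels the growing factor, and D \<eta>^\<epsilon> \<le>
  \<theta> supplies the next power of \<theta>. The threshold \<eta> depends only on D, b and
  \<epsilon>, not on the sequence.\<close>

lemma fast_geometric_convergence:
  fixes D b \<epsilon> :: real
  assumes D: "D \<ge> 0" and b: "b > 1" and \<epsilon>: "\<epsilon> > 0"
  obtains \<eta> where "\<eta> > 0" "\<And>y :: nat \<Rightarrow> real. (\<And>n. y n \<ge> 0) \<Longrightarrow> (\<And>n. y (Suc n) \<le> D * b ^ n * y n powr (1 + \<epsilon>)) \<Longrightarrow> y 0 \<le> \<eta> \<Longrightarrow> y \<longlonglongrightarrow> 0"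
proof -
  define \<theta> where "\<theta> = b powr (- 1 / \<epsilon>)"
  have \<theta>: "0 < \<theta>" "\<theta> < 1" using b \<epsilon> by (auto simp: \<theta>_def powr_less_one)
  have \<theta>\<epsilon>: "\<theta> powr \<epsilon> = 1 / b" 
  proof -
    have "\<theta> powr \<epsilon> = b powr (- 1 / \<epsilon> * \<epsilon>)" by (simp only: \<theta>_def powr_powr)
    also have "- 1 / \<epsilon> * \<epsilon> = - 1" using \<epsilon> by simp
    finally show ?thesis using b by (simp add: powr_minus_divide)
  qed
  \<comment> \<open>The denominator \<open>D + 1\<close> admits D = 0 and still gives D
    \<eta>^\<epsilon> \<le> \<theta>.\<close>
  define \<eta> where "\<eta> = (\<theta> / (D + 1)) powr (1 / \<epsilon>)"
  have \<eta>: "\<eta> > 0" "D * \<eta> powr \<epsilon> \<le> \<theta>"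
  proof -
    show "\<eta> > 0" using \<theta> D by (simp add: \<eta>_def)
    have "\<eta> powr \<epsilon> = \<theta> / (D + 1)" using \<epsilon> \<theta> D by (simp add: \<eta>_def powr_powr)
    then have "D * \<eta> powr \<epsilon> = \<theta> * (D / (D + 1))" by simp
    also have "\<dots> \<le> \<theta> * 1" using \<theta> D by (intro mult_left_mono) auto
    finally show "D * \<eta> powr \<epsilon> \<le> \<theta>" by simp
  qed
  show ?thesis
  proof (rule that[OF \<eta>(1)])
    fix y :: "nat \<Rightarrow> real"
    assume y: "\<And>n. y n \<ge> 0" "\<And>n. y (Suc n) \<le> D * b ^ n * y n powr (1 + \<epsilon>)" "y 0 \<le> \<eta>"
    have le: "y n \<le> \<eta> * \<theta> ^ n" for n
    proof (induction n)
      case (Suc n)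
      have e: "(\<theta> ^ n) powr \<epsilon> = 1 / b ^ n"
      proof -
        have "(\<theta> ^ n) powr \<epsilon> = (\<theta> powr \<epsilon>) ^ n" using \<theta>(1) by (rule power_powr_commute)
        then show ?thesis using \<theta>\<epsilon> by (simp add: power_one_over)
      qed
      have "y (Suc n) \<le> D * b ^ n * (\<eta> * \<theta> ^ n) powr (1 + \<epsilon>)"
        using y Suc D b \<epsilon> by (intro order_trans[OF y(2)] mult_left_mono powr_mono2) auto
      also have "(\<eta> * \<theta> ^ n) powr (1 + \<epsilon>) = (\<eta> * \<theta> ^ n) * (\<eta> powr \<epsilon> * (1 / b ^ n))"
        using \<eta> \<theta> by (simp add: powr_add powr_mult e)
      also have "D * b ^ n * ((\<eta> * \<theta> ^ n) * (\<eta> powr \<epsilon> * (1 / b ^ n))) = (D * \<eta> powr \<epsilon>) * (\<eta> * \<theta> ^ n)"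
        using b by simp
      also have "\<dots> \<le> \<theta> * (\<eta> * \<theta> ^ n)" using \<eta> \<theta> by (intro mult_right_mono) auto
      finally show ?case by (simp add: mult_ac)
    qed (use y in simp)
    have lim: "(\<lambda>n. \<eta> * \<theta> ^ n) \<longlonglongrightarrow> \<eta> * 0" 
      by (rule tendsto_mult[OF tendsto_const LIMSEQ_realpow_zero]) (use \<theta> in auto)
    show "y \<longlonglongrightarrow> 0"
      by (rule tendsto_sandwich[OF _ _ tendsto_const lim[simplified]]) (simp_all add: y(1) le)
  qed
qed

lemma tail_integral_tendsto_0:
  fixes f u :: "'a \<Rightarrow> real"
  assumes f: "integrable M f" and [measurable]: "u \<in> borel_measurable M"
  shows "(\<lambda>n::nat. \<integral>x. f x * indicator {x. \<bar>u x\<bar> > real n} x \<partial>M) \<longlonglongrightarrow> 0"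
proof -
  have [measurable]: "f \<in> borel_measurable M" using f by simp
  have "(\<lambda>n::nat. \<integral>x. f x * indicator {x. \<bar>u x\<bar> > real n} x \<partial>M) \<longlonglongrightarrow> (\<integral>x. 0 \<partial>M)"
  proof (rule integral_dominated_convergence[where w="\<lambda>x. \<bar>f x\<bar>"])
    show "AE x in M. (\<lambda>n. f x * indicator {x. \<bar>u x\<bar> > real n} x) \<longlonglongrightarrow> 0"
    proof (rule AE_I2)
      fix x
      obtain N where N: "\<bar>u x\<bar> \<le> real N" using real_arch_simple by blast
      have "eventually (\<lambda>n. 0 = f x * indicator {x. \<bar>u x\<bar> > real n} x) sequentially"
        using eventually_ge_at_top[of N] by eventually_elim (use N in \<open>auto simp: indicator_def\<close>)
      then show "(\<lambda>n. f x * indicator {x. \<bar>u x\<bar> > real n} x) \<longlonglongrightarrow> 0"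
        by (rule Lim_transform_eventually[OF tendsto_const])
    qed
    show "AE x in M. norm (f x * indicator {x. \<bar>u x\<bar> > real n} x) \<le> \<bar>f x\<bar>" for n
      by (intro AE_I2) (auto simp: indicator_def)
  qed (use f in auto)
  then show ?thesis by simp
qed

text \<open>Stampacchia's truncation method: absorbing \<open>\<integral> V w\<^sup>2\<close> for large \<open>k\<close> leaves a superlinear
  recursion between the measures of the superlevel sets of \<open>\<bar>u\<bar>\<close>.\<close>

lemma stampacchia_essentially_bounded:
  fixes u V :: "'a \<Rightarrow> real"
  assumes fin: "finite_measure M" and [measurable]: "u \<in> borel_measurable M" "V \<in> borel_measurable M"
    and V: "\<And>x. V x \<ge> 1" and q: "q > 2" and s: "s > q / (q - 2)"
    and iV: "integrable M (\<lambda>x. V x powr s)" and iu: "integrable M (\<lambda>x. \<bar>u x\<bar> powr q)"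
    and C: "C \<ge> 0"
    and ineq: "\<And>k. k \<ge> R \<Longrightarrow> (\<integral>x. (max 0 (\<bar>u x\<bar> - k)) powr q \<partial>M) powr (2 / q)
        \<le> C * (\<integral>x. V x * \<bar>u x\<bar> * max 0 (\<bar>u x\<bar> - k) \<partial>M)"
  obtains B where "AE x in M. \<bar>u x\<bar> \<le> B"
proof -
  interpret finite_measure M by (rule fin)
  define A where "A k = {x \<in> space M. \<bar>u x\<bar> > k}" for k
  have [measurable]: "A k \<in> sets M" for k unfolding A_def by measurable
  define w where "w k x = max 0 (\<bar>u x\<bar> - k)" for k x
  have [measurable]: "w k \<in> borel_measurable M" for k unfolding w_def by measurable
  have w0: "w k x \<ge> 0" for k x by (simp add: w_def)
  define W where "W k = (\<integral>x. w k x powr q \<partial>M) powr (1 / q)" for k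
  have W0: "W k \<ge> 0" for k by (simp add: W_def)
  \<comment> \<open>The exponent \<sigma> is conjugate to q/2 and q' to q; they serve for the
    integrals of V w^2 and V w. The inequality \<kappa> > 1/q is equivalent to s > \<sigma> and
    makes the exponent \<kappa> q of the recursion larger than 1.\<close>
  define \<sigma> where "\<sigma> = q / (q - 2)"
  define q' where "q' = q / (q - 1)"
  define \<kappa> where "\<kappa> = 1 - 1 / s - 1 / q"
  have \<sigma>: "\<sigma> > 1" "1 / \<sigma> + 1 / (q / 2) = 1" "s > \<sigma>" using q s by (auto simp: \<sigma>_def field_simps)
  have q': "q' > 1" "1 / q' + 1 / q = 1" "q' < \<sigma>" using q by (auto simp: q'_def \<sigma>_def field_simps)
  have s1: "s > 1" "s > q'" using \<sigma> q' by auto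
  have \<kappa>: "\<kappa> > 1 / q" "\<kappa> = 1 / q' - 1 / s"
  proof -
    have "1 / s < 1 / \<sigma>" using \<sigma> by (intro divide_strict_left_mono) auto
    then show "\<kappa> > 1 / q" using \<sigma>(2) unfolding \<kappa>_def by (simp add: field_simps)
    show "\<kappa> = 1 / q' - 1 / s" using q'(2) by (simp add: \<kappa>_def)
  qed
  have Vi: "0 \<le> V x * indicator (A k) x" for k x
    using V[of x] by (simp add: indicator_def)
  have iVr: "integrable M (\<lambda>x. (V x * indicator (A k) x) powr t)" if "0 < t" "t \<le> s" for t k
  proof (rule Bochner_Integration.integrable_bound[OF iV])
    show "AE x in M. norm ((V x * indicator (A k) x) powr t) \<le> norm (V x powr s)"
    proof (rule AE_I2)
      fix x
      have "V x powr t \<le> V x powr s" using V[of x] that by (intro powr_mono) auto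
      then show "norm ((V x * indicator (A k) x) powr t) \<le> norm (V x powr s)"
        by (cases "x \<in> A k") auto
    qed
  qed measurable
  have iw: "integrable M (\<lambda>x. w k x powr q)" if "k \<ge> 0" for k
  proof (rule Bochner_Integration.integrable_bound[OF iu])
    show "AE x in M. norm (w k x powr q) \<le> norm (\<bar>u x\<bar> powr q)"
      using that q by (intro AE_I2) (auto simp: w_def intro!: powr_mono2)
  qed measurable
  have w_ind: "w k x = w k x * indicator (A k) x" if "x \<in> space M" for k x
    using that by (auto simp: w_def A_def indicator_def)

  define L where "L = (\<integral>x. V x powr s \<partial>M) powr (1 / s)"
  have L0: "L \<ge> 0" by (simp add: L_def)
  define \<epsilon> where "\<epsilon> k = (\<integral>x. (V x * indicator (A k) x) powr \<sigma> \<partial>M) powr (1 / \<sigma>)" for k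
  \<comment> \<open>V is localised to \<open>A k\<close> because \<open>\<epsilon> k\<close> becomes
    small for large k, so that this term can be absorbed on the left.\<close>
  have estA: "integrable M (\<lambda>x. V x * (w k x)\<^sup>2)" "(\<integral>x. V x * (w k x)\<^sup>2 \<partial>M) \<le> \<epsilon> k * (W k)\<^sup>2" if k: "k \<ge> 0" for k
  proof -
    have p2: "((w k x)\<^sup>2) powr (q / 2) = w k x powr q" for x
    proof (cases "w k x = 0")
      case False
      then have "(w k x)\<^sup>2 = w k x powr 2" using w0[of k x] by simp
      then show ?thesis by (simp add: powr_powr)
    qed (use q in simp)
    have eq: "V x * (w k x)\<^sup>2 = (V x * indicator (A k) x) * (w k x)\<^sup>2" if "x \<in> space M" for x
      using w_ind[OF that, of k] by (cases "x \<in> A k") auto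
    note h = holder_inequality_integral[of "\<lambda>x. V x * indicator (A k) x" M "\<lambda>x. (w k x)\<^sup>2" \<sigma> "q / 2"]
    have i: "integrable M (\<lambda>x. (V x * indicator (A k) x) * (w k x)\<^sup>2)"
      using \<sigma> q iVr[of \<sigma> k] iw[OF k] by (intro h(1)) (auto simp: p2 Vi)
    show "integrable M (\<lambda>x. V x * (w k x)\<^sup>2)"
      by (rule iffD2[OF Bochner_Integration.integrable_cong[OF refl] i]) (rule eq)
    have "(\<integral>x. V x * (w k x)\<^sup>2 \<partial>M) = (\<integral>x. (V x * indicator (A k) x) * (w k x)\<^sup>2 \<partial>M)"
      by (rule Bochner_Integration.integral_cong[OF refl eq])
    also have "\<dots> \<le> \<epsilon> k * (\<integral>x. ((w k x)\<^sup>2) powr (q / 2) \<partial>M) powr (1 / (q / 2))"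
      unfolding \<epsilon>_def using \<sigma> q iVr[of \<sigma> k] iw[OF k] by (intro h(2)) (auto simp: p2 Vi)
    also have "(\<integral>x. ((w k x)\<^sup>2) powr (q / 2) \<partial>M) powr (1 / (q / 2)) = (W k)\<^sup>2"
      unfolding p2 W_def using q by (simp add: powr_powr power2_eq_square powr_add[symmetric])
    finally show "(\<integral>x. V x * (w k x)\<^sup>2 \<partial>M) \<le> \<epsilon> k * (W k)\<^sup>2" .
  qed
  \<comment> \<open>Two applications of Hoelder's inequality: one separates w, the other uses the
    integrability of V beyond q', up to s, to gain a power of the measure of
    \<open>A k\<close>.\<close>
  have estB: "integrable M (\<lambda>x. V x * w k x)" "(\<integral>x. V x * w k x \<partial>M) \<le> L * measure M (A k) powr \<kappa> * W k" if k: "k \<ge> 0" for k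
  proof -
    have eq: "V x * w k x = (V x * indicator (A k) x) * w k x" if "x \<in> space M" for x
      using w_ind[OF that, of k] by (cases "x \<in> A k") auto
    note h = holder_inequality_integral[of "\<lambda>x. V x * indicator (A k) x" M "w k" q' q]
    have i: "integrable M (\<lambda>x. (V x * indicator (A k) x) * w k x)"
      using q' q s1 iVr[of q' k] iw[OF k] by (intro h(1)) (auto simp: w0 Vi)
    show "integrable M (\<lambda>x. V x * w k x)"
      by (rule iffD2[OF Bochner_Integration.integrable_cong[OF refl] i]) (rule eq)
    define r where "r = s / q'"
    have r: "r > 1" using s1 q' by (simp add: r_def)
    define r' where "r' = r / (r - 1)"
    have r': "r' > 1" "1 / r + 1 / r' = 1" using r by (auto simp: r'_def field_simps)
    have i1: "integrable M (\<lambda>x. indicator (A k) x powr r' :: real)"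
    proof (rule Bochner_Integration.integrable_bound[of _ "\<lambda>x. 1::real"])
      show "AE x in M. norm (indicator (A k) x powr r' :: real) \<le> norm (1::real)"
        by (intro AE_I2) (auto simp: indicator_def)
    qed auto
    have "(\<integral>x. (V x * indicator (A k) x) powr q' \<partial>M) = (\<integral>x. V x powr q' * indicator (A k) x \<partial>M)"
      by (intro Bochner_Integration.integral_cong) (auto simp: indicator_def)
    also have "\<dots> \<le> (\<integral>x. (V x powr q') powr r \<partial>M) powr (1 / r) * (\<integral>x. indicator (A k) x powr r' \<partial>M) powr (1 / r')"
      using r r' i1 iV q' by (intro holder_inequality_integral(2)) (auto simp: powr_powr r_def)
    also have "(\<integral>x. (V x powr q') powr r \<partial>M) = (\<integral>x. V x powr s \<partial>M)"
      using q' by (simp add: powr_powr r_def)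
    also have "(\<integral>x. indicator (A k) x powr r' \<partial>M) = (\<integral>x. indicator (A k) x \<partial>M)"
      by (intro Bochner_Integration.integral_cong) (auto simp: indicator_def)
    also have "(\<integral>x. indicator (A k) x \<partial>M) = measure M (A k)" by simp
    finally have "(\<integral>x. (V x * indicator (A k) x) powr q' \<partial>M) \<le> (\<integral>x. V x powr s \<partial>M) powr (1 / r) * measure M (A k) powr (1 / r')" .
    then have "(\<integral>x. (V x * indicator (A k) x) powr q' \<partial>M) powr (1 / q') \<le> ((\<integral>x. V x powr s \<partial>M) powr (1 / r) * measure M (A k) powr (1 / r')) powr (1 / q')"
      using q' by (intro powr_mono2) auto
    also have "\<dots> = (\<integral>x. V x powr s \<partial>M) powr (1 / r * (1 / q')) * measure M (A k) powr (1 / r' * (1 / q'))"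
      by (simp add: powr_mult powr_powr)
    also have "1 / r * (1 / q') = 1 / s" using q' by (simp add: r_def)
    also have "1 / r' * (1 / q') = \<kappa>"
    proof -
      have "1 / r' = 1 - q' / s" using r'(2) by (simp add: r_def)
      then show ?thesis using q' s1 by (simp add: \<kappa>(2) field_simps)
    qed
    finally have Vq: "(\<integral>x. (V x * indicator (A k) x) powr q' \<partial>M) powr (1 / q') \<le> L * measure M (A k) powr \<kappa>"
      by (simp add: L_def)
    have "(\<integral>x. V x * w k x \<partial>M) = (\<integral>x. (V x * indicator (A k) x) * w k x \<partial>M)"
      by (rule Bochner_Integration.integral_cong[OF refl eq])
    also have "\<dots> \<le> (\<integral>x. (V x * indicator (A k) x) powr q' \<partial>M) powr (1 / q') * W k"
      unfolding W_def using q' q s1 iVr[of q' k] iw[OF k] by (intro h(2)) (auto simp: w0 Vi)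
    also have "\<dots> \<le> L * measure M (A k) powr \<kappa> * W k" using Vq W0 by (intro mult_right_mono)
    finally show "(\<integral>x. V x * w k x \<partial>M) \<le> L * measure M (A k) powr \<kappa> * W k" .
  qed

  obtain k0 where k0: "k0 \<ge> R" "k0 \<ge> 1" "\<And>k. k \<ge> k0 \<Longrightarrow> C * \<epsilon> k \<le> 1 / 2"
  proof -
    \<comment> \<open>Tail integrals below this value give C \<epsilon> k \<le> C / (2 (C + 1))
      \<le> 1/2, also for C = 0.\<close>
    define \<epsilon>0 where "\<epsilon>0 = (1 / (2 * (C + 1))) powr \<sigma>"
    have \<epsilon>0: "\<epsilon>0 > 0" "\<epsilon>0 powr (1 / \<sigma>) = 1 / (2 * (C + 1))" using C \<sigma> by (auto simp: \<epsilon>0_def powr_powr)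
    have iV\<sigma>: "integrable M (\<lambda>x. V x powr \<sigma>)"
    proof (rule Bochner_Integration.integrable_bound[OF iV])
      show "AE x in M. norm (V x powr \<sigma>) \<le> norm (V x powr s)"
        using V \<sigma> by (intro AE_I2) (auto intro!: powr_mono)
    qed measurable
    have "eventually (\<lambda>n::nat. (\<integral>x. V x powr \<sigma> * indicator {x. \<bar>u x\<bar> > real n} x \<partial>M) < \<epsilon>0) sequentially"
      using tail_integral_tendsto_0[OF iV\<sigma>, of u] \<epsilon>0 by (intro order_tendstoD) auto
    then obtain n1 where n1: "\<And>n. n \<ge> n1 \<Longrightarrow> (\<integral>x. V x powr \<sigma> * indicator {x. \<bar>u x\<bar> > real n} x \<partial>M) < \<epsilon>0"
      unfolding eventually_sequentially by blast
    obtain n2 :: nat where n2: "max R 1 \<le> real n2" using real_arch_simple by blast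
    define n where "n = max n1 n2"
    show ?thesis
    proof (rule that[of "real n"])
      show "real n \<ge> R" "real n \<ge> 1" using n2 by (auto simp: n_def)
      fix k assume k: "k \<ge> real n"
      have "(\<integral>x. (V x * indicator (A k) x) powr \<sigma> \<partial>M) \<le> (\<integral>x. V x powr \<sigma> * indicator {x. \<bar>u x\<bar> > real n} x \<partial>M)"
      proof (rule integral_mono)
        show "integrable M (\<lambda>x. (V x * indicator (A k) x) powr \<sigma>)" using \<sigma> by (intro iVr) auto
        show "integrable M (\<lambda>x. V x powr \<sigma> * indicator {x. \<bar>u x\<bar> > real n} x)"
        proof (rule Bochner_Integration.integrable_bound[OF iV\<sigma>])
          show "AE x in M. norm (V x powr \<sigma> * indicator {x. \<bar>u x\<bar> > real n} x) \<le> norm (V x powr \<sigma>)"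
            by (intro AE_I2) (auto simp: indicator_def)
        qed measurable
        show "(V x * indicator (A k) x) powr \<sigma> \<le> V x powr \<sigma> * indicator {x. \<bar>u x\<bar> > real n} x" for x
          using k by (auto simp: indicator_def A_def)
      qed
      also have "\<dots> < \<epsilon>0" by (rule n1) (simp add: n_def)
      finally have "\<epsilon> k \<le> \<epsilon>0 powr (1 / \<sigma>)" unfolding \<epsilon>_def using \<sigma> by (intro powr_mono2) auto
      then have "C * \<epsilon> k \<le> C * (1 / (2 * (C + 1)))" using C unfolding \<epsilon>0 by (intro mult_left_mono)
      also have "\<dots> \<le> 1 / 2" using C by (simp add: field_simps)
      finally show "C * \<epsilon> k \<le> 1 / 2" .
    qed
  qed
  have W_le: "W k \<le> 2 * C * L * k * measure M (A k) powr \<kappa>" if k: "k \<ge> k0" for k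
  proof (cases "W k = 0")
    case False
    then have Wp: "W k > 0" using W0[of k] by simp
    have kp: "k \<ge> 0" "k \<ge> R" using k k0 by auto
    \<comment> \<open>Where w is nonzero, |u| = w + k. The quadratic part will be absorbed and the
      linear part carries the factor k.\<close>
    have eq: "V x * \<bar>u x\<bar> * w k x = V x * (w k x)\<^sup>2 + k * (V x * w k x)" for x
      by (cases "\<bar>u x\<bar> \<le> k") (auto simp: w_def power2_eq_square algebra_simps)
    have "(W k)\<^sup>2 = (\<integral>x. (w k x) powr q \<partial>M) powr (2 / q)"
      unfolding W_def by (simp add: power2_eq_square powr_add[symmetric])
    also have "\<dots> \<le> C * (\<integral>x. V x * \<bar>u x\<bar> * w k x \<partial>M)" using ineq[OF kp(2)] by (simp add: w_def)
    also have "(\<integral>x. V x * \<bar>u x\<bar> * w k x \<partial>M) = (\<integral>x. V x * (w k x)\<^sup>2 \<partial>M) + k * (\<integral>x. V x * w k x \<partial>M)"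
      unfolding eq using estA(1)[OF kp(1)] estB(1)[OF kp(1)] by simp
    also have "C * \<dots> \<le> C * (\<epsilon> k * (W k)\<^sup>2 + k * (L * measure M (A k) powr \<kappa> * W k))"
      using estA(2)[OF kp(1)] estB(2)[OF kp(1)] C kp by (intro mult_left_mono add_mono) auto
    also have "\<dots> = (C * \<epsilon> k) * (W k)\<^sup>2 + C * k * L * measure M (A k) powr \<kappa> * W k"
      by (simp add: algebra_simps)
    also have "\<dots> \<le> 1 / 2 * (W k)\<^sup>2 + C * k * L * measure M (A k) powr \<kappa> * W k"
      using k0(3)[OF k] by (intro add_right_mono mult_right_mono) auto
    finally have "W k * W k \<le> (2 * C * L * k * measure M (A k) powr \<kappa>) * W k"
      by (simp add: power2_eq_square mult_ac)
    then show ?thesis using Wp by simp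
  qed (use C L0 k k0 in simp)
  \<comment> \<open>Chebyshev's inequality: w at level k is at least h - k on
    \<open>A h\<close>.\<close>
  have step: "measure M (A h) \<le> (2 * C * L * k / (h - k)) powr q * measure M (A k) powr (\<kappa> * q)" if k: "k \<ge> k0" "h > k" for h k
  proof -
    have "(h - k) powr q * measure M (A h) = (\<integral>x. (h - k) powr q * indicator (A h) x \<partial>M)" by simp
    also have "\<dots> \<le> (\<integral>x. w k x powr q \<partial>M)"
    proof (rule integral_mono)
      show "integrable M (\<lambda>x. w k x powr q)" using k k0 by (intro iw) auto
      show "(h - k) powr q * indicator (A h) x \<le> w k x powr q" for x
        using k q by (auto simp: indicator_def A_def w_def intro!: powr_mono2)
    qed (simp add: emeasure_eq_measure)
    also have "\<dots> = W k powr q" unfolding W_def using q by (simp add: powr_powr)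
    also have "\<dots> \<le> (2 * C * L * k * measure M (A k) powr \<kappa>) powr q"
      using W_le[OF k(1)] W0 q by (intro powr_mono2) auto
    also have "\<dots> = (2 * C * L * k) powr q * measure M (A k) powr (\<kappa> * q)"
      using C L0 k k0 by (simp add: powr_mult powr_powr)
    finally have "(h - k) powr q * measure M (A h) \<le> (2 * C * L * k) powr q * measure M (A k) powr (\<kappa> * q)" .
    moreover have "(h - k) powr q > 0" using k by simp
    ultimately have "measure M (A h) \<le> (2 * C * L * k) powr q / (h - k) powr q * measure M (A k) powr (\<kappa> * q)"
      by (simp add: field_simps)
    then show ?thesis using k C L0 k0 by (simp add: powr_divide)
  qed
  define e where "e = \<kappa> * q - 1"
  have e: "e > 0" using \<kappa>(1) q by (simp add: e_def field_simps)
  \<comment> \<open>The number 8 comes from levels between m and 2 m with gaps m / 2^(n+1): the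
    ratio of level to gap is at most 4 * 2^n, and m cancels. Hence D and \<eta> do not depend on m,
    and m can be chosen afterwards.\<close>
  define D where "D = (8 * C * L) powr q"
  obtain \<eta> where \<eta>: "\<eta> > 0" "\<And>y :: nat \<Rightarrow> real. (\<And>n. y n \<ge> 0) \<Longrightarrow> (\<And>n. y (Suc n) \<le> D * (2 powr q) ^ n * y n powr (1 + e)) \<Longrightarrow> y 0 \<le> \<eta> \<Longrightarrow> y \<longlonglongrightarrow> 0"
  proof (rule fast_geometric_convergence[of D "2 powr q" e])
    show "D \<ge> 0" by (simp add: D_def)
    show "2 powr q > 1" using q by simp
    show "e > 0" by (rule e)
  qed blast
  obtain m where m: "m \<ge> k0" "measure M (A m) \<le> \<eta>"
  proof -
    have "eventually (\<lambda>n::nat. (\<integral>x. 1 * indicator {x. \<bar>u x\<bar> > real n} x \<partial>M) < \<eta>) sequentially"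
      using tail_integral_tendsto_0[of M "\<lambda>x. 1" u] \<eta> by (intro order_tendstoD) auto
    then obtain n1 where n1: "\<And>n. n \<ge> n1 \<Longrightarrow> (\<integral>x. 1 * indicator {x. \<bar>u x\<bar> > real n} x \<partial>M) < \<eta>"
      unfolding eventually_sequentially by blast
    obtain n2 :: nat where n2: "k0 \<le> real n2" using real_arch_simple by blast
    define n where "n = max n1 n2"
    have "measure M (A (real n)) = (\<integral>x. indicator (A (real n)) x \<partial>M)" by simp
    also have "\<dots> = (\<integral>x. 1 * indicator {x. \<bar>u x\<bar> > real n} x \<partial>M)"
      by (intro Bochner_Integration.integral_cong) (auto simp: A_def indicator_def)
    also have "\<dots> < \<eta>" by (rule n1) (simp add: n_def)
    finally show ?thesis using n2 by (intro that[of "real n"]) (auto simp: n_def)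
  qed
  have mp: "m > 0" using m k0 by auto
  \<comment> \<open>The levels increase from m towards 2 m, so the superlevel set at 2 m is
    contained in all the others and its measure is bounded by their limit.\<close>
  define l where "l n = m * (2 - (1 / 2) ^ n)" for n :: nat
  define y where "y n = measure M (A (l n))" for n
  have "y \<longlonglongrightarrow> 0"
  proof (rule \<eta>(2))
    show "y n \<ge> 0" for n by (simp add: y_def)
    show "y 0 \<le> \<eta>" using m by (simp add: y_def l_def)
    fix n
    have p: "(1 / 2 :: real) ^ n \<le> 1" "(1 / 2 :: real) ^ n > 0" by (auto intro: power_le_one)
    have ln: "l n \<ge> m" "l n \<le> 2 * m"
    proof -
      have "m * 1 \<le> m * (2 - (1 / 2) ^ n)" using p mp by (intro mult_left_mono) auto
      then show "l n \<ge> m" by (simp add: l_def)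
      have "m * (2 - (1 / 2) ^ n) \<le> m * 2" using p mp by (intro mult_left_mono) auto
      then show "l n \<le> 2 * m" by (simp add: l_def)
    qed
    have diff: "l (Suc n) - l n = m * (1 / 2) ^ Suc n" by (simp add: l_def algebra_simps)
    have lt: "l (Suc n) > l n" 
    proof -
      have "m * (1 / 2) ^ Suc n > 0" using mp by simp
      then show ?thesis using diff by linarith
    qed
    have "2 * C * L * l n / (l (Suc n) - l n) \<le> 2 * C * L * (2 * m) / (m * (1 / 2) ^ Suc n)"
      unfolding diff using ln C L0 mp by (intro divide_right_mono mult_left_mono) auto
    also have "\<dots> = 8 * C * L * 2 ^ n" using mp by (simp add: field_simps)
    finally have ratio: "2 * C * L * l n / (l (Suc n) - l n) \<le> 8 * C * L * 2 ^ n" .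
    have "y (Suc n) \<le> (2 * C * L * l n / (l (Suc n) - l n)) powr q * y n powr (\<kappa> * q)"
      unfolding y_def using ln m lt by (intro step) auto
    also have "\<dots> \<le> (8 * C * L * 2 ^ n) powr q * y n powr (\<kappa> * q)"
      using ratio ln mp lt C L0 q by (intro mult_right_mono powr_mono2) auto
    also have "(8 * C * L * 2 ^ n) powr q = D * (2 powr q) ^ n"
    proof -
      have "(2 ^ n) powr q = (2 powr q) ^ n" by (rule power_powr_commute) simp
      then show ?thesis using C L0 by (simp add: D_def powr_mult)
    qed
    also have "\<kappa> * q = 1 + e" by (simp add: e_def)
    finally show "y (Suc n) \<le> D * (2 powr q) ^ n * y n powr (1 + e)" .
  qed
  moreover have "measure M (A (2 * m)) \<le> y n" for n
  proof -
    have "m * (2 - (1 / 2) ^ n) \<le> m * 2" using mp by (intro mult_left_mono) auto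
    then have "A (2 * m) \<subseteq> A (l n)" by (auto simp: A_def l_def)
    then show ?thesis unfolding y_def by (intro finite_measure_mono) auto
  qed
  ultimately have "measure M (A (2 * m)) \<le> 0" by (intro LIMSEQ_le_const) auto
  then have "emeasure M (A (2 * m)) = 0" by (simp add: emeasure_eq_measure measure_le_0_iff)
  then have "AE x in M. x \<notin> A (2 * m)" by (intro AE_not_in) (auto simp: null_sets_def)
  then have "AE x in M. \<bar>u x\<bar> \<le> 2 * m" using AE_space by eventually_elim (auto simp: A_def)
  then show ?thesis by (rule that)
qed

section \<open>Superposition operators\<close>

text \<open>u is replaced by the largest multiple of 1/(n+1) not above it. This takes countably many
  values, so measurability at each fixed s suffices. Continuity in s carries it to the limit off a
  null set, on which all functions are set to 0.\<close>

lemma caratheodory_set_borel_measurable: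
  fixes F :: "real^'n \<Rightarrow> real \<Rightarrow> real"
  assumes F: "\<And>s. set_borel_measurable lebesgue \<Omega> (\<lambda>x. F x s)"
    and cont: "AE x in lebesgue. x \<in> \<Omega> \<longrightarrow> continuous_on UNIV (F x)"
    and u: "set_borel_measurable lebesgue \<Omega> u"
  shows "set_borel_measurable lebesgue \<Omega> (\<lambda>x. F x (u x))"
proof -
  define F1 where "F1 x s = indicator \<Omega> x *\<^sub>R F x s" for x s
  define u1 where "u1 x = indicator \<Omega> x *\<^sub>R u x" for x
  have F1 [measurable]: "(\<lambda>x. F1 x s) \<in> borel_measurable lebesgue" for s
    using F[of s] by (simp add: set_borel_measurable_def F1_def)
  have u1 [measurable]: "u1 \<in> borel_measurable lebesgue"
    using u by (simp add: set_borel_measurable_def u1_def[abs_def])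
  define d where "d n x = of_int \<lfloor>real (Suc n) * u1 x\<rfloor> / real (Suc n)" for n x
  have "(\<lambda>x. F1 x (d n x)) \<in> borel_measurable lebesgue" for n
  proof -
    have "(\<lambda>x. F1 x (of_int \<lfloor>real (Suc n) * u1 x\<rfloor> / real (Suc n))) \<in> borel_measurable lebesgue"
      by (rule measurable_compose_countable[where f="\<lambda>i x. F1 x (of_int i / real (Suc n))"]) measurable
    then show ?thesis by (simp add: d_def)
  qed
  note [measurable] = this
  have d_lim: "(\<lambda>n. d n x) \<longlonglongrightarrow> u1 x" for x
  proof (rule tendsto_sandwich[of "\<lambda>n. u1 x - 1 / real (Suc n)" _ _ "\<lambda>n. u1 x"])
    have b: "real (Suc n) * u1 x - 1 \<le> of_int \<lfloor>real (Suc n) * u1 x\<rfloor>" "of_int \<lfloor>real (Suc n) * u1 x\<rfloor> \<le> real (Suc n) * u1 x" for n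
      by linarith+
    have "u1 x - 1 / real (Suc n) \<le> d n x" for n
    proof -
      have "u1 x - 1 / real (Suc n) = (real (Suc n) * u1 x - 1) / real (Suc n)" by (simp add: diff_divide_distrib)
      also have "\<dots> \<le> d n x" unfolding d_def by (intro divide_right_mono b) simp
      finally show ?thesis .
    qed
    then show "\<forall>\<^sub>F n in sequentially. u1 x - 1 / real (Suc n) \<le> d n x" by simp
    have "d n x \<le> real (Suc n) * u1 x / real (Suc n)" for n
      unfolding d_def by (intro divide_right_mono b) simp
    then show "\<forall>\<^sub>F n in sequentially. d n x \<le> u1 x" by simp
    have "(\<lambda>n. u1 x - 1 / real (Suc n)) \<longlonglongrightarrow> u1 x - 0"
      by (intro tendsto_diff tendsto_const LIMSEQ_Suc[OF lim_1_over_n])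
    then show "(\<lambda>n. u1 x - 1 / real (Suc n)) \<longlonglongrightarrow> u1 x" by simp
  qed simp
  obtain E where E: "E \<in> null_sets lebesgue" "\<And>x. x \<notin> E \<Longrightarrow> x \<in> \<Omega> \<longrightarrow> continuous_on UNIV (F x)"
    using cont unfolding completion.AE_iff_null_sets by auto
  have [measurable]: "E \<in> sets lebesgue" using E(1) by auto
  define h where "h x = (if x \<in> E then 0 else F1 x (u1 x))" for x
  have "h \<in> borel_measurable lebesgue"
  proof (rule borel_measurable_LIMSEQ_metric)
    show "(\<lambda>x. if x \<in> E then 0 else F1 x (d n x)) \<in> borel_measurable lebesgue" for n by measurable
    show "(\<lambda>n. if x \<in> E then 0 else F1 x (d n x)) \<longlonglongrightarrow> h x" for x
    proof (cases "x \<in> E")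
      case False
      have "isCont (F1 x) (u1 x)"
      proof (cases "x \<in> \<Omega>")
        case True
        then have "continuous_on UNIV (F x)" using E(2)[OF False] by simp
        then show ?thesis using True by (simp add: F1_def[abs_def] continuous_on_eq_continuous_at)
      qed (simp add: F1_def[abs_def])
      then have "(\<lambda>n. F1 x (d n x)) \<longlonglongrightarrow> F1 x (u1 x)" using d_lim by (rule isCont_tendsto_compose)
      then show ?thesis using False by (simp add: h_def)
    qed (simp add: h_def)
  qed
  moreover have "AE x in lebesgue. h x = indicator \<Omega> x *\<^sub>R F x (u x)"
  proof -
    have "AE x in lebesgue. x \<notin> E" using E(1) by (rule AE_not_in)
    then show ?thesis by eventually_elim (simp add: h_def F1_def u1_def indicator_def)
  qed
  ultimately show ?thesis unfolding set_borel_measurable_def by (rule borel_measurable_AE)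
qed

text \<open>A limit of difference quotients with step 1/(n+1), outside a null set. In this way the
  measurability of the entries of \<open>DA\<close> is inherited from those of
  \<open>A\<close>.\<close>

lemma set_borel_measurable_deriv:
  fixes F DF :: "real^'n \<Rightarrow> real \<Rightarrow> real"
  assumes F: "\<And>s. set_borel_measurable lebesgue \<Omega> (\<lambda>x. F x s)"
    and deriv: "AE x in lebesgue. x \<in> \<Omega> \<longrightarrow> (\<forall>s. (F x has_real_derivative DF x s) (at s))"
  shows "set_borel_measurable lebesgue \<Omega> (\<lambda>x. DF x s)"
proof -
  define F1 where "F1 x s = indicator \<Omega> x *\<^sub>R F x s" for x s
  have F1 [measurable]: "(\<lambda>x. F1 x s) \<in> borel_measurable lebesgue" for s
    using F[of s] by (simp add: set_borel_measurable_def F1_def)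
  obtain E where E: "E \<in> null_sets lebesgue" "\<And>x. x \<notin> E \<Longrightarrow> x \<in> \<Omega> \<longrightarrow> (\<forall>s. (F x has_real_derivative DF x s) (at s))"
    using deriv unfolding completion.AE_iff_null_sets by auto
  have [measurable]: "E \<in> sets lebesgue" using E(1) by auto
  define q where "q n x = (F1 x (s + 1 / real (Suc n)) - F1 x s) / (1 / real (Suc n))" for n x
  have [measurable]: "q n \<in> borel_measurable lebesgue" for n unfolding q_def by measurable
  define h where "h x = (if x \<in> E then 0 else indicator \<Omega> x *\<^sub>R DF x s)" for x
  have "h \<in> borel_measurable lebesgue"
  proof (rule borel_measurable_LIMSEQ_metric)
    show "(\<lambda>x. if x \<in> E then 0 else q n x) \<in> borel_measurable lebesgue" for n by measurable
    show "(\<lambda>n. if x \<in> E then 0 else q n x) \<longlonglongrightarrow> h x" for x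
    proof (cases "x \<in> E \<or> x \<notin> \<Omega>")
      case True
      then show ?thesis by (auto simp: h_def q_def F1_def)
    next
      case False
      then have "((\<lambda>t. (F x (s + t) - F x s) / t) \<longlongrightarrow> DF x s) (at 0)" using E(2)[of x] by (simp add: DERIV_def)
      moreover have "filterlim (\<lambda>n. 1 / real (Suc n)) (at 0) sequentially"
        unfolding filterlim_at using LIMSEQ_Suc[OF lim_1_over_n] by simp
      ultimately have "(\<lambda>n. (F x (s + 1 / real (Suc n)) - F x s) / (1 / real (Suc n))) \<longlonglongrightarrow> DF x s"
        by (rule filterlim_compose)
      then show ?thesis using False by (simp add: h_def q_def F1_def)
    qed
  qed
  moreover have "AE x in lebesgue. h x = indicator \<Omega> x *\<^sub>R DF x s"
  proof -
    have "AE x in lebesgue. x \<notin> E" using E(1) by (rule AE_not_in)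
    then show ?thesis by eventually_elim (simp add: h_def)
  qed
  ultimately show ?thesis unfolding set_borel_measurable_def by (rule borel_measurable_AE)
qed

section \<open>Smooth truncations\<close>

lemma isCont_flat: "isCont (flat P) t"
  using DERIV_flat by (rule DERIV_isCont)

text \<open>The factor \<open>exp (- 1 / (n t))\<close> smooths the corner of the positive part at 0 with slope
  \<open>(1 + y) exp (- y) \<le> 1\<close> for \<open>y = 1 / (n t)\<close>; the outer function saturates at \<open>n\<close>.\<close>

lemma smooth_truncation_one_sided:
  fixes n :: real
  assumes n: "n > 0"
  defines "\<psi> \<equiv> \<lambda>t. t * flat 1 (n * t)"
  defines "\<psi>' \<equiv> \<lambda>t. flat 1 (n * t) + t * (flat (monom 1 2) (n * t) * n)"
  defines "P \<equiv> \<lambda>t. n * (1 - exp (- (\<psi> t / n)))"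
  defines "P' \<equiv> \<lambda>t. exp (- (\<psi> t / n)) * \<psi>' t"
  shows "smooth_fun w \<Longrightarrow> smooth_fun (\<lambda>x. P (w x))"
    and "(P has_real_derivative P' t) (at t)" and "isCont P' t"
    and "0 \<le> P' t" "P' t \<le> 1" "0 \<le> P t" "P t \<le> n" "P t \<le> max 0 t" "t \<le> 0 \<Longrightarrow> P t = 0" "t \<le> 0 \<Longrightarrow> P' t = 0"
proof -
  have \<psi>: "0 \<le> \<psi> t" "\<psi> t \<le> max 0 t" for t
    using n by (auto simp: \<psi>_def flat_def zero_less_mult_iff mult_left_le max_def)
  have \<psi>': "0 \<le> \<psi>' t" "\<psi>' t \<le> 1" for t
  proof -
    have eq: "\<psi>' t = (1 + 1 / (n * t)) * exp (- (1 / (n * t)))" if "t > 0"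
      using that n by (simp add: \<psi>'_def flat_def poly_monom power2_eq_square algebra_simps add_divide_distrib)
    show "0 \<le> \<psi>' t" "\<psi>' t \<le> 1"
    proof -
      show "0 \<le> \<psi>' t"
        using eq n by (cases "t > 0") (auto simp: \<psi>'_def flat_nonpos mult_nonneg_nonpos)
      show "\<psi>' t \<le> 1"
      proof (cases "t > 0")
        case True
        have "1 + 1 / (n * t) \<le> exp (1 / (n * t))" by (rule exp_ge_add_one_self)
        then have "(1 + 1 / (n * t)) * exp (- (1 / (n * t))) \<le> exp (1 / (n * t)) * exp (- (1 / (n * t)))"
          by (intro mult_right_mono) auto
        then show ?thesis using eq[OF True] by (simp add: exp_minus_inverse)
      next
        case False
        then show ?thesis using n by (auto simp: \<psi>'_def flat_nonpos mult_nonneg_nonpos)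
      qed
    qed
  qed
  have \<psi>0: "\<psi> t = 0" "\<psi>' t = 0" if "t \<le> 0" for t
    using that n by (auto simp: \<psi>_def \<psi>'_def flat_nonpos mult_nonneg_nonpos)
  have d\<psi>: "(\<psi> has_real_derivative \<psi>' t) (at t)" for t
  proof -
    have nt: "((\<lambda>t. n * t) has_real_derivative n) (at t)" by (auto intro!: derivative_eq_intros)
    have f: "(flat 1 has_real_derivative flat (monom 1 2) (n * t)) (at (n * t))"
      using DERIV_flat[of 1 "n * t"] by simp
    have "((\<lambda>t. flat 1 (n * t)) has_real_derivative flat (monom 1 2) (n * t) * n) (at t)"
      by (rule DERIV_chain2[OF f nt])
    from DERIV_mult[OF DERIV_ident this] show ?thesis
      unfolding \<psi>_def \<psi>'_def by (simp add: algebra_simps)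
  qed
  show "smooth_fun (\<lambda>x. P (w x))" if w: "smooth_fun w"
  proof -
    have s\<psi>: "smooth_fun (\<lambda>x. (1 / n) * \<psi> (w x))"
      unfolding \<psi>_def by (intro smooth_fun_mult smooth_fun_const smooth_fun_flat w)
    have "smooth_fun (\<lambda>x. n * (1 - exp (- ((1 / n) * \<psi> (w x)))))"
      by (intro smooth_fun_mult smooth_fun_diff smooth_fun_const smooth_fun_exp smooth_fun_minus s\<psi>)
    then show ?thesis by (simp add: P_def)
  qed
  show "(P has_real_derivative P' t) (at t)"
  proof -
    have e: "((\<lambda>t. exp (- (\<psi> t / n))) has_real_derivative exp (- (\<psi> t / n)) * - (\<psi>' t / n)) (at t)"
      by (rule DERIV_chain2[OF DERIV_exp DERIV_minus[OF DERIV_cdivide[OF d\<psi>]]])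
    have "((\<lambda>t. n * (1 - exp (- (\<psi> t / n)))) has_real_derivative n * (0 - exp (- (\<psi> t / n)) * - (\<psi>' t / n))) (at t)"
      by (rule DERIV_cmult[OF DERIV_diff[OF DERIV_const e]])
    moreover have "n * (0 - exp (- (\<psi> t / n)) * - (\<psi>' t / n)) = P' t" using n by (simp add: P'_def)
    ultimately show ?thesis by (simp only: P_def)
  qed
  have c: "isCont (\<lambda>t. flat Q (n * t)) t" for Q t
    by (rule isCont_o2[OF _ isCont_flat]) simp
  show "isCont P' t"
    unfolding P'_def \<psi>'_def \<psi>_def using n by (intro continuous_intros c) auto
  show "0 \<le> P' t" unfolding P'_def using \<psi>' by simp
  show "P' t \<le> 1" unfolding P'_def using \<psi>' \<psi> n by (intro mult_le_one) auto
  show "0 \<le> P t" "P t \<le> n" unfolding P_def using \<psi> n by (auto simp: mult_le_cancel_left1)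
  \<comment> \<open>The saturation only lowers the inner function, which in turn is at most the
    positive part of t.\<close>
  have "1 - exp (- (\<psi> t / n)) \<le> \<psi> t / n" using exp_ge_add_one_self[of "- (\<psi> t / n)"] by linarith
  then have "P t \<le> n * (\<psi> t / n)" unfolding P_def using n by (intro mult_left_mono) auto
  then show "P t \<le> max 0 t" using \<psi>(2)[of t] n by simp
  show "P t = 0" "P' t = 0" if "t \<le> 0" using \<psi>0[OF that] by (auto simp: P_def P'_def)
qed

text \<open>For t > 0 let n = i + 1 and let y be the inner value, which tends to t while y/n tends
  to 0 through positive numbers. Then n (1 - exp(-y/n)) is -y times the difference quotient of
  exp(-x) at 0 with step y/n, and that quotient tends to -1.\<close>

lemma smooth_truncation_one_sided_tendsto:
  "(\<lambda>i. real (Suc i) * (1 - exp (- (t * flat 1 (real (Suc i) * t) / real (Suc i))))) \<longlonglongrightarrow> max 0 t"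
proof (cases "t > 0")
  case True
  have inv: "(\<lambda>i. 1 / real (Suc i)) \<longlonglongrightarrow> 0" by (rule LIMSEQ_Suc[OF lim_1_over_n])
  define y where "y i = t * exp (- (1 / t * (1 / real (Suc i))))" for i
  have "y \<longlonglongrightarrow> t * exp (- (1 / t * 0))"
    unfolding y_def by (intro tendsto_intros inv)
  then have y: "y \<longlonglongrightarrow> t" by simp
  have y0: "y i > 0" for i using True by (simp add: y_def)
  have "(\<lambda>i. y i * (1 / real (Suc i))) \<longlonglongrightarrow> t * 0" by (intro tendsto_mult y inv)
  then have x: "(\<lambda>i. y i / real (Suc i)) \<longlonglongrightarrow> 0" by simp
  have "((\<lambda>x. (exp (- x) - 1) / x) \<longlongrightarrow> - 1) (at (0::real))"
  proof -
    have "((\<lambda>x. exp (- x)) has_real_derivative - 1) (at 0)" by (auto intro!: derivative_eq_intros)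
    then show ?thesis by (simp add: DERIV_def)
  qed
  moreover have "filterlim (\<lambda>i. y i / real (Suc i)) (at 0) sequentially"
    unfolding filterlim_at using x y0 by (auto simp: less_imp_neq[THEN not_sym])
  ultimately have "(\<lambda>i. (exp (- (y i / real (Suc i))) - 1) / (y i / real (Suc i))) \<longlonglongrightarrow> - 1"
    by (rule filterlim_compose)
  then have "(\<lambda>i. - (y i * ((exp (- (y i / real (Suc i))) - 1) / (y i / real (Suc i))))) \<longlonglongrightarrow> - (t * - 1)"
    by (intro tendsto_minus tendsto_mult y)
  moreover have "- (y i * ((exp (- (y i / real (Suc i))) - 1) / (y i / real (Suc i))))
      = real (Suc i) * (1 - exp (- (t * flat 1 (real (Suc i) * t) / real (Suc i))))" for i
  proof -
    have A: "t * flat 1 (real (Suc i) * t) = y i"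
      using True by (simp add: flat_def y_def zero_less_mult_iff mult.commute)
    have B: "- (a * ((e - 1) / (a / m))) = m * (1 - e)" if "a \<noteq> 0" "m \<noteq> 0" for a e m :: real
      using that by (simp add: field_simps)
    show ?thesis unfolding A by (rule B) (use y0[of i] in auto)
  qed
  ultimately show ?thesis using True by (simp add: max_def)
next
  case False
  then have "flat 1 (real (Suc i) * t) = 0" for i by (intro flat_nonpos mult_nonneg_nonpos) auto
  then show ?thesis using False by (simp add: max_def)
qed

text \<open>The one-sided truncation of t - k minus that of -t - k. As k \<ge> 0, at most one of the
  two is nonzero at any t, so the absolute value and the derivative reduce to a single one-sided
  piece. The bounds \<open>K n\<close> allow products with functions that are merely
  integrable.\<close>

lemma smooth_truncation_sequence:
  fixes k :: real
  assumes k: "k \<ge> 0"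
  obtains \<phi> \<phi>' :: "nat \<Rightarrow> real \<Rightarrow> real" and K :: "nat \<Rightarrow> real" where
    "\<And>n w. smooth_fun w \<Longrightarrow> smooth_fun (\<lambda>x::real^'n. \<phi> n (w x))"
    "\<And>n t. (\<phi> n has_real_derivative \<phi>' n t) (at t)" "\<And>n t. isCont (\<phi>' n) t"
    "\<And>n t. 0 \<le> \<phi>' n t" "\<And>n t. \<phi>' n t \<le> 1" "\<And>n t. \<bar>\<phi> n t\<bar> \<le> K n" "\<And>n t. \<bar>\<phi> n t\<bar> \<le> max 0 (\<bar>t\<bar> - k)"
    "\<And>n t. 0 \<le> t * \<phi> n t" "\<And>t. (\<lambda>n. \<bar>\<phi> n t\<bar>) \<longlonglongrightarrow> max 0 (\<bar>t\<bar> - k)"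
proof -
  define \<psi> where "\<psi> n t = t * flat 1 (n * t)" for n t :: real
  define \<psi>' where "\<psi>' n t = flat 1 (n * t) + t * (flat (monom 1 2) (n * t) * n)" for n t :: real
  define P where "P n t = n * (1 - exp (- (\<psi> n t / n)))" for n t
  define P' where "P' n t = exp (- (\<psi> n t / n)) * \<psi>' n t" for n t
  note P = smooth_truncation_one_sided[folded \<psi>_def \<psi>'_def, folded P_def P'_def]
  define \<phi> where "\<phi> i t = P (real (Suc i)) (t - k) - P (real (Suc i)) (- t - k)" for i t
  define \<phi>' where "\<phi>' i t = P' (real (Suc i)) (t - k) + P' (real (Suc i)) (- t - k)" for i t
  have abs_\<phi>: "\<bar>\<phi> i t\<bar> = P (real (Suc i)) (\<bar>t\<bar> - k)" for i t
    using P(9)[of "real (Suc i)" "t - k"] P(9)[of "real (Suc i)" "- t - k"] P(6)[of "real (Suc i)"] k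
    by (cases "t \<ge> 0") (auto simp: \<phi>_def)
  show ?thesis
  proof (rule that[of \<phi> \<phi>' "\<lambda>i. real (Suc i)"])
    fix i t
    have n: "real (Suc i) > 0" by simp
    show "smooth_fun (\<lambda>x::real^'n. \<phi> i (w x))" if w: "smooth_fun w" for w
      unfolding \<phi>_def
      by (intro smooth_fun_diff P(1)[OF n] smooth_fun_minus smooth_fun_const w)
    have d1: "((\<lambda>t. t - k) has_real_derivative 1) (at t)" by (auto intro!: derivative_eq_intros)
    have d2: "((\<lambda>t. - t - k) has_real_derivative - 1) (at t)" by (auto intro!: derivative_eq_intros)
    have "((\<lambda>t. P (real (Suc i)) (t - k) - P (real (Suc i)) (- t - k)) has_real_derivative
        P' (real (Suc i)) (t - k) * 1 - P' (real (Suc i)) (- t - k) * - 1) (at t)"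
      by (rule DERIV_diff[OF DERIV_chain2[OF P(2)[OF n] d1] DERIV_chain2[OF P(2)[OF n] d2]])
    then show "(\<phi> i has_real_derivative \<phi>' i t) (at t)" by (simp add: \<phi>_def[abs_def] \<phi>'_def)
    show "isCont (\<phi>' i) t"
      unfolding \<phi>'_def by (intro continuous_add isCont_o2[OF _ P(3)[OF n]]) (auto intro!: continuous_intros)
    show "0 \<le> \<phi>' i t" unfolding \<phi>'_def using P(4)[OF n] by (intro add_nonneg_nonneg)
    show "\<phi>' i t \<le> 1"
      unfolding \<phi>'_def using P(5)[OF n, of "t - k"] P(5)[OF n, of "- t - k"] P(10)[OF n, of "t - k"] P(10)[OF n, of "- t - k"] k
      by (cases "t \<ge> 0") auto
    show "\<bar>\<phi> i t\<bar> \<le> real (Suc i)" unfolding abs_\<phi> by (rule P(7)[OF n])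
    show "\<bar>\<phi> i t\<bar> \<le> max 0 (\<bar>t\<bar> - k)" unfolding abs_\<phi> by (rule P(8)[OF n])
    show "0 \<le> t * \<phi> i t"
      using P(6)[OF n, of "t - k"] P(6)[OF n, of "- t - k"] P(9)[OF n, of "t - k"] P(9)[OF n, of "- t - k"] k
      by (cases "t \<ge> 0") (auto simp: \<phi>_def mult_nonpos_nonneg)
  next
    fix t
    show "(\<lambda>n. \<bar>\<phi> n t\<bar>) \<longlonglongrightarrow> max 0 (\<bar>t\<bar> - k)"
      unfolding abs_\<phi> P_def \<psi>_def by (rule smooth_truncation_one_sided_tendsto)
  qed
qed

section \<open>Truncations of weak solutions as test functions\<close>

lemma borel_measurable_lebesgue_on_of_borel:
  fixes f :: "'a::euclidean_space \<Rightarrow> 'b::topological_space"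
  assumes "f \<in> borel_measurable borel"
  shows "f \<in> borel_measurable (lebesgue_on \<Omega>)"
  using assms by (intro measurable_restrict_space1 measurable_completion) simp

lemma set_borel_measurable_iff_lebesgue_on:
  fixes f :: "real^'n \<Rightarrow> real"
  assumes "\<Omega> \<in> sets lebesgue"
  shows "set_borel_measurable lebesgue \<Omega> f \<longleftrightarrow> f \<in> borel_measurable (lebesgue_on \<Omega>)"
  using assms unfolding set_borel_measurable_def
  by (subst borel_measurable_restrict_space_iff) (auto simp: ac_simps)

lemma set_integrable_iff_lebesgue_on:
  fixes f :: "real^'n \<Rightarrow> real"
  assumes "\<Omega> \<in> sets lebesgue"
  shows "set_integrable lebesgue \<Omega> f \<longleftrightarrow> integrable (lebesgue_on \<Omega>) f"
  using assms unfolding set_integrable_def by (subst integrable_restrict_space) auto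

lemma set_integral_eq_lebesgue_on:
  fixes f :: "real^'n \<Rightarrow> real"
  assumes "\<Omega> \<in> sets lebesgue"
  shows "(LINT x:\<Omega>|lebesgue. f x) = (\<integral>x. f x \<partial>(lebesgue_on \<Omega>))"
  using assms unfolding set_lebesgue_integral_def by (subst integral_restrict_space) auto

lemma set_integral_lborel_eq_lebesgue_on:
  fixes f :: "real^'n \<Rightarrow> real"
  assumes "\<Omega> \<in> sets borel" "f \<in> borel_measurable borel"
  shows "(LINT x:\<Omega>|lborel. f x) = (\<integral>x. f x \<partial>(lebesgue_on \<Omega>))"
proof -
  have "(LINT x:\<Omega>|lebesgue. f x) = (LINT x:\<Omega>|lborel. f x)"
    unfolding set_lebesgue_integral_def using assms by (intro integral_completion) simp
  then show ?thesis using set_integral_eq_lebesgue_on[of \<Omega> f] assms by simp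
qed

lemma AE_lebesgue_on_iff:
  "\<Omega> \<in> sets lebesgue \<Longrightarrow> (AE x in lebesgue_on \<Omega>. P x) \<longleftrightarrow> (AE x in lebesgue. x \<in> \<Omega> \<longrightarrow> P x)"
  by (subst AE_restrict_space_iff) auto

text \<open>The mollification estimates use Fubini's theorem and translations for Borel functions on
  the whole space, whereas the data are Lebesgue measurable on \<Omega>; this lemma mediates between
  the two.\<close>

lemma lebesgue_set_borel_representative:
  fixes f :: "real^'n \<Rightarrow> real"
  assumes [measurable]: "\<Omega> \<in> sets borel" and f: "set_borel_measurable lebesgue \<Omega> f"
  obtains g where "g \<in> borel_measurable borel" "\<And>x. x \<notin> \<Omega> \<Longrightarrow> g x = 0"
    "AE x in lebesgue. g x = indicator \<Omega> x *\<^sub>R f x"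
proof -
  obtain h where h: "h \<in> borel_measurable lborel" "AE x in lborel. indicator \<Omega> x *\<^sub>R f x = h x"
    using completion_ex_borel_measurable_real f unfolding set_borel_measurable_def by blast
  have [measurable]: "h \<in> borel_measurable borel" using h(1) by simp
  show ?thesis
  proof (rule that[of "\<lambda>x. indicator \<Omega> x * h x"])
    show "AE x in lebesgue. indicator \<Omega> x * h x = indicator \<Omega> x *\<^sub>R f x"
      using AE_completion[OF h(2)] by eventually_elim (auto simp: indicator_def split: if_splits)
  qed auto
qed

lemma nn_integral_square_representative:
  fixes f g :: "real^'n \<Rightarrow> real"
  assumes [measurable]: "g \<in> borel_measurable borel"
    and g: "AE x in lebesgue. g x = indicator \<Omega> x *\<^sub>R f x" and f: "in_Lp 2 \<Omega> f"
  shows "(\<integral>\<^sup>+x. ennreal ((g x)\<^sup>2) \<partial>lborel) < \<infinity>"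
proof -
  have i: "integrable lebesgue (\<lambda>x. indicator \<Omega> x *\<^sub>R (\<bar>f x\<bar> powr 2))"
    using f by (simp add: in_Lp_def set_integrable_def)
  have "(\<integral>\<^sup>+x. ennreal ((g x)\<^sup>2) \<partial>lborel) = (\<integral>\<^sup>+x. ennreal ((g x)\<^sup>2) \<partial>lebesgue)"
    by (simp add: nn_integral_completion)
  also have "\<dots> = (\<integral>\<^sup>+x. ennreal (norm (indicator \<Omega> x *\<^sub>R (\<bar>f x\<bar> powr 2))) \<partial>lebesgue)"
    by (intro nn_integral_cong_AE, use g in eventually_elim) (auto simp: indicator_def)
  also have "\<dots> < \<infinity>" using i by (simp add: integrable_iff_bounded)
  finally show ?thesis .
qed

text \<open>The density result is applied to Borel representatives of u and of each component of Du.
  They inherit the weak derivative identity because its integrals do not change, and the conclusion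
  returns to u and Du almost everywhere.\<close>

lemma H1_dominated_approximation:
  fixes u :: "real^'n \<Rightarrow> real"
  assumes \<Omega>: "lipschitz_domain \<Omega>" "bounded \<Omega>" and H1: "H1_with_grad \<Omega> u Du"
  obtains w G W where "\<And>n::nat. smooth_fun (w n)" "\<And>n. has_grad (w n) (G n)"
    "integrable (lebesgue_on \<Omega>) W"
    "AE x in lebesgue_on \<Omega>. (\<lambda>n. w n x) \<longlonglongrightarrow> u x \<and> (\<lambda>n. G n x) \<longlonglongrightarrow> Du x
       \<and> (\<forall>n. (w n x)\<^sup>2 + (norm (G n x))\<^sup>2 \<le> W x)"
proof -
  have op: "open \<Omega>" using \<Omega>(1) by (simp add: lipschitz_domain_def)
  then have [measurable]: "\<Omega> \<in> sets borel" by simp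
  have \<Omega>L: "\<Omega> \<in> sets lebesgue" using op by simp
  have uL: "in_Lp 2 \<Omega> u" and DL: "\<And>i. in_Lp 2 \<Omega> (\<lambda>x. Du x $ i)" and wg: "weak_gradient \<Omega> u Du"
    using H1 by (auto simp: H1_with_grad_def)
  obtain u' where u' [measurable]: "u' \<in> borel_measurable borel" and u'0: "\<And>x. x \<notin> \<Omega> \<Longrightarrow> u' x = 0"
    and u'ae: "AE x in lebesgue. u' x = indicator \<Omega> x *\<^sub>R u x"
    using lebesgue_set_borel_representative[of \<Omega> u] uL by (auto simp: in_Lp_def)
  define Q where "Q i d \<longleftrightarrow> d \<in> borel_measurable borel \<and> (\<forall>x. x \<notin> \<Omega> \<longrightarrow> d x = 0) \<and>
    (AE x in lebesgue. d x = indicator \<Omega> x *\<^sub>R (Du x $ i))" for i d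
  have "\<exists>d. Q i d" for i
    using lebesgue_set_borel_representative[of \<Omega> "\<lambda>x. Du x $ i"] DL[of i] unfolding Q_def in_Lp_def
    by (metis \<open>\<Omega> \<in> sets borel\<close>)
  then obtain d where "\<And>i. Q i (d i)" by metis
  then have d [measurable]: "\<And>i. d i \<in> borel_measurable borel" and d0: "\<And>i x. x \<notin> \<Omega> \<Longrightarrow> d i x = 0"
    and dae: "\<And>i. AE x in lebesgue. d i x = indicator \<Omega> x *\<^sub>R (Du x $ i)"
    unfolding Q_def by blast+
  define D where "D x = (\<Sum>i\<in>UNIV. d i x *\<^sub>R axis i (1::real))" for x
  have [measurable]: "D \<in> borel_measurable borel" unfolding D_def by measurable
  have D_nth: "D x $ i = d i x" for x i
    by (simp add: D_def axis_def if_distrib[of "\<lambda>y. _ * y"] cong: if_cong)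
  have D0: "D x = 0" if "x \<notin> \<Omega>" for x using d0[OF that] by (simp add: D_def)
  have u2: "(\<integral>\<^sup>+x. ennreal ((u' x)\<^sup>2) \<partial>lborel) < \<infinity>"
    by (rule nn_integral_square_representative[OF u' u'ae uL])
  have D2: "(\<integral>\<^sup>+x. ennreal ((D x $ i)\<^sup>2) \<partial>lborel) < \<infinity>" for i
    unfolding D_nth by (rule nn_integral_square_representative[OF d dae DL])
  have transfer: "(\<integral>x. f' x * h x \<partial>lborel) = (LINT x:\<Omega>|lebesgue. f x * h x)"
    if f': "f' \<in> borel_measurable borel" "AE x in lebesgue. f' x = indicator \<Omega> x *\<^sub>R f x" and f: "in_Lp 2 \<Omega> f"
      and h: "continuous_on UNIV h" for f f' h :: "real^'n \<Rightarrow> real"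
  proof -
    have [measurable]: "f' \<in> borel_measurable borel" by fact
    have [measurable]: "h \<in> borel_measurable borel" using h by (rule borel_measurable_continuous_onI)
    have hL: "h \<in> borel_measurable lebesgue" by (rule measurable_completion) simp
    have m1: "(\<lambda>x. f' x * h x) \<in> borel_measurable lborel" by measurable
    have fm: "(\<lambda>x. indicator \<Omega> x *\<^sub>R f x) \<in> borel_measurable lebesgue"
      using f by (simp add: in_Lp_def set_borel_measurable_def)
    have "(\<lambda>x. (indicator \<Omega> x *\<^sub>R f x) * h x) \<in> borel_measurable lebesgue"
      by (intro borel_measurable_times fm hL)
    then have m2: "(\<lambda>x. indicator \<Omega> x *\<^sub>R (f x * h x)) \<in> borel_measurable lebesgue"
      by (simp add: mult.assoc)
    have "(\<integral>x. f' x * h x \<partial>lborel) = (\<integral>x. f' x * h x \<partial>lebesgue)"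
      by (rule integral_completion[OF m1, symmetric])
    also have "\<dots> = (\<integral>x. indicator \<Omega> x *\<^sub>R (f x * h x) \<partial>lebesgue)"
      by (rule integral_cong_AE[OF measurable_completion[OF m1] m2], use f'(2) in eventually_elim)
        (simp add: mult.assoc)
    finally show ?thesis by (simp add: set_lebesgue_integral_def)
  qed
  have weak: "(\<integral>x. u' x * (g x $ i) \<partial>lborel) = - (\<integral>x. (D x $ i) * \<phi> x \<partial>lborel)"
    if "smooth_fun \<phi>" "has_grad \<phi> g" "compact (closure {x. \<phi> x \<noteq> 0})" "closure {x. \<phi> x \<noteq> 0} \<subseteq> \<Omega>" for \<phi> g i
  proof -
    have c: "continuous_on UNIV \<phi>" "continuous_on UNIV (\<lambda>x. g x $ i)"
      using that(1,2) by (auto intro: smooth_fun_continuous_on smooth_fun_grad_component)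
    have "(\<integral>x. u' x * (g x $ i) \<partial>lborel) = (LINT x:\<Omega>|lebesgue. u x * g x $ i)"
      by (rule transfer[OF u' u'ae uL c(2)])
    also have "\<dots> = - (LINT x:\<Omega>|lebesgue. Du x $ i * \<phi> x)"
      using wg that unfolding weak_gradient_def by blast
    also have "(LINT x:\<Omega>|lebesgue. Du x $ i * \<phi> x) = (\<integral>x. (D x $ i) * \<phi> x \<partial>lborel)"
      unfolding D_nth by (rule transfer[OF d dae DL c(1), symmetric])
    finally show ?thesis .
  qed
  have "H1_approximable \<Omega> u' D"
    by (rule H1_approximable_lipschitz_domain[OF \<Omega> _ _ u'0 D0 u2 D2 weak]) auto
  then obtain w G W where w: "\<And>n::nat. smooth_fun (w n)" "\<And>n. has_grad (w n) (G n)"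
    and W: "W \<in> borel_measurable borel" "\<And>x. W x \<ge> 0" "integrable lborel W"
    and ae: "AE x in lborel. x \<in> \<Omega> \<longrightarrow> (\<lambda>n. w n x) \<longlonglongrightarrow> u' x \<and> (\<lambda>n. G n x) \<longlonglongrightarrow> D x
       \<and> (\<forall>n. (w n x)\<^sup>2 + (norm (G n x))\<^sup>2 \<le> W x)"
    using H1_approximable_dominated_sequence[of \<Omega> u' D] u2 D2 by auto
  show ?thesis
  proof (rule that[OF w])
    have "integrable lebesgue W" using W by (simp add: integrable_completion)
    then have "integrable lebesgue (\<lambda>x. indicator \<Omega> x *\<^sub>R W x)" by (rule integrable_mult_indicator[OF \<Omega>L])
    then show "integrable (lebesgue_on \<Omega>) W"
      using set_integrable_iff_lebesgue_on[OF \<Omega>L] by (simp add: set_integrable_def)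
    have "AE x in lebesgue. \<forall>i. d i x = indicator \<Omega> x *\<^sub>R (Du x $ i)"
      using dae by (simp add: AE_all_countable)
    then have "AE x in lebesgue. x \<in> \<Omega> \<longrightarrow> ((\<lambda>n. w n x) \<longlonglongrightarrow> u x \<and> (\<lambda>n. G n x) \<longlonglongrightarrow> Du x
       \<and> (\<forall>n. (w n x)\<^sup>2 + (norm (G n x))\<^sup>2 \<le> W x))"
      using AE_completion[OF ae] u'ae
    proof eventually_elim
      case (elim x)
      show ?case
      proof
        assume x: "x \<in> \<Omega>"
        then have "u' x = u x" "D x = Du x" using elim by (auto simp: vec_eq_iff D_nth)
        then show "(\<lambda>n. w n x) \<longlonglongrightarrow> u x \<and> (\<lambda>n. G n x) \<longlonglongrightarrow> Du x
           \<and> (\<forall>n. (w n x)\<^sup>2 + (norm (G n x))\<^sup>2 \<le> W x)" using elim x by auto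
      qed
    qed
    then show "AE x in lebesgue_on \<Omega>. (\<lambda>n. w n x) \<longlonglongrightarrow> u x \<and> (\<lambda>n. G n x) \<longlonglongrightarrow> Du x
       \<and> (\<forall>n. (w n x)\<^sup>2 + (norm (G n x))\<^sup>2 \<le> W x)"
      by (rule iffD2[OF AE_lebesgue_on_iff[OF \<Omega>L]])
  qed
qed

text \<open>Composing the smooth approximations with \<open>\<phi>\<close> makes \<open>\<phi> \<circ> u\<close> admissible without a chain rule
  for weak derivatives.\<close>

lemma weak_formulation_composition:
  fixes u :: "real^'n \<Rightarrow> real" and a :: "real^'n \<Rightarrow> real^'n"
  assumes w: "\<And>n::nat. smooth_fun (w n)" "\<And>n. has_grad (w n) (G n)"
    and W: "integrable (lebesgue_on \<Omega>) W"
    and ae: "AE x in lebesgue_on \<Omega>. (\<lambda>n. w n x) \<longlonglongrightarrow> u x \<and> (\<lambda>n. G n x) \<longlonglongrightarrow> Du x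
       \<and> (\<forall>n. (w n x)\<^sup>2 + (norm (G n x))\<^sup>2 \<le> W x)"
    and [measurable]: "u \<in> borel_measurable (lebesgue_on \<Omega>)" "Du \<in> borel_measurable (lebesgue_on \<Omega>)"
      "a \<in> borel_measurable (lebesgue_on \<Omega>)"
    and a2: "integrable (lebesgue_on \<Omega>) (\<lambda>x. (norm (a x))\<^sup>2)"
    and B: "integrable (lebesgue_on \<Omega>) B" and g: "integrable (lebesgue_on \<Omega>) g"
    and eq: "\<And>v gv. smooth_fun v \<Longrightarrow> has_grad v gv \<Longrightarrow>
        (\<integral>x. a x \<bullet> gv x \<partial>(lebesgue_on \<Omega>)) + 1/2 * (\<integral>x. v x * B x \<partial>(lebesgue_on \<Omega>)) = (\<integral>x. g x * v x \<partial>(lebesgue_on \<Omega>))"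
    and \<phi>: "\<And>w. smooth_fun w \<Longrightarrow> smooth_fun (\<lambda>x::real^'n. \<phi> (w x))"
      "\<And>t. (\<phi> has_real_derivative \<phi>' t) (at t)" "\<And>t. isCont \<phi>' t"
      "\<And>t. 0 \<le> \<phi>' t" "\<And>t. \<phi>' t \<le> 1" "\<And>t. \<bar>\<phi> t\<bar> \<le> K"
  shows "integrable (lebesgue_on \<Omega>) (\<lambda>x. \<phi>' (u x) * (a x \<bullet> Du x))"
    and "(\<integral>x. \<phi>' (u x) * (a x \<bullet> Du x) \<partial>(lebesgue_on \<Omega>)) + 1/2 * (\<integral>x. \<phi> (u x) * B x \<partial>(lebesgue_on \<Omega>))
       = (\<integral>x. g x * \<phi> (u x) \<partial>(lebesgue_on \<Omega>))"
proof -
  let ?M = "lebesgue_on \<Omega>"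
  have [measurable]: "B \<in> borel_measurable ?M" "g \<in> borel_measurable ?M" "W \<in> borel_measurable ?M" using B g W by auto
  have [measurable]: "w n \<in> borel_measurable ?M" "G n \<in> borel_measurable ?M" for n
    using w(1,2)[of n] smooth_fun_continuous_on smooth_fun_grad_continuous_on
    by (blast intro: borel_measurable_continuous_onI borel_measurable_lebesgue_on_of_borel)+
  have c\<phi>: "isCont \<phi> t" for t using \<phi>(2) by (rule DERIV_isCont)
  have [measurable]: "\<phi> \<in> borel_measurable borel" "\<phi>' \<in> borel_measurable borel"
    using c\<phi> \<phi>(3) by (auto intro!: borel_measurable_continuous_onI simp: continuous_on_eq_continuous_at)
  have K: "K \<ge> 0" using \<phi>(6)[of 0] by linarith
  have l1: "(\<lambda>n. \<integral>x. a x \<bullet> (\<phi>' (w n x) *\<^sub>R G n x) \<partial>?M) \<longlonglongrightarrow> (\<integral>x. \<phi>' (u x) * (a x \<bullet> Du x) \<partial>?M)"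
    and i1: "integrable ?M (\<lambda>x. \<phi>' (u x) * (a x \<bullet> Du x))"
  proof -
    have c: "AE x in ?M. (\<lambda>n. a x \<bullet> (\<phi>' (w n x) *\<^sub>R G n x)) \<longlonglongrightarrow> \<phi>' (u x) * (a x \<bullet> Du x)"
      using ae
    proof eventually_elim
      case (elim x)
      then have "(\<lambda>n. a x \<bullet> (\<phi>' (w n x) *\<^sub>R G n x)) \<longlonglongrightarrow> a x \<bullet> (\<phi>' (u x) *\<^sub>R Du x)"
        by (intro tendsto_intros isCont_tendsto_compose[OF \<phi>(3)]) auto
      then show ?case by simp
    qed
    \<comment> \<open>The Cauchy-Schwarz inequality, followed by a product being at most the sum of
      the squares, gives a majorant independent of n.\<close>
    have b: "AE x in ?M. norm (a x \<bullet> (\<phi>' (w n x) *\<^sub>R G n x)) \<le> (norm (a x))\<^sup>2 + W x" for n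
      using ae
    proof eventually_elim
      case (elim x)
      have "\<bar>a x \<bullet> G n x\<bar> \<le> norm (a x) * norm (G n x)" by (rule Cauchy_Schwarz_ineq2)
      also have "\<dots> \<le> (norm (a x))\<^sup>2 + (norm (G n x))\<^sup>2"
        using sum_squares_bound[of "norm (a x)" "norm (G n x)"] mult_nonneg_nonneg[OF norm_ge_zero[of "a x"] norm_ge_zero[of "G n x"]] by linarith
      finally have 1: "\<bar>a x \<bullet> G n x\<bar> \<le> (norm (a x))\<^sup>2 + (norm (G n x))\<^sup>2" .
      have "(w n x)\<^sup>2 + (norm (G n x))\<^sup>2 \<le> W x" using elim by blast
      then have 2: "(norm (G n x))\<^sup>2 \<le> W x" using zero_le_power2[of "w n x"] by linarith
      have "\<phi>' (w n x) * \<bar>a x \<bullet> G n x\<bar> \<le> 1 * \<bar>a x \<bullet> G n x\<bar>" using \<phi>(5) by (intro mult_right_mono) auto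
      then show ?case using 1 2 \<phi>(4) by (simp add: abs_mult)
    qed
    have iw: "integrable ?M (\<lambda>x. (norm (a x))\<^sup>2 + W x)" using a2 W by simp
    show "(\<lambda>n. \<integral>x. a x \<bullet> (\<phi>' (w n x) *\<^sub>R G n x) \<partial>?M) \<longlonglongrightarrow> (\<integral>x. \<phi>' (u x) * (a x \<bullet> Du x) \<partial>?M)"
      by (rule integral_dominated_convergence[OF _ _ iw c b]) measurable
    show "integrable ?M (\<lambda>x. \<phi>' (u x) * (a x \<bullet> Du x))"
      by (rule integrable_dominated_convergence[OF _ _ iw c b]) measurable
  qed
  \<comment> \<open>Applied to \<open>B\<close> and \<open>g\<close>, which are merely integrable:
    the bound K of \<phi> is what provides the majorant K |f|.\<close>
  have lim: "(\<lambda>n. \<integral>x. \<phi> (w n x) * f x \<partial>?M) \<longlonglongrightarrow> (\<integral>x. \<phi> (u x) * f x \<partial>?M)" if f: "integrable ?M f" for f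
  proof (rule integral_dominated_convergence)
    have [measurable]: "f \<in> borel_measurable ?M" using f by simp
    show "(\<lambda>x. \<phi> (u x) * f x) \<in> borel_measurable ?M" "(\<lambda>x. \<phi> (w n x) * f x) \<in> borel_measurable ?M" for n by measurable
    show "integrable ?M (\<lambda>x. K * \<bar>f x\<bar>)" using f by simp
    show "AE x in ?M. (\<lambda>n. \<phi> (w n x) * f x) \<longlonglongrightarrow> \<phi> (u x) * f x"
      using ae by eventually_elim (intro tendsto_intros isCont_tendsto_compose[OF c\<phi>], auto)
    show "AE x in ?M. norm (\<phi> (w n x) * f x) \<le> K * \<bar>f x\<bar>" for n
      using \<phi>(6) by (intro AE_I2) (auto simp: abs_mult intro!: mult_right_mono)
  qed
  have eqn: "(\<integral>x. a x \<bullet> (\<phi>' (w n x) *\<^sub>R G n x) \<partial>?M) + 1/2 * (\<integral>x. \<phi> (w n x) * B x \<partial>?M) = (\<integral>x. \<phi> (w n x) * g x \<partial>?M)" for n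
    using eq[OF \<phi>(1)[OF w(1)] has_grad_compose[OF w(2) \<phi>(2)], of n] by (simp add: mult.commute)
  have "(\<lambda>n. (\<integral>x. a x \<bullet> (\<phi>' (w n x) *\<^sub>R G n x) \<partial>?M) + 1/2 * (\<integral>x. \<phi> (w n x) * B x \<partial>?M))
      \<longlonglongrightarrow> (\<integral>x. \<phi>' (u x) * (a x \<bullet> Du x) \<partial>?M) + 1/2 * (\<integral>x. \<phi> (u x) * B x \<partial>?M)"
    by (intro tendsto_add tendsto_mult tendsto_const l1 lim B)
  then have "(\<integral>x. \<phi>' (u x) * (a x \<bullet> Du x) \<partial>?M) + 1/2 * (\<integral>x. \<phi> (u x) * B x \<partial>?M) = (\<integral>x. \<phi> (u x) * g x \<partial>?M)"
    unfolding eqn using lim[OF g] LIMSEQ_unique by blast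
  then show "(\<integral>x. \<phi>' (u x) * (a x \<bullet> Du x) \<partial>?M) + 1/2 * (\<integral>x. \<phi> (u x) * B x \<partial>?M) = (\<integral>x. g x * \<phi> (u x) \<partial>?M)"
    by (simp add: mult.commute)
  show "integrable ?M (\<lambda>x. \<phi>' (u x) * (a x \<bullet> Du x))" by (rule i1)
qed

text \<open>The inequality holds for the smooth functions \<phi>(w n). In the limit the left side is
  controlled by Fatou's lemma and the right side by dominated convergence, as |\<phi>(t)| \<le> |t|
  and 0 \<le> \<phi>' \<le> 1 keep the energies below \<open>W\<close>. Unbounded \<phi> are
  included, in particular \<phi>(t) = t, which gives u in L^q.\<close>

lemma sobolev_inequality_composition:
  fixes u :: "real^'n \<Rightarrow> real"
  assumes \<Omega>: "\<Omega> \<in> sets borel"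
    and w: "\<And>n::nat. smooth_fun (w n)" "\<And>n. has_grad (w n) (G n)"
    and W: "integrable (lebesgue_on \<Omega>) W"
    and ae: "AE x in lebesgue_on \<Omega>. (\<lambda>n. w n x) \<longlonglongrightarrow> u x \<and> (\<lambda>n. G n x) \<longlonglongrightarrow> Du x
       \<and> (\<forall>n. (w n x)\<^sup>2 + (norm (G n x))\<^sup>2 \<le> W x)"
    and [measurable]: "u \<in> borel_measurable (lebesgue_on \<Omega>)" "Du \<in> borel_measurable (lebesgue_on \<Omega>)"
    and K: "K \<ge> 0" "\<And>v G. smooth_fun v \<Longrightarrow> has_grad v G \<Longrightarrow>
     (\<integral>\<^sup>+x\<in>\<Omega>. ennreal (\<bar>v x\<bar> powr q) \<partial>lborel)
       \<le> ennreal (K * (\<integral>x\<in>\<Omega>. (v x)\<^sup>2 + (norm (G x))\<^sup>2 \<partial>lborel) powr (q / 2))" and q: "q > 0"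
    and \<phi>: "\<And>w. smooth_fun w \<Longrightarrow> smooth_fun (\<lambda>x::real^'n. \<phi> (w x))"
      "\<And>t. (\<phi> has_real_derivative \<phi>' t) (at t)" "\<And>t. isCont \<phi>' t"
      "\<And>t. 0 \<le> \<phi>' t" "\<And>t. \<phi>' t \<le> 1" "\<And>t. \<bar>\<phi> t\<bar> \<le> \<bar>t\<bar>"
  shows "integrable (lebesgue_on \<Omega>) (\<lambda>x. (\<phi> (u x))\<^sup>2 + (norm (\<phi>' (u x) *\<^sub>R Du x))\<^sup>2)"
    and "(\<integral>\<^sup>+x. ennreal (\<bar>\<phi> (u x)\<bar> powr q) \<partial>(lebesgue_on \<Omega>))
      \<le> ennreal (K * (\<integral>x. (\<phi> (u x))\<^sup>2 + (norm (\<phi>' (u x) *\<^sub>R Du x))\<^sup>2 \<partial>(lebesgue_on \<Omega>)) powr (q / 2))"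
proof -
  let ?M = "lebesgue_on \<Omega>"
  have [measurable]: "W \<in> borel_measurable ?M" using W by auto
  have wb [measurable]: "w n \<in> borel_measurable borel" "G n \<in> borel_measurable borel" for n
    using w(1,2)[of n] smooth_fun_continuous_on smooth_fun_grad_continuous_on
    by (blast intro: borel_measurable_continuous_onI)+
  have [measurable]: "w n \<in> borel_measurable ?M" "G n \<in> borel_measurable ?M" for n
    using wb by (blast intro: borel_measurable_lebesgue_on_of_borel)+
  have c\<phi>: "isCont \<phi> t" for t using \<phi>(2) by (rule DERIV_isCont)
  have [measurable]: "\<phi> \<in> borel_measurable borel" "\<phi>' \<in> borel_measurable borel"
    using c\<phi> \<phi>(3) by (auto intro!: borel_measurable_continuous_onI simp: continuous_on_eq_continuous_at)
  define E where "E n = (\<integral>x. (\<phi> (w n x))\<^sup>2 + (norm (\<phi>' (w n x) *\<^sub>R G n x))\<^sup>2 \<partial>?M)" for n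
  define E0 where "E0 = (\<integral>x. (\<phi> (u x))\<^sup>2 + (norm (\<phi>' (u x) *\<^sub>R Du x))\<^sup>2 \<partial>?M)"
  have c: "AE x in ?M. (\<lambda>n. (\<phi> (w n x))\<^sup>2 + (norm (\<phi>' (w n x) *\<^sub>R G n x))\<^sup>2) \<longlonglongrightarrow> (\<phi> (u x))\<^sup>2 + (norm (\<phi>' (u x) *\<^sub>R Du x))\<^sup>2"
    using ae
  proof eventually_elim
    case (elim x)
    then show ?case
      by (intro tendsto_intros isCont_tendsto_compose[OF c\<phi>] isCont_tendsto_compose[OF \<phi>(3)]) auto
  qed
  have b: "AE x in ?M. norm ((\<phi> (w n x))\<^sup>2 + (norm (\<phi>' (w n x) *\<^sub>R G n x))\<^sup>2) \<le> W x" for n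
    using ae
  proof eventually_elim
    case (elim x)
    have "(\<phi> (w n x))\<^sup>2 \<le> (w n x)\<^sup>2" using \<phi>(6) by (simp add: abs_le_square_iff[symmetric])
    moreover have "norm (\<phi>' (w n x) *\<^sub>R G n x) \<le> norm (G n x)"
      using \<phi>(4,5)[of "w n x"] by (simp add: mult_left_le_one_le)
    then have "(norm (\<phi>' (w n x) *\<^sub>R G n x))\<^sup>2 \<le> (norm (G n x))\<^sup>2" by (intro power_mono) auto
    moreover have "(w n x)\<^sup>2 + (norm (G n x))\<^sup>2 \<le> W x" using elim by blast
    ultimately have "(\<phi> (w n x))\<^sup>2 + (norm (\<phi>' (w n x) *\<^sub>R G n x))\<^sup>2 \<le> W x" by argo
    then show ?case by simp
  qed
  show "integrable ?M (\<lambda>x. (\<phi> (u x))\<^sup>2 + (norm (\<phi>' (u x) *\<^sub>R Du x))\<^sup>2)"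
    by (rule integrable_dominated_convergence[OF _ _ W c b]) measurable
  have E: "E \<longlonglongrightarrow> E0"
    unfolding E_def E0_def by (rule integral_dominated_convergence[OF _ _ W c b]) measurable
  have le: "(\<integral>\<^sup>+x. ennreal (\<bar>\<phi> (w n x)\<bar> powr q) \<partial>?M) \<le> ennreal (K * E n powr (q / 2))" for n
  proof -
    have gr: "has_grad (\<lambda>x. \<phi> (w n x)) (\<lambda>x. \<phi>' (w n x) *\<^sub>R G n x)" by (rule has_grad_compose[OF w(2) \<phi>(2)])
    have "(\<integral>\<^sup>+x. ennreal (\<bar>\<phi> (w n x)\<bar> powr q) \<partial>?M) = (\<integral>\<^sup>+x\<in>\<Omega>. ennreal (\<bar>\<phi> (w n x)\<bar> powr q) \<partial>lebesgue)"
      using \<Omega> by (subst nn_integral_restrict_space) auto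
    also have "\<dots> = (\<integral>\<^sup>+x\<in>\<Omega>. ennreal (\<bar>\<phi> (w n x)\<bar> powr q) \<partial>lborel)"
      by (rule nn_integral_completion)
    also have "\<dots> \<le> ennreal (K * (\<integral>x\<in>\<Omega>. (\<phi> (w n x))\<^sup>2 + (norm (\<phi>' (w n x) *\<^sub>R G n x))\<^sup>2 \<partial>lborel) powr (q / 2))"
      by (rule K(2)[OF \<phi>(1)[OF w(1)] gr])
    also have "(\<integral>x\<in>\<Omega>. (\<phi> (w n x))\<^sup>2 + (norm (\<phi>' (w n x) *\<^sub>R G n x))\<^sup>2 \<partial>lborel) = E n"
      unfolding E_def by (rule set_integral_lborel_eq_lebesgue_on[OF \<Omega>]) measurable
    finally show ?thesis .
  qed
  have "(\<integral>\<^sup>+x. ennreal (\<bar>\<phi> (u x)\<bar> powr q) \<partial>?M) = (\<integral>\<^sup>+x. liminf (\<lambda>n. ennreal (\<bar>\<phi> (w n x)\<bar> powr q)) \<partial>?M)"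
  proof (rule nn_integral_cong_AE, use ae in eventually_elim)
    case (elim x)
    then have "(\<lambda>n. \<bar>\<phi> (w n x)\<bar> powr q) \<longlonglongrightarrow> \<bar>\<phi> (u x)\<bar> powr q"
      using q by (intro tendsto_powr' tendsto_intros isCont_tendsto_compose[OF c\<phi>]) auto
    then have "(\<lambda>n. ennreal (\<bar>\<phi> (w n x)\<bar> powr q)) \<longlonglongrightarrow> ennreal (\<bar>\<phi> (u x)\<bar> powr q)"
      by (rule tendsto_ennrealI)
    from lim_imp_Liminf[OF sequentially_bot this] show ?case by simp
  qed
  also have "\<dots> \<le> liminf (\<lambda>n. \<integral>\<^sup>+x. ennreal (\<bar>\<phi> (w n x)\<bar> powr q) \<partial>?M)"
    by (rule nn_integral_liminf) measurable
  also have "\<dots> \<le> liminf (\<lambda>n. ennreal (K * E n powr (q / 2)))"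
    by (intro Liminf_mono always_eventually allI le)
  also have "\<dots> = ennreal (K * E0 powr (q / 2))"
  proof -
    have "(\<lambda>n. K * E n powr (q / 2)) \<longlonglongrightarrow> K * E0 powr (q / 2)"
      using q by (intro tendsto_mult tendsto_const tendsto_powr' E) (auto simp: E_def intro!: always_eventually)
    then show ?thesis by (intro lim_imp_Liminf tendsto_ennrealI) auto
  qed
  finally show "(\<integral>\<^sup>+x. ennreal (\<bar>\<phi> (u x)\<bar> powr q) \<partial>?M) \<le> ennreal (K * (\<integral>x. (\<phi> (u x))\<^sup>2 + (norm (\<phi>' (u x) *\<^sub>R Du x))\<^sup>2 \<partial>?M) powr (q / 2))"
    unfolding E0_def .
qed

section \<open>Elementary bounds, the exponent q and the energy estimate\<close>

lemma borel_measurable_vecI: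
  fixes f :: "'a \<Rightarrow> real^'n"
  assumes "\<And>i. (\<lambda>x. f x $ i) \<in> borel_measurable M"
  shows "f \<in> borel_measurable M"
proof -
  have "f = (\<lambda>x. \<Sum>i\<in>UNIV. (f x $ i) *\<^sub>R axis i (1::real))"
    by (auto simp: vec_eq_iff axis_def if_distrib[of "\<lambda>y. _ * y"] cong: if_cong)
  moreover have "(\<lambda>x. \<Sum>i\<in>UNIV. (f x $ i) *\<^sub>R axis i (1::real)) \<in> borel_measurable M"
    using assms by measurable
  ultimately show ?thesis by simp
qed

lemma norm_matrix_vector_mult_le:
  fixes B :: "real^'n^'n"
  assumes "\<And>i j. \<bar>B $ i $ j\<bar> \<le> C"
  shows "norm (B *v x) \<le> (real CARD('n))\<^sup>2 * C * norm x"
proof -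
  have "\<bar>(B *v x) $ i\<bar> \<le> real CARD('n) * (C * norm x)" for i
  proof -
    have "\<bar>(B *v x) $ i\<bar> \<le> (\<Sum>j\<in>UNIV. \<bar>B $ i $ j * x $ j\<bar>)"
      by (simp add: matrix_vector_mult_def sum_abs)
    also have "\<dots> \<le> (\<Sum>j\<in>(UNIV::'n set). C * norm x)"
      using assms order_trans[OF abs_ge_zero assms]
      by (intro sum_mono) (auto simp: abs_mult intro!: mult_mono component_le_norm_cart)
    finally show ?thesis by simp
  qed
  then have "(\<Sum>i\<in>UNIV. \<bar>(B *v x) $ i\<bar>) \<le> (\<Sum>i\<in>(UNIV::'n set). real CARD('n) * (C * norm x))"
    by (intro sum_mono)
  then show ?thesis using norm_le_l1_cart[of "B *v x"] by (simp add: power2_eq_square)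
qed

lemma powr_le_one_plus_powr:
  fixes x :: real
  assumes "x \<ge> 0" "0 < s" "s \<le> r"
  shows "x powr s \<le> 1 + x powr r"
proof (cases "x \<le> 1")
  case True
  then have "x powr s \<le> 1" using assms by (intro powr_le1) auto
  then show ?thesis using powr_ge_zero[of x r] by linarith
next
  case False
  then have "x powr s \<le> x powr r" using assms by (intro powr_mono) auto
  then show ?thesis by simp
qed

text \<open>Solving r > q/(q - 2) for q gives q > 2r/(r - 1), and for N \<ge> 3 the condition r >
  N/2 says that this bound is below 2N/(N - 2). Hence both lower bounds on q are compatible with the
  upper one, which is void for N = 2.\<close>

lemma subcritical_exponent_exists:
  fixes p r :: real
  assumes N: "N \<ge> (2::nat)" and p: "2 < p" "N \<ge> 3 \<Longrightarrow> p < 2 * real N / (real N - 2)" and r: "r > real N / 2"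
  obtains q where "q > p" "q * (real N - 2) < 2 * real N" "r > q / (q - 2)"
proof -
  have r1: "r > 1" using N r by simp
  define m where "m = max p (2 * r / (r - 1))"
  have "\<exists>q>m. q * (real N - 2) < 2 * real N"
  proof (cases "N \<ge> 3")
    case True
    then have N2: "real N - 2 > 0" by simp
    have "2 * r * (real N - 2) < 2 * real N * (r - 1)" using r by (simp add: algebra_simps)
    then have "2 * r / (r - 1) < 2 * real N / (real N - 2)" using r1 N2 by (simp add: divide_less_eq less_divide_eq)
    then have "m < 2 * real N / (real N - 2)" using p(2)[OF True] by (simp add: m_def)
    then obtain q where "m < q" "q < 2 * real N / (real N - 2)" using dense by blast
    then show ?thesis using N2 by (intro exI[of _ q]) (simp add: less_divide_eq)
  next
    case False
    then have "real N = 2" using N by simp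
    then show ?thesis by (intro exI[of _ "m + 1"]) simp
  qed
  then obtain q where q: "q > m" "q * (real N - 2) < 2 * real N" by blast
  have qp: "q > p" "q > 2 * r / (r - 1)" using q by (auto simp: m_def)
  have "2 * r < q * (r - 1)" using qp(2) r1 by (simp add: divide_less_eq)
  then have "q < r * (q - 2)" by (simp add: algebra_simps)
  then have "q / (q - 2) < r" using qp p by (simp add: divide_less_eq)
  then show ?thesis using that qp q by blast
qed

text \<open>Testing with \<phi>_n(u) bounds \<nu> times the integral of \<phi>_n'(u) |Du|^2 by that
  of V |u| |\<phi>_n(u)|, because the term with \<open>B\<close> is nonnegative. The latter
  integrand also dominates \<phi>_n(u)^2, whence the factor 1 + 1/\<nu> in the bound for the H^1
  norm of \<phi>_n(u). The Sobolev inequality and the limit in n conclude.\<close>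

lemma truncation_energy_inequality:
  fixes u V g B :: "real^'n \<Rightarrow> real" and a Du :: "real^'n \<Rightarrow> real^'n"
  assumes \<Omega>: "\<Omega> \<in> sets borel"
    and w: "\<And>n::nat. smooth_fun (w n)" "\<And>n. has_grad (w n) (G n)"
    and W: "integrable (lebesgue_on \<Omega>) W"
    and ae: "AE x in lebesgue_on \<Omega>. (\<lambda>n. w n x) \<longlonglongrightarrow> u x \<and> (\<lambda>n. G n x) \<longlonglongrightarrow> Du x
       \<and> (\<forall>n. (w n x)\<^sup>2 + (norm (G n x))\<^sup>2 \<le> W x)"
    and meas [measurable]: "u \<in> borel_measurable (lebesgue_on \<Omega>)" "Du \<in> borel_measurable (lebesgue_on \<Omega>)"
      "a \<in> borel_measurable (lebesgue_on \<Omega>)" "V \<in> borel_measurable (lebesgue_on \<Omega>)"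
    and D2: "integrable (lebesgue_on \<Omega>) (\<lambda>x. (norm (Du x))\<^sup>2)"
    and a2: "integrable (lebesgue_on \<Omega>) (\<lambda>x. (norm (a x))\<^sup>2)"
    and B: "integrable (lebesgue_on \<Omega>) B" and g: "integrable (lebesgue_on \<Omega>) g"
    and eq: "\<And>v gv. smooth_fun v \<Longrightarrow> has_grad v gv \<Longrightarrow>
        (\<integral>x. a x \<bullet> gv x \<partial>(lebesgue_on \<Omega>)) + 1/2 * (\<integral>x. v x * B x \<partial>(lebesgue_on \<Omega>)) = (\<integral>x. g x * v x \<partial>(lebesgue_on \<Omega>))"
    and K: "K \<ge> 0" "\<And>v G. smooth_fun v \<Longrightarrow> has_grad v G \<Longrightarrow>
     (\<integral>\<^sup>+x\<in>\<Omega>. ennreal (\<bar>v x\<bar> powr q) \<partial>lborel)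
       \<le> ennreal (K * (\<integral>x\<in>\<Omega>. (v x)\<^sup>2 + (norm (G x))\<^sup>2 \<partial>lborel) powr (q / 2))" and q: "q > 0"
    and \<nu>: "\<nu> > 0" "AE x in lebesgue_on \<Omega>. a x \<bullet> Du x \<ge> \<nu> * (norm (Du x))\<^sup>2"
    and k: "k \<ge> 0" and Bk: "AE x in lebesgue_on \<Omega>. \<bar>u x\<bar> > k \<longrightarrow> u x * B x \<ge> 0"
    and V: "\<And>x. V x \<ge> 1" and gV: "AE x in lebesgue_on \<Omega>. \<bar>u x\<bar> > k \<longrightarrow> \<bar>g x\<bar> \<le> V x * \<bar>u x\<bar>"
    and Vu: "integrable (lebesgue_on \<Omega>) (\<lambda>x. V x * (u x)\<^sup>2)"
  shows "(\<integral>x. (max 0 (\<bar>u x\<bar> - k)) powr q \<partial>(lebesgue_on \<Omega>)) powr (2 / q)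
      \<le> K powr (2 / q) * (1 + 1 / \<nu>) * (\<integral>x. V x * \<bar>u x\<bar> * max 0 (\<bar>u x\<bar> - k) \<partial>(lebesgue_on \<Omega>))"
proof -
  let ?M = "lebesgue_on \<Omega>"
  obtain \<phi> \<phi>' :: "nat \<Rightarrow> real \<Rightarrow> real" and Kn :: "nat \<Rightarrow> real" where
    \<phi>: "\<And>n w. smooth_fun w \<Longrightarrow> smooth_fun (\<lambda>x::real^'n. \<phi> n (w x))"
    "\<And>n t. (\<phi> n has_real_derivative \<phi>' n t) (at t)" "\<And>n t. isCont (\<phi>' n) t"
    "\<And>n t. 0 \<le> \<phi>' n t" "\<And>n t. \<phi>' n t \<le> 1" "\<And>n t. \<bar>\<phi> n t\<bar> \<le> Kn n" "\<And>n t. \<bar>\<phi> n t\<bar> \<le> max 0 (\<bar>t\<bar> - k)"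
    "\<And>n t. 0 \<le> t * \<phi> n t" "\<And>t. (\<lambda>n. \<bar>\<phi> n t\<bar>) \<longlonglongrightarrow> max 0 (\<bar>t\<bar> - k)"
    using smooth_truncation_sequence[OF k, where 'n='n] by metis
  have c\<phi>: "isCont (\<phi> n) t" for n t using \<phi>(2) by (rule DERIV_isCont)
  have [measurable]: "\<phi> n \<in> borel_measurable borel" "\<phi>' n \<in> borel_measurable borel" for n
    using c\<phi> \<phi>(3) by (auto intro!: borel_measurable_continuous_onI simp: continuous_on_eq_continuous_at)
  have \<phi>_le: "\<bar>\<phi> n t\<bar> \<le> \<bar>t\<bar>" for n t using \<phi>(7)[of n t] k by (auto simp: max_def split: if_splits)
  have \<phi>0: "\<phi> n t = 0" if "\<bar>t\<bar> \<le> k" for n t using \<phi>(7)[of n t] that by linarith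
  define I where "I = (\<integral>x. V x * \<bar>u x\<bar> * max 0 (\<bar>u x\<bar> - k) \<partial>?M)"
  define X where "X n = (\<integral>x. V x * \<bar>u x\<bar> * \<bar>\<phi> n (u x)\<bar> \<partial>?M)" for n
  have V0: "0 \<le> V x" for x using V[of x] by linarith
  have bound_Vu: "integrable ?M (\<lambda>x. V x * \<bar>u x\<bar> * f (u x))"
    if "f \<in> borel_measurable borel" "\<And>t. 0 \<le> f t" "\<And>t. f t \<le> \<bar>t\<bar>" for f :: "real \<Rightarrow> real"
  proof (rule Bochner_Integration.integrable_bound[OF Vu])
    have [measurable]: "f \<in> borel_measurable borel" by fact
    show "(\<lambda>x. V x * \<bar>u x\<bar> * f (u x)) \<in> borel_measurable ?M" by measurable
    show "AE x in ?M. norm (V x * \<bar>u x\<bar> * f (u x)) \<le> norm (V x * (u x)\<^sup>2)"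
    proof (rule AE_I2)
      fix x
      have "V x * \<bar>u x\<bar> * f (u x) \<le> V x * \<bar>u x\<bar> * \<bar>u x\<bar>"
        using V0 that by (intro mult_left_mono) auto
      also have "\<dots> = V x * (u x)\<^sup>2" by (simp add: power2_eq_square)
      finally show "norm (V x * \<bar>u x\<bar> * f (u x)) \<le> norm (V x * (u x)\<^sup>2)"
        using V0 that(2) by (simp add: abs_mult)
    qed
  qed
  have iI: "integrable ?M (\<lambda>x. V x * \<bar>u x\<bar> * max 0 (\<bar>u x\<bar> - k))"
    using k by (intro bound_Vu[of "\<lambda>t. max 0 (\<bar>t\<bar> - k)"]) auto
  have iX: "integrable ?M (\<lambda>x. V x * \<bar>u x\<bar> * \<bar>\<phi> n (u x)\<bar>)" for n
    using \<phi>_le by (intro bound_Vu[of "\<lambda>t. \<bar>\<phi> n t\<bar>"]) auto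
  have XI: "X n \<le> I" for n
    unfolding X_def I_def using V0 \<phi>(7) by (intro integral_mono iX iI mult_left_mono) auto
  have I0: "I \<ge> 0" unfolding I_def using V0 by (intro Bochner_Integration.integral_nonneg) simp
  have X0: "X n \<ge> 0" for n unfolding X_def using V0 by (intro Bochner_Integration.integral_nonneg) simp
  have energy: "\<nu> * (\<integral>x. \<phi>' n (u x) * (norm (Du x))\<^sup>2 \<partial>?M) \<le> X n" for n
  proof -
    note wf = weak_formulation_composition[OF w W ae meas(1-3) a2 B g eq \<phi>(1-6)]
    have iD: "integrable ?M (\<lambda>x. \<phi>' n (u x) * (norm (Du x))\<^sup>2)"
    proof (rule Bochner_Integration.integrable_bound[OF D2])
      show "AE x in ?M. norm (\<phi>' n (u x) * (norm (Du x))\<^sup>2) \<le> norm ((norm (Du x))\<^sup>2)"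
        using \<phi>(4,5) by (intro AE_I2) (simp add: abs_mult mult_left_le_one_le)
    qed measurable
    have "\<nu> * (\<integral>x. \<phi>' n (u x) * (norm (Du x))\<^sup>2 \<partial>?M) = (\<integral>x. \<nu> * (\<phi>' n (u x) * (norm (Du x))\<^sup>2) \<partial>?M)" by simp
    also have "\<dots> \<le> (\<integral>x. \<phi>' n (u x) * (a x \<bullet> Du x) \<partial>?M)"
    proof (rule integral_mono_AE)
      show "AE x in ?M. \<nu> * (\<phi>' n (u x) * (norm (Du x))\<^sup>2) \<le> \<phi>' n (u x) * (a x \<bullet> Du x)"
        using \<nu>(2)
      proof eventually_elim
        case (elim x)
        then have "\<phi>' n (u x) * (\<nu> * (norm (Du x))\<^sup>2) \<le> \<phi>' n (u x) * (a x \<bullet> Du x)"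
          using \<phi>(4) by (intro mult_left_mono)
        then show ?case by (simp add: mult.left_commute)
      qed
    qed (use iD wf(1) in auto)
    also have "\<dots> \<le> (\<integral>x. \<phi>' n (u x) * (a x \<bullet> Du x) \<partial>?M) + 1/2 * (\<integral>x. \<phi> n (u x) * B x \<partial>?M)"
    proof -
      have "AE x in ?M. 0 \<le> \<phi> n (u x) * B x"
        using Bk
      proof eventually_elim
        case (elim x)
        show ?case
        proof (cases "\<bar>u x\<bar> > k")
          case True
          \<comment> \<open>The sign of \<phi>_n(u) B is found by multiplying u B \<ge> 0 with u
            \<phi>_n(u) \<ge> 0 and dividing by u^2, which covers both signs of u.\<close>
          then have "0 \<le> (u x * B x) * (u x * \<phi> n (u x))" using elim by (intro mult_nonneg_nonneg[OF _ \<phi>(8)]) auto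
          then have "0 \<le> (u x)\<^sup>2 * (\<phi> n (u x) * B x)" by (simp add: power2_eq_square mult_ac)
          moreover have "(u x)\<^sup>2 > 0" using True k by auto
          ultimately show ?thesis by (simp add: zero_le_mult_iff)
        next
          case False
          then show ?thesis using \<phi>0[of "u x"] by simp
        qed
      qed
      then have "0 \<le> (\<integral>x. \<phi> n (u x) * B x \<partial>?M)" by (rule integral_nonneg_AE)
      then show ?thesis by simp
    qed
    also have "\<dots> = (\<integral>x. g x * \<phi> n (u x) \<partial>?M)" by (rule wf(2))
    also have "\<dots> \<le> X n"
      unfolding X_def
    proof (rule integral_mono_AE)
      show "integrable ?M (\<lambda>x. g x * \<phi> n (u x))"
      proof (rule Bochner_Integration.integrable_bound[of _ "\<lambda>x. Kn n * g x"])
        show "AE x in ?M. norm (g x * \<phi> n (u x)) \<le> norm (Kn n * g x)"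
        proof (rule AE_I2)
          fix x
          have "\<bar>g x\<bar> * \<bar>\<phi> n (u x)\<bar> \<le> \<bar>g x\<bar> * \<bar>Kn n\<bar>"
            using \<phi>(6)[of n "u x"] by (intro mult_left_mono) auto
          then show "norm (g x * \<phi> n (u x)) \<le> norm (Kn n * g x)" by (simp add: abs_mult mult.commute)
        qed
        show "(\<lambda>x. g x * \<phi> n (u x)) \<in> borel_measurable ?M" using g by measurable
      qed (use g in simp)
      show "AE x in ?M. g x * \<phi> n (u x) \<le> V x * \<bar>u x\<bar> * \<bar>\<phi> n (u x)\<bar>"
        using gV
      proof eventually_elim
        case (elim x)
        show ?case
        proof (cases "\<bar>u x\<bar> > k")
          case True
          have "g x * \<phi> n (u x) \<le> \<bar>g x\<bar> * \<bar>\<phi> n (u x)\<bar>" by (metis abs_ge_self abs_mult)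
          also have "\<dots> \<le> V x * \<bar>u x\<bar> * \<bar>\<phi> n (u x)\<bar>" using elim True by (intro mult_right_mono) auto
          finally show ?thesis .
        next
          case False
          then show ?thesis using \<phi>0[of "u x"] by simp
        qed
      qed
    qed (rule iX)
    finally show ?thesis .
  qed
  define T where "T = K * ((1 + 1 / \<nu>) * I) powr (q / 2)"
  have T0: "T \<ge> 0" unfolding T_def using K by simp
  have sob: "(\<integral>\<^sup>+x. ennreal (\<bar>\<phi> n (u x)\<bar> powr q) \<partial>?M) \<le> ennreal T" for n
  proof -
    note sc = sobolev_inequality_composition[OF \<Omega> w W ae meas(1,2) K q \<phi>(1-5) \<phi>_le]
    have iD: "integrable ?M (\<lambda>x. \<phi>' n (u x) * (norm (Du x))\<^sup>2)"
    proof (rule Bochner_Integration.integrable_bound[OF D2])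
      show "AE x in ?M. norm (\<phi>' n (u x) * (norm (Du x))\<^sup>2) \<le> norm ((norm (Du x))\<^sup>2)"
        using \<phi>(4,5) by (intro AE_I2) (simp add: abs_mult mult_left_le_one_le)
    qed measurable
    have "(\<integral>x. (\<phi> n (u x))\<^sup>2 + (norm (\<phi>' n (u x) *\<^sub>R Du x))\<^sup>2 \<partial>?M)
       \<le> (\<integral>x. V x * \<bar>u x\<bar> * \<bar>\<phi> n (u x)\<bar> + \<phi>' n (u x) * (norm (Du x))\<^sup>2 \<partial>?M)"
    proof (rule integral_mono)
      show "integrable ?M (\<lambda>x. (\<phi> n (u x))\<^sup>2 + (norm (\<phi>' n (u x) *\<^sub>R Du x))\<^sup>2)" by (rule sc(1))
      show "integrable ?M (\<lambda>x. V x * \<bar>u x\<bar> * \<bar>\<phi> n (u x)\<bar> + \<phi>' n (u x) * (norm (Du x))\<^sup>2)" using iX iD by simp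
      fix x
      have "(\<phi> n (u x))\<^sup>2 = 1 * \<bar>\<phi> n (u x)\<bar> * \<bar>\<phi> n (u x)\<bar>" by (simp add: power2_eq_square)
      also have "\<dots> \<le> V x * \<bar>u x\<bar> * \<bar>\<phi> n (u x)\<bar>" using V V0 \<phi>_le by (intro mult_right_mono mult_mono) auto
      finally have 1: "(\<phi> n (u x))\<^sup>2 \<le> V x * \<bar>u x\<bar> * \<bar>\<phi> n (u x)\<bar>" .
      \<comment> \<open>The slope occurs squared in the norm but only to the first power in the
        tested equation; slopes between 0 and 1 reconcile the two.\<close>
      have "(\<phi>' n (u x))\<^sup>2 \<le> \<phi>' n (u x)" using \<phi>(4,5) by (simp add: power2_eq_square mult_left_le)
      then have "(\<phi>' n (u x))\<^sup>2 * (norm (Du x))\<^sup>2 \<le> \<phi>' n (u x) * (norm (Du x))\<^sup>2" by (intro mult_right_mono) auto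
      then show "(\<phi> n (u x))\<^sup>2 + (norm (\<phi>' n (u x) *\<^sub>R Du x))\<^sup>2 \<le> V x * \<bar>u x\<bar> * \<bar>\<phi> n (u x)\<bar> + \<phi>' n (u x) * (norm (Du x))\<^sup>2"
        using 1 by (simp add: power_mult_distrib)
    qed
    also have "\<dots> = X n + (\<integral>x. \<phi>' n (u x) * (norm (Du x))\<^sup>2 \<partial>?M)"
      unfolding X_def by (rule Bochner_Integration.integral_add[OF iX iD])
    also have "\<dots> \<le> X n + X n / \<nu>"
    proof -
      have "(\<integral>x. \<phi>' n (u x) * (norm (Du x))\<^sup>2 \<partial>?M) \<le> X n / \<nu>"
        using energy[of n] \<nu>(1) by (simp add: pos_le_divide_eq mult.commute)
      then show ?thesis by simp
    qed
    also have "\<dots> = (1 + 1 / \<nu>) * X n" by (simp add: algebra_simps)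
    also have "\<dots> \<le> (1 + 1 / \<nu>) * I" using XI \<nu>(1) by (intro mult_left_mono) auto
    finally have E: "(\<integral>x. (\<phi> n (u x))\<^sup>2 + (norm (\<phi>' n (u x) *\<^sub>R Du x))\<^sup>2 \<partial>?M) \<le> (1 + 1 / \<nu>) * I" .
    have "(\<integral>\<^sup>+x. ennreal (\<bar>\<phi> n (u x)\<bar> powr q) \<partial>?M)
       \<le> ennreal (K * (\<integral>x. (\<phi> n (u x))\<^sup>2 + (norm (\<phi>' n (u x) *\<^sub>R Du x))\<^sup>2 \<partial>?M) powr (q / 2))" by (rule sc(2))
    also have "\<dots> \<le> ennreal T"
      unfolding T_def using K(1) E q by (intro ennreal_leI mult_left_mono powr_mono2 Bochner_Integration.integral_nonneg) auto
    finally show ?thesis .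
  qed
  \<comment> \<open>Fatou's lemma: the smooth truncations converge at every point, and the bound T
    is independent of n.\<close>
  have "(\<integral>\<^sup>+x. ennreal (max 0 (\<bar>u x\<bar> - k) powr q) \<partial>?M) = (\<integral>\<^sup>+x. liminf (\<lambda>n. ennreal (\<bar>\<phi> n (u x)\<bar> powr q)) \<partial>?M)"
  proof (rule nn_integral_cong)
    fix x
    have "(\<lambda>n. \<bar>\<phi> n (u x)\<bar> powr q) \<longlonglongrightarrow> max 0 (\<bar>u x\<bar> - k) powr q"
      using q by (intro tendsto_powr' \<phi>(9) tendsto_const) auto
    then have "(\<lambda>n. ennreal (\<bar>\<phi> n (u x)\<bar> powr q)) \<longlonglongrightarrow> ennreal (max 0 (\<bar>u x\<bar> - k) powr q)"
      by (rule tendsto_ennrealI)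
    from lim_imp_Liminf[OF sequentially_bot this]
    show "ennreal (max 0 (\<bar>u x\<bar> - k) powr q) = liminf (\<lambda>n. ennreal (\<bar>\<phi> n (u x)\<bar> powr q))" by simp
  qed
  also have "\<dots> \<le> liminf (\<lambda>n. \<integral>\<^sup>+x. ennreal (\<bar>\<phi> n (u x)\<bar> powr q) \<partial>?M)"
    by (rule nn_integral_liminf) measurable
  also have "\<dots> \<le> liminf (\<lambda>n::nat. ennreal T)"
    by (intro Liminf_mono always_eventually allI sob)
  also have "\<dots> = ennreal T" by (simp add: Liminf_const)
  finally have nn: "(\<integral>\<^sup>+x. ennreal (max 0 (\<bar>u x\<bar> - k) powr q) \<partial>?M) \<le> ennreal T" .
  have "(\<integral>x. max 0 (\<bar>u x\<bar> - k) powr q \<partial>?M) = enn2real (\<integral>\<^sup>+x. ennreal (max 0 (\<bar>u x\<bar> - k) powr q) \<partial>?M)"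
    by (intro integral_eq_nn_integral) auto
  also have "\<dots> \<le> T" using enn2real_mono[OF nn] T0 by simp
  finally have "(\<integral>x. max 0 (\<bar>u x\<bar> - k) powr q \<partial>?M) powr (2 / q) \<le> T powr (2 / q)"
    using q by (intro powr_mono2 Bochner_Integration.integral_nonneg) auto
  also have "T powr (2 / q) = K powr (2 / q) * (1 + 1 / \<nu>) * I"
    using K(1) \<nu>(1) I0 q by (simp add: T_def powr_mult powr_powr)
  finally show ?thesis by (simp add: I_def)
qed

theorem theorem3p4:
  fixes \<Omega> :: "(real^'n) set"
    and A DA :: "real^'n \<Rightarrow> real \<Rightarrow> real^'n^'n"
    and g :: "real^'n \<Rightarrow> real \<Rightarrow> real"
    and a :: "real^'n \<Rightarrow> real"
    and u :: "real^'n \<Rightarrow> real"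
    and p r b C \<nu> R lam :: real
  assumes N2: "CARD('n) \<ge> 2"
    and dom: "bounded \<Omega>" "lipschitz_domain \<Omega>"
    and p: "2 < p" "CARD('n) \<ge> 3 \<Longrightarrow> p < 2 * real CARD('n) / (real CARD('n) - 2)"
    and A_sym: "AE x in lebesgue. x \<in> \<Omega> \<longrightarrow> (\<forall>s. transpose (A x s) = A x s)"
    and A_meas: "\<And>s i j. set_borel_measurable lebesgue \<Omega> (\<lambda>x. A x s $ i $ j)"
    and A_C1: "AE x in lebesgue. x \<in> \<Omega> \<longrightarrow>
                 (\<forall>i j. (\<forall>s. ((\<lambda>t. A x t $ i $ j) has_real_derivative DA x s $ i $ j) (at s)) \<and>
                        continuous_on UNIV (\<lambda>s. DA x s $ i $ j))"
    and C: "C > 0" and \<nu>: "\<nu> > 0" and R: "R > 0"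
    and a1: "AE x in lebesgue. x \<in> \<Omega> \<longrightarrow>
               (\<forall>s i j. \<bar>A x s $ i $ j\<bar> \<le> C \<and> \<bar>DA x s $ i $ j\<bar> \<le> C)"
    and a2: "AE x in lebesgue. x \<in> \<Omega> \<longrightarrow>
               (\<forall>s \<xi>. (A x s *v \<xi>) \<bullet> \<xi> \<ge> \<nu> * (norm \<xi>)\<^sup>2)"
    and a3: "AE x in lebesgue. x \<in> \<Omega> \<longrightarrow>
               (\<forall>s \<xi>. \<bar>s\<bar> \<ge> R \<longrightarrow> s * ((DA x s *v \<xi>) \<bullet> \<xi>) \<ge> 0)"
    and g_meas: "\<And>s. set_borel_measurable lebesgue \<Omega> (\<lambda>x. g x s)"
    and g_cont: "AE x in lebesgue. x \<in> \<Omega> \<longrightarrow> continuous_on UNIV (g x)"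
    and g1: "AE x in lebesgue. x \<in> \<Omega> \<longrightarrow> (\<forall>s. \<bar>g x s\<bar> \<le> a x + b * \<bar>s\<bar> powr (p - 1))"
    and a_Lr: "in_Lp r \<Omega> a"
    and r: "r > real CARD('n) / 2"
    and sol: "weak_solution \<Omega> A DA g lam u"
  shows "in_Linf \<Omega> u"
proof -
  let ?M = "lebesgue_on \<Omega>"
  have op: "open \<Omega>" using dom(2) by (simp add: lipschitz_domain_def)
  then have \<Omega>B: "\<Omega> \<in> sets borel" by simp
  have \<Omega>L: "\<Omega> \<in> sets lebesgue" using op by simp
  have fin: "finite_measure ?M"
    using op dom(1) by (intro finite_measure_lebesgue_on) (simp add: lmeasurable_open)
  interpret finite_measure ?M by (rule fin)
  obtain Du where H1: "H1_with_grad \<Omega> u Du" and weak: "\<And>v gv. smooth_fun v \<Longrightarrow> has_grad v gv \<Longrightarrow>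
          (LINT x:\<Omega>|lebesgue. (A x (u x) *v Du x) \<bullet> gv x)
          + 1/2 * (LINT x:\<Omega>|lebesgue. v x * ((DA x (u x) *v Du x) \<bullet> Du x))
          = (LINT x:\<Omega>|lebesgue. (g x (u x) - lam * u x) * v x)"
    using sol unfolding weak_solution_def by blast
  have su: "set_borel_measurable lebesgue \<Omega> u" using H1 by (simp add: H1_with_grad_def in_Lp_def)
  then have um [measurable]: "u \<in> borel_measurable ?M" by (simp add: set_borel_measurable_iff_lebesgue_on[OF \<Omega>L])
  have Dim [measurable]: "(\<lambda>x. Du x $ i) \<in> borel_measurable ?M" for i
    using H1 by (simp add: H1_with_grad_def in_Lp_def set_borel_measurable_iff_lebesgue_on[OF \<Omega>L])
  have Dm [measurable]: "Du \<in> borel_measurable ?M" by (rule borel_measurable_vecI[OF Dim])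
  have D2: "integrable ?M (\<lambda>x. (norm (Du x))\<^sup>2)"
  proof -
    have "integrable ?M (\<lambda>x. \<bar>Du x $ i\<bar> powr 2)" for i
      using H1 by (simp add: H1_with_grad_def in_Lp_def set_integrable_iff_lebesgue_on[OF \<Omega>L])
    then show ?thesis unfolding norm_squared_vec by (intro Bochner_Integration.integrable_sum) simp
  qed

  have Am [measurable]: "(\<lambda>x. A x (u x) $ i $ j) \<in> borel_measurable ?M" for i j
  proof -
    have "AE x in lebesgue. x \<in> \<Omega> \<longrightarrow> continuous_on UNIV (\<lambda>s. A x s $ i $ j)"
      using A_C1
    proof eventually_elim
      case (elim x)
      show ?case
      proof
        assume "x \<in> \<Omega>"
        then have "\<And>s. ((\<lambda>t. A x t $ i $ j) has_real_derivative DA x s $ i $ j) (at s)" using elim by blast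
        then show "continuous_on UNIV (\<lambda>s. A x s $ i $ j)"
          by (intro continuous_at_imp_continuous_on ballI DERIV_isCont)
      qed
    qed
    from caratheodory_set_borel_measurable[OF A_meas this su]
    show ?thesis by (simp add: set_borel_measurable_iff_lebesgue_on[OF \<Omega>L])
  qed
  have DAm [measurable]: "(\<lambda>x. DA x (u x) $ i $ j) \<in> borel_measurable ?M" for i j
  proof -
    have "AE x in lebesgue. x \<in> \<Omega> \<longrightarrow> (\<forall>s. ((\<lambda>t. A x t $ i $ j) has_real_derivative DA x s $ i $ j) (at s))"
      using A_C1 by eventually_elim blast
    then have "set_borel_measurable lebesgue \<Omega> (\<lambda>x. DA x s $ i $ j)" for s
      by (rule set_borel_measurable_deriv[OF A_meas])
    moreover have "AE x in lebesgue. x \<in> \<Omega> \<longrightarrow> continuous_on UNIV (\<lambda>s. DA x s $ i $ j)"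
      using A_C1 by eventually_elim blast
    ultimately have "set_borel_measurable lebesgue \<Omega> (\<lambda>x. DA x (u x) $ i $ j)"
      using su by (rule caratheodory_set_borel_measurable)
    then show ?thesis by (simp add: set_borel_measurable_iff_lebesgue_on[OF \<Omega>L])
  qed
  define F where "F x = A x (u x) *v Du x" for x
  define H where "H x = DA x (u x) *v Du x" for x
  define B where "B x = H x \<bullet> Du x" for x
  have Fm [measurable]: "F \<in> borel_measurable ?M"
  proof (rule borel_measurable_vecI)
    show "(\<lambda>x. F x $ i) \<in> borel_measurable ?M" for i
      unfolding F_def matrix_vector_mult_def by simp
  qed
  have Hm [measurable]: "H \<in> borel_measurable ?M"
  proof (rule borel_measurable_vecI)
    show "(\<lambda>x. H x $ i) \<in> borel_measurable ?M" for i
      unfolding H_def matrix_vector_mult_def by simp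
  qed
  have Bm [measurable]: "B \<in> borel_measurable ?M" unfolding B_def by measurable
  define L where "L = (real CARD('n))\<^sup>2 * C"
  have "AE x in lebesgue. x \<in> \<Omega> \<longrightarrow> norm (F x) \<le> L * norm (Du x) \<and> norm (H x) \<le> L * norm (Du x)"
    using a1 by eventually_elim (auto simp: F_def H_def L_def intro!: norm_matrix_vector_mult_le)
  then have FH: "AE x in ?M. norm (F x) \<le> L * norm (Du x) \<and> norm (H x) \<le> L * norm (Du x)"
    by (rule iffD2[OF AE_lebesgue_on_iff[OF \<Omega>L]])
  have F2: "integrable ?M (\<lambda>x. (norm (F x))\<^sup>2)"
  proof (rule Bochner_Integration.integrable_bound[of _ "\<lambda>x. L\<^sup>2 * (norm (Du x))\<^sup>2"])
    show "AE x in ?M. norm ((norm (F x))\<^sup>2) \<le> norm (L\<^sup>2 * (norm (Du x))\<^sup>2)"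
      using FH
    proof eventually_elim
      case (elim x)
      then have "(norm (F x))\<^sup>2 \<le> (L * norm (Du x))\<^sup>2" by (intro power_mono) auto
      then show ?case by (simp add: power_mult_distrib)
    qed
  qed (use D2 in auto)
  have Bi: "integrable ?M B"
  proof (rule Bochner_Integration.integrable_bound[of _ "\<lambda>x. L * (norm (Du x))\<^sup>2"])
    show "AE x in ?M. norm (B x) \<le> norm (L * (norm (Du x))\<^sup>2)"
      using FH
    proof eventually_elim
      case (elim x)
      have "\<bar>B x\<bar> \<le> norm (H x) * norm (Du x)" unfolding B_def by (rule Cauchy_Schwarz_ineq2)
      also have "\<dots> \<le> L * norm (Du x) * norm (Du x)" using elim by (intro mult_right_mono) auto
      also have "\<dots> = L * (norm (Du x))\<^sup>2" by (simp add: power2_eq_square)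
      finally show ?case by simp
    qed
  qed (use D2 in auto)

  obtain q where q: "q > p" "q * (real CARD('n) - 2) < 2 * real CARD('n)" "r > q / (q - 2)"
    using subcritical_exponent_exists[OF N2 p r] by blast
  have q2: "q > 2" using q p by linarith
  obtain K where K: "K \<ge> 0" "\<And>v G. smooth_fun v \<Longrightarrow> has_grad v G \<Longrightarrow>
     (\<integral>\<^sup>+x\<in>\<Omega>. ennreal (\<bar>v x\<bar> powr q) \<partial>lborel)
       \<le> ennreal (K * (\<integral>x\<in>\<Omega>. (v x)\<^sup>2 + (norm (G x))\<^sup>2 \<partial>lborel) powr (q / 2))"
    using sobolev_inequality_lipschitz_domain[OF dom(2,1) q2 q(2)] by blast
  obtain w G W where w: "\<And>n::nat. smooth_fun (w n)" "\<And>n. has_grad (w n) (G n)"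
    and W: "integrable ?M W"
    and wae: "AE x in ?M. (\<lambda>n. w n x) \<longlonglongrightarrow> u x \<and> (\<lambda>n. G n x) \<longlonglongrightarrow> Du x
       \<and> (\<forall>n. (w n x)\<^sup>2 + (norm (G n x))\<^sup>2 \<le> W x)"
    using H1_dominated_approximation[OF dom(2,1) H1] by blast
  have q0: "q > 0" using q2 by simp
  \<comment> \<open>The Sobolev inequality with \<phi>(t) = t provides the initial integrability of
    u, from which those of powers of V, of V u^2 and of f follow.\<close>
  have uq: "integrable ?M (\<lambda>x. \<bar>u x\<bar> powr q)"
  proof (rule integrableI_nonneg)
    have "(\<integral>\<^sup>+x. ennreal (\<bar>u x\<bar> powr q) \<partial>?M)
      \<le> ennreal (K * (\<integral>x. (u x)\<^sup>2 + (norm (1 *\<^sub>R Du x))\<^sup>2 \<partial>?M) powr (q / 2))"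
      by (rule sobolev_inequality_composition(2)[OF \<Omega>B w W wae um Dm K q0, where \<phi>="\<lambda>t. t" and \<phi>'="\<lambda>t. 1"]) auto
    then show "(\<integral>\<^sup>+x. ennreal (\<bar>u x\<bar> powr q) \<partial>?M) < \<infinity>" by (rule order_le_less_trans) simp
  qed auto

  have am [measurable]: "a \<in> borel_measurable ?M"
    using a_Lr by (simp add: in_Lp_def set_borel_measurable_iff_lebesgue_on[OF \<Omega>L])
  have ar: "integrable ?M (\<lambda>x. \<bar>a x\<bar> powr r)"
    using a_Lr by (simp add: in_Lp_def set_integrable_iff_lebesgue_on[OF \<Omega>L])
  \<comment> \<open>V is made so that |g(x,u) - \<lambda> u| \<le> V |u| wherever |u| \<ge> 1. Its
    summand 1 lets it dominate the zero order part of the H^1 norm too.\<close>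
  define V where "V x = (1 + \<bar>lam\<bar>) + \<bar>a x\<bar> + \<bar>b\<bar> * \<bar>u x\<bar> powr (p - 2)" for x
  have Vm [measurable]: "V \<in> borel_measurable ?M" unfolding V_def by measurable
  have V1: "V x \<ge> 1" for x unfolding V_def by (simp add: add_nonneg_nonneg)
  \<comment> \<open>The integrability common to a, which is in L^r, and |u|^(p-2), which is in
    L^(q/(p-2)). Both exponents exceed q/(q-2), the first by the choice of q and the second because
    p < q.\<close>
  define s where "s = min r (q / (p - 2))"
  have s: "s > q / (q - 2)" "s \<le> r" "(p - 2) * s \<le> q" "s > 0"
  proof -
    have "q / (q - 2) < q / (p - 2)" using q p by (intro divide_strict_left_mono) auto
    then show 1: "s > q / (q - 2)" using q by (simp add: s_def)
    show "s \<le> r" by (simp add: s_def)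
    have "s \<le> q / (p - 2)" by (simp add: s_def)
    then show "(p - 2) * s \<le> q" using p by (simp add: pos_le_divide_eq mult.commute)
    show "s > 0" using 1 q2 by (smt (verit) divide_pos_pos)
  qed
  have iV: "integrable ?M (\<lambda>x. V x powr s)"
  proof (rule Bochner_Integration.integrable_bound)
    show "integrable ?M (\<lambda>x. 2 powr s * (2 powr s * ((1 + \<bar>lam\<bar>) powr s + (1 + \<bar>a x\<bar> powr r)) + \<bar>b\<bar> powr s * (1 + \<bar>u x\<bar> powr q)))"
      using ar uq by simp
    show "AE x in ?M. norm (V x powr s) \<le> norm (2 powr s * (2 powr s * ((1 + \<bar>lam\<bar>) powr s + (1 + \<bar>a x\<bar> powr r)) + \<bar>b\<bar> powr s * (1 + \<bar>u x\<bar> powr q)))"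
    proof (rule AE_I2)
      fix x
      have "(\<bar>u x\<bar> powr (p - 2)) powr s = \<bar>u x\<bar> powr ((p - 2) * s)" by (rule powr_powr)
      also have "\<dots> \<le> 1 + \<bar>u x\<bar> powr q" using s p by (intro powr_le_one_plus_powr) auto
      finally have 1: "(\<bar>b\<bar> * \<bar>u x\<bar> powr (p - 2)) powr s \<le> \<bar>b\<bar> powr s * (1 + \<bar>u x\<bar> powr q)"
        by (simp add: powr_mult mult_left_mono)
      have 2: "\<bar>a x\<bar> powr s \<le> 1 + \<bar>a x\<bar> powr r" using s by (intro powr_le_one_plus_powr) auto
      have "V x powr s \<le> 2 powr s * (((1 + \<bar>lam\<bar>) + \<bar>a x\<bar>) powr s + (\<bar>b\<bar> * \<bar>u x\<bar> powr (p - 2)) powr s)"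
        unfolding V_def using s by (intro powr_add_le) auto
      also have "\<dots> \<le> 2 powr s * (2 powr s * ((1 + \<bar>lam\<bar>) powr s + \<bar>a x\<bar> powr s) + (\<bar>b\<bar> * \<bar>u x\<bar> powr (p - 2)) powr s)"
        using s by (intro mult_left_mono add_right_mono powr_add_le) auto
      also have "\<dots> \<le> 2 powr s * (2 powr s * ((1 + \<bar>lam\<bar>) powr s + (1 + \<bar>a x\<bar> powr r)) + \<bar>b\<bar> powr s * (1 + \<bar>u x\<bar> powr q))"
        using 1 2 by (intro mult_left_mono add_mono) auto
      finally show "norm (V x powr s) \<le> norm (2 powr s * (2 powr s * ((1 + \<bar>lam\<bar>) powr s + (1 + \<bar>a x\<bar> powr r)) + \<bar>b\<bar> powr s * (1 + \<bar>u x\<bar> powr q)))"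
        by simp
    qed
  qed measurable
  have Vu: "integrable ?M (\<lambda>x. V x * (u x)\<^sup>2)"
  proof (rule holder_inequality_integral(1)[where P="q / (q - 2)" and Q="q / 2"])
    show "q / (q - 2) > 1" "q / 2 > 1" "1 / (q / (q - 2)) + 1 / (q / 2) = 1" using q2 by (auto simp: field_simps)
    show "integrable ?M (\<lambda>x. V x powr (q / (q - 2)))"
    proof (rule Bochner_Integration.integrable_bound[OF iV])
      show "AE x in ?M. norm (V x powr (q / (q - 2))) \<le> norm (V x powr s)"
        using V1 s by (intro AE_I2) (auto intro!: powr_mono)
    qed measurable
    have "((u x)\<^sup>2) powr (q / 2) = \<bar>u x\<bar> powr q" for x
    proof (cases "u x = 0")
      case False
      then have "(u x)\<^sup>2 = \<bar>u x\<bar> powr 2" by simp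
      then show ?thesis by (simp only: powr_powr) simp
    qed (use q2 in simp)
    then show "integrable ?M (\<lambda>x. ((u x)\<^sup>2) powr (q / 2))" using uq by simp
    show "V x \<ge> 0" for x using V1[of x] by linarith
  qed auto

  have g1M: "AE x in ?M. \<bar>g x (u x)\<bar> \<le> a x + b * \<bar>u x\<bar> powr (p - 1)"
    by (rule iffD2[OF AE_lebesgue_on_iff[OF \<Omega>L]]) (use g1 in eventually_elim, blast)
  define f where "f x = g x (u x) - lam * u x" for x
  have "set_borel_measurable lebesgue \<Omega> (\<lambda>x. g x (u x))"
    by (rule caratheodory_set_borel_measurable[OF g_meas g_cont su])
  then have [measurable]: "(\<lambda>x. g x (u x)) \<in> borel_measurable ?M"
    by (simp add: set_borel_measurable_iff_lebesgue_on[OF \<Omega>L])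
  have fm [measurable]: "f \<in> borel_measurable ?M" unfolding f_def by measurable
  have r1: "r > 1" using r N2 by simp
  \<comment> \<open>Plain integrability of f is what the bounded test functions require. The
    exponents 1, p - 1 and 1 that occur are at most r, q and q.\<close>
  have fi: "integrable ?M f"
  proof (rule Bochner_Integration.integrable_bound)
    show "integrable ?M (\<lambda>x. (1 + \<bar>a x\<bar> powr r) + \<bar>b\<bar> * (1 + \<bar>u x\<bar> powr q) + \<bar>lam\<bar> * (1 + \<bar>u x\<bar> powr q))"
      using ar uq by simp
    show "AE x in ?M. norm (f x) \<le> norm ((1 + \<bar>a x\<bar> powr r) + \<bar>b\<bar> * (1 + \<bar>u x\<bar> powr q) + \<bar>lam\<bar> * (1 + \<bar>u x\<bar> powr q))"
      using g1M
    proof eventually_elim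
      case (elim x)
      have 1: "\<bar>a x\<bar> \<le> 1 + \<bar>a x\<bar> powr r" using powr_le_one_plus_powr[of "\<bar>a x\<bar>" 1 r] r1 by simp
      have "\<bar>u x\<bar> powr (p - 1) \<le> 1 + \<bar>u x\<bar> powr q" using p q by (intro powr_le_one_plus_powr) auto
      then have 2: "\<bar>b\<bar> * \<bar>u x\<bar> powr (p - 1) \<le> \<bar>b\<bar> * (1 + \<bar>u x\<bar> powr q)" by (intro mult_left_mono) auto
      have "\<bar>u x\<bar> \<le> 1 + \<bar>u x\<bar> powr q" using powr_le_one_plus_powr[of "\<bar>u x\<bar>" 1 q] q2 by simp
      then have 3: "\<bar>lam\<bar> * \<bar>u x\<bar> \<le> \<bar>lam\<bar> * (1 + \<bar>u x\<bar> powr q)" by (intro mult_left_mono) auto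
      have 4: "b * \<bar>u x\<bar> powr (p - 1) \<le> \<bar>b\<bar> * \<bar>u x\<bar> powr (p - 1)" by (intro mult_right_mono) auto
      have "\<bar>f x\<bar> \<le> \<bar>g x (u x)\<bar> + \<bar>lam\<bar> * \<bar>u x\<bar>"
        unfolding f_def using abs_triangle_ineq4[of "g x (u x)" "lam * u x"] by (simp add: abs_mult)
      then have "\<bar>f x\<bar> \<le> (1 + \<bar>a x\<bar> powr r) + \<bar>b\<bar> * (1 + \<bar>u x\<bar> powr q) + \<bar>lam\<bar> * (1 + \<bar>u x\<bar> powr q)"
        using elim 1 2 3 4 by linarith
      then show ?case by simp
    qed
  qed measurable

  have eq: "(\<integral>x. F x \<bullet> gv x \<partial>?M) + 1/2 * (\<integral>x. v x * B x \<partial>?M) = (\<integral>x. f x * v x \<partial>?M)"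
    if "smooth_fun v" "has_grad v gv" for v gv
    using weak[OF that] unfolding set_integral_eq_lebesgue_on[OF \<Omega>L] F_def B_def H_def f_def .
  have coercive: "AE x in ?M. F x \<bullet> Du x \<ge> \<nu> * (norm (Du x))\<^sup>2"
    unfolding F_def by (rule iffD2[OF AE_lebesgue_on_iff[OF \<Omega>L]]) (use a2 in eventually_elim, blast)
  have sign: "AE x in ?M. \<bar>u x\<bar> \<ge> R \<longrightarrow> u x * B x \<ge> 0"
    unfolding B_def H_def by (rule iffD2[OF AE_lebesgue_on_iff[OF \<Omega>L]]) (use a3 in eventually_elim, blast)
  \<comment> \<open>Levels k \<ge> R bring in the sign condition (a.3), and k \<ge> 1 yields |u|
    \<ge> 1 on the set |u| > k, so that |a| may be replaced by |a| |u|.\<close>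
  have ineq: "(\<integral>x. (max 0 (\<bar>u x\<bar> - k)) powr q \<partial>?M) powr (2 / q)
      \<le> K powr (2 / q) * (1 + 1 / \<nu>) * (\<integral>x. V x * \<bar>u x\<bar> * max 0 (\<bar>u x\<bar> - k) \<partial>?M)"
    if k: "k \<ge> max R 1" for k
  proof (rule truncation_energy_inequality[OF \<Omega>B w W wae um Dm Fm _ D2 F2 Bi fi eq K q0 \<nu> coercive])
    show "k \<ge> 0" using k by simp
    show "AE x in ?M. \<bar>u x\<bar> > k \<longrightarrow> u x * B x \<ge> 0"
      using sign by eventually_elim (use k in auto)
    show "AE x in ?M. \<bar>u x\<bar> > k \<longrightarrow> \<bar>f x\<bar> \<le> V x * \<bar>u x\<bar>"
      using g1M
    proof (eventually_elim, intro impI)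
      fix x assume gx: "\<bar>g x (u x)\<bar> \<le> a x + b * \<bar>u x\<bar> powr (p - 1)" and ux: "\<bar>u x\<bar> > k"
      have u1: "\<bar>u x\<bar> \<ge> 1" using ux k by simp
      have 1: "\<bar>a x\<bar> * 1 \<le> \<bar>a x\<bar> * \<bar>u x\<bar>" using u1 by (intro mult_left_mono) auto
      have "\<bar>u x\<bar> powr (p - 2) * \<bar>u x\<bar> powr 1 = \<bar>u x\<bar> powr (p - 2 + 1)" by (rule powr_add[symmetric])
      then have "\<bar>u x\<bar> powr (p - 1) = \<bar>u x\<bar> powr (p - 2) * \<bar>u x\<bar>" using u1 by simp
      then have 2: "b * \<bar>u x\<bar> powr (p - 1) \<le> \<bar>b\<bar> * \<bar>u x\<bar> powr (p - 2) * \<bar>u x\<bar>"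
        by (simp add: mult.assoc mult_right_mono)
      have "\<bar>f x\<bar> \<le> \<bar>g x (u x)\<bar> + \<bar>lam\<bar> * \<bar>u x\<bar>"
        unfolding f_def using abs_triangle_ineq4[of "g x (u x)" "lam * u x"] by (simp add: abs_mult)
      then have "\<bar>f x\<bar> \<le> \<bar>a x\<bar> * \<bar>u x\<bar> + \<bar>b\<bar> * \<bar>u x\<bar> powr (p - 2) * \<bar>u x\<bar> + \<bar>lam\<bar> * \<bar>u x\<bar>"
        using gx 1 2 by linarith
      also have "\<dots> \<le> V x * \<bar>u x\<bar>" by (simp add: V_def algebra_simps)
      finally show "\<bar>f x\<bar> \<le> V x * \<bar>u x\<bar>" .
    qed
  qed (use V1 Vu in auto)
  have C0: "0 \<le> K powr (2 / q) * (1 + 1 / \<nu>)" using \<nu> by (intro mult_nonneg_nonneg) auto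
  obtain M where "AE x in ?M. \<bar>u x\<bar> \<le> M"
    by (rule stampacchia_essentially_bounded[OF fin um Vm V1 q2 s(1) iV uq C0 ineq])
  then have "AE x in lebesgue. x \<in> \<Omega> \<longrightarrow> \<bar>u x\<bar> \<le> M" by (rule iffD1[OF AE_lebesgue_on_iff[OF \<Omega>L]])
  then show ?thesis using su unfolding in_Linf_def by blast
qed

end
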